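(* Let $\Delta\ge 3$, $c\in[0,\Delta-2]$ and $\kappa=\Delta+c$. There exist a forest of maximum degree at most $\Delta$ on $n$ vertices with a proper $\kappa$-edge-coloring, and a fully dynamic update sequence from this state, such that from this state onward the amortized recourse of {\textsc{GreedyShift}} and of {\textsc{GreedyPath}} is $\Omega\!\left(\log_{c+2}\frac{n}{\Delta-c}\right)$. Moreover, there exists $n_2=n_2(\Delta,c)$ such that for every $n\ge n_2$ this bad state can be reached from the empty graph.
   Context: A dynamic forest on $n$ fixed vertices undergoes insertions of edges joining two distinct trees and deletions of edges (fully dynamic model), with maximum degree always at most $\Delta$; a proper edge coloring with palette $[\kappa]$ must be maintained. Recourse of an update is the number of previously colored edges whose color changes; amortized recourse is total recourse divided by number of updates. A shift chain for an inserted edge $e$: starting with current uncolored edge $e'=(u,v)=e$, assign $e'$ a color available at $u$ or at $v$; if available at both stop; otherwise uncolor the conflicting edge at the other endpoint and repeat with it. {\textsc{GreedyShift}} performs on each insertion a shift chain recoloring the fewest existing edges; {\textsc{GreedyPath}} does the same restricted to chains whose recolored edges form a path; both use deterministic tie-breaking and keep the coloring unchanged on deletions. *)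

theory Defs
  imports Complex_Main
begin

text \<open>Vertices are the natural numbers below \<open>n\<close>; an edge is a two-element set of vertices, and
  a graph on \<open>n\<close> vertices is given by its set of edges.\<close>

type_synonym edge = "nat set"

definition graph_on :: "nat \<Rightarrow> edge set \<Rightarrow> bool" where
  "graph_on n E \<longleftrightarrow> (\<forall>e\<in>E. e \<subseteq> {..<n} \<and> card e = 2)"

definition is_cycle :: "edge set \<Rightarrow> nat list \<Rightarrow> bool" where
  "is_cycle E vs \<longleftrightarrow> 3 \<le> length vs \<and> distinct vs \<and>
     (\<forall>i<length vs. {vs ! i, vs ! (Suc i mod length vs)} \<in> E)"

definition forest :: "nat \<Rightarrow> edge set \<Rightarrow> bool" where
  "forest n E \<longleftrightarrow> graph_on n E \<and> (\<nexists>vs. is_cycle E vs)"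

definition degree :: "edge set \<Rightarrow> nat \<Rightarrow> nat" where
  "degree E v = card {e \<in> E. v \<in> e}"

definition max_degree_le :: "nat \<Rightarrow> nat \<Rightarrow> edge set \<Rightarrow> bool" where
  "max_degree_le n \<Delta> E \<longleftrightarrow> (\<forall>v<n. degree E v \<le> \<Delta>)"

definition same_tree :: "edge set \<Rightarrow> nat \<Rightarrow> nat \<Rightarrow> bool" where
  "same_tree E u v \<longleftrightarrow> (u, v) \<in> {(x, y). {x, y} \<in> E}\<^sup>*"

text \<open>A coloring is a partial map, undefined on uncolored edges and on non-edges. Between two
  updates every edge is colored, so the coloring \<open>\<phi>\<close> determines the state: the current forest
  is \<open>dom \<phi>\<close>.\<close>

type_synonym coloring = "edge \<rightharpoonup> nat"

definition proper_edge_coloring :: "nat \<Rightarrow> edge set \<Rightarrow> coloring \<Rightarrow> bool" where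
  "proper_edge_coloring \<kappa> E \<phi> \<longleftrightarrow> dom \<phi> = E \<and> ran \<phi> \<subseteq> {1..\<kappa>} \<and>
     (\<forall>e\<in>E. \<forall>f\<in>E. e \<noteq> f \<and> e \<inter> f \<noteq> {} \<longrightarrow> \<phi> e \<noteq> \<phi> f)"

definition colored_forest :: "nat \<Rightarrow> nat \<Rightarrow> nat \<Rightarrow> coloring \<Rightarrow> bool" where
  "colored_forest n \<Delta> \<kappa> \<phi> \<longleftrightarrow>
     forest n (dom \<phi>) \<and> max_degree_le n \<Delta> (dom \<phi>) \<and> proper_edge_coloring \<kappa> (dom \<phi>) \<phi>"

definition available :: "nat \<Rightarrow> coloring \<Rightarrow> nat \<Rightarrow> nat set" where
  "available \<kappa> \<phi> v = {1..\<kappa>} - {a. \<exists>f. v \<in> f \<and> \<phi> f = Some a}"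

text \<open>\<open>shift_chain \<kappa> \<phi> e es \<psi>\<close>: a shift chain starting from the partial coloring \<open>\<phi>\<close> with current
  uncolored edge \<open>e\<close> assigns colors, in this order, to the edges \<open>es\<close> (the head of \<open>es\<close> is \<open>e\<close>)
  and ends in \<open>\<psi>\<close>. The names of the two ends of \<open>e\<close> may be exchanged, so the color chosen in
  \<open>shift\<close> may be available at either end.\<close>

inductive shift_chain :: "nat \<Rightarrow> coloring \<Rightarrow> edge \<Rightarrow> edge list \<Rightarrow> coloring \<Rightarrow> bool" for \<kappa> where
  stop: "\<lbrakk>e = {u, v}; u \<noteq> v; a \<in> available \<kappa> \<phi> u; a \<in> available \<kappa> \<phi> v\<rbrakk>
    \<Longrightarrow> shift_chain \<kappa> \<phi> e [e] (\<phi>(e \<mapsto> a))"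
| shift: "\<lbrakk>e = {u, v}; u \<noteq> v; a \<in> available \<kappa> \<phi> u; a \<notin> available \<kappa> \<phi> v;
      v \<in> f; \<phi> f = Some a; shift_chain \<kappa> (\<phi>(f := None, e \<mapsto> a)) f es \<psi>\<rbrakk>
    \<Longrightarrow> shift_chain \<kappa> \<phi> e (e # es) \<psi>"

text \<open>Inserted and deleted edges do not count: only edges colored both before and after the update
  can change their color.\<close>

definition recourse :: "coloring \<Rightarrow> coloring \<Rightarrow> nat" where
  "recourse \<phi> \<psi> = card {f \<in> dom \<phi> \<inter> dom \<psi>. \<phi> f \<noteq> \<psi> f}"

definition form_path :: "edge list \<Rightarrow> bool" where
  "form_path es \<longleftrightarrow> (\<exists>vs. distinct vs \<and> length vs = Suc (length es) \<and>
     (\<forall>i<length es. es ! i = {vs ! i, vs ! Suc i}))"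

datatype update = Insert edge | Delete edge

fun update_edges :: "edge set \<Rightarrow> update \<Rightarrow> edge set" where
  "update_edges E (Insert e) = insert e E"
| "update_edges E (Delete e) = E - {e}"

fun legal_update :: "nat \<Rightarrow> nat \<Rightarrow> edge set \<Rightarrow> update \<Rightarrow> bool" where
  "legal_update n \<Delta> E (Insert e) \<longleftrightarrow>
     (\<exists>u v. e = {u, v} \<and> u < n \<and> v < n \<and> \<not> same_tree E u v) \<and> max_degree_le n \<Delta> (insert e E)"
| "legal_update n \<Delta> E (Delete e) \<longleftrightarrow> e \<in> E"

text \<open>An insertion algorithm with deterministic tie-breaking maps the current state and the inserted
  edge to the new state. \<open>greedy admissible\<close> says that it performs a chain with the fewest recolored
  existing edges among the admissible ones; how ties are broken is left arbitrary.\<close>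

type_synonym algorithm = "coloring \<Rightarrow> edge \<Rightarrow> coloring"

definition greedy :: "(edge list \<Rightarrow> bool) \<Rightarrow> nat \<Rightarrow> nat \<Rightarrow> nat \<Rightarrow> algorithm \<Rightarrow> bool" where
  "greedy admissible n \<Delta> \<kappa> alg \<longleftrightarrow>
     (\<forall>\<phi> e. colored_forest n \<Delta> \<kappa> \<phi> \<and> legal_update n \<Delta> (dom \<phi>) (Insert e) \<longrightarrow>
        (\<exists>es. admissible es \<and> shift_chain \<kappa> \<phi> e es (alg \<phi> e)) \<and>
        (\<forall>es \<psi>. admissible es \<and> shift_chain \<kappa> \<phi> e es \<psi> \<longrightarrow>
           recourse \<phi> (alg \<phi> e) \<le> recourse \<phi> \<psi>))"

definition greedy_shift :: "nat \<Rightarrow> nat \<Rightarrow> nat \<Rightarrow> algorithm \<Rightarrow> bool" where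
  "greedy_shift = greedy (\<lambda>es. True)"

text \<open>The path contains the inserted edge, from which the chain starts.\<close>

definition greedy_path :: "nat \<Rightarrow> nat \<Rightarrow> nat \<Rightarrow> algorithm \<Rightarrow> bool" where
  "greedy_path = greedy form_path"

fun apply_update :: "algorithm \<Rightarrow> coloring \<Rightarrow> update \<Rightarrow> coloring" where
  "apply_update alg \<phi> (Insert e) = alg \<phi> e"
| "apply_update alg \<phi> (Delete e) = \<phi>(e := None)"

primrec run :: "algorithm \<Rightarrow> coloring \<Rightarrow> (nat \<Rightarrow> update) \<Rightarrow> nat \<Rightarrow> coloring" where
  "run alg \<phi> \<sigma> 0 = \<phi>"
| "run alg \<phi> \<sigma> (Suc t) = apply_update alg (run alg \<phi> \<sigma> t) (\<sigma> t)"

primrec edges_at :: "edge set \<Rightarrow> (nat \<Rightarrow> update) \<Rightarrow> nat \<Rightarrow> edge set" where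
  "edges_at E \<sigma> 0 = E"
| "edges_at E \<sigma> (Suc t) = update_edges (edges_at E \<sigma> t) (\<sigma> t)"

definition legal_updates :: "nat \<Rightarrow> nat \<Rightarrow> edge set \<Rightarrow> (nat \<Rightarrow> update) \<Rightarrow> nat \<Rightarrow> bool" where
  "legal_updates n \<Delta> E \<sigma> T \<longleftrightarrow> (\<forall>t<T. legal_update n \<Delta> (edges_at E \<sigma> t) (\<sigma> t))"

definition amortized_recourse :: "algorithm \<Rightarrow> coloring \<Rightarrow> (nat \<Rightarrow> update) \<Rightarrow> nat \<Rightarrow> real" where
  "amortized_recourse alg \<phi> \<sigma> T =
     (\<Sum>t<T. real (recourse (run alg \<phi> \<sigma> t) (run alg \<phi> \<sigma> (Suc t)))) / real T"

definition reachable_from_empty :: "nat \<Rightarrow> nat \<Rightarrow> algorithm \<Rightarrow> coloring \<Rightarrow> bool" where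
  "reachable_from_empty n \<Delta> alg \<phi> \<longleftrightarrow>
     (\<exists>\<sigma> T. legal_updates n \<Delta> {} \<sigma> T \<and> run alg Map.empty \<sigma> T = \<phi>)"

end

theory Submission
  imports Defs "HOL-Library.FuncSet" "HOL-Library.Disjoint_Sets"
begin

text \<open>The \<open>2c + 2\<close> active colors are split into two halves. In the bad forest a spine and deep
  side trees are colored such that below every vertex all colors of one half occur, the two halves
  alternating with the distance from the inserted edge. When this edge joins the first two vertices
  of the spine, a shift chain moves an uncolored edge (the hole) through the forest. At every
  interior vertex the colors available at the two ends of the hole stay disjoint, so the chain can
  only stop at the end of the spine or at the even deeper leaves of the side trees. The unique
  cheapest chain shifts the colors of the spine by one edge. The result is the mirror image of the
  initial forest, so after deleting the new edge an insertion at the other end of the spine shifts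
  everything back, and this repeats forever.

  Every colored forest with enough isolated vertices can be reached from the empty graph, for any
  tie-breaking: a leaf edge gets the only color that is missing at both ends once stars with suitable
  colors have been attached there temporarily. Stars with prescribed colors are obtained one color
  at a time: by the pigeonhole principle there are many stars with the same colors, and joining them
  one after the other to a fresh vertex exhausts all undesired colors.\<close>

section \<open>Forests and edge colorings\<close>

text \<open>The sizes are forced: with \<open>K\<close> = c + 1 colors in each half and
  \<open>g\<close> = \<Delta> - c - 2 pendant colors, \<open>K + g + 1\<close> = \<Delta> and
  \<open>2 * K + g\<close> = \<Delta> + c. An interior vertex at the hole has at most \<Delta> - 1
  colored edges, and its own half together with the pendant colors uses them up, so the colors that
  it misses are exactly the other half. Tie-breaking is arbitrary, so it is not known which chain is
  performed; the argument constrains every chain by an invariant of the partial coloring and reads a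
  lower bound for its cost off the place where it stops. To make every wrong exit dearer than the
  \<open>m - 1\<close> recolored spine edges, side trees of depth \<open>m\<close> hang at each of
  the \<open>m + 2\<close> spine vertices, about (c + 1)^m vertices apiece and up to \<Delta> - c -
  2 pendant leaves at each; inverting this count gives the logarithm of n / (\<Delta> - c). The
  length \<open>m\<close> is odd so that mirroring the spine preserves the parity that decides
  between the halves.\<close>

definition col :: "coloring \<Rightarrow> nat \<Rightarrow> nat set" where
  "col \<phi> v = {a. \<exists>f. v \<in> f \<and> \<phi> f = Some a}"

lemma available_eq: "available \<kappa> \<phi> v = {1..\<kappa>} - col \<phi> v"
  by (simp add: available_def col_def)

lemma colI: "v \<in> f \<Longrightarrow> \<phi> f = Some a \<Longrightarrow> a \<in> col \<phi> v"
  by (auto simp: col_def)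

lemma graph_on_subset: "graph_on n E \<Longrightarrow> E' \<subseteq> E \<Longrightarrow> graph_on n E'"
  by (auto simp: graph_on_def)

lemma graph_on_finite: "graph_on n E \<Longrightarrow> finite E"
  by (rule finite_subset[of _ "Pow {..<n}"]) (auto simp: graph_on_def)

lemma is_cycle_mono: "is_cycle E vs \<Longrightarrow> E \<subseteq> E' \<Longrightarrow> is_cycle E' vs"
  by (auto simp: is_cycle_def)

lemma forest_subset: "forest n E \<Longrightarrow> E' \<subseteq> E \<Longrightarrow> forest n E'"
  unfolding forest_def using graph_on_subset is_cycle_mono by blast

text \<open>Lets any chosen edge of a cycle become the closing one, from the last entry of the list
  back to the first.\<close>

lemma is_cycle_rotate:
  assumes "is_cycle E vs"
  shows "is_cycle E (rotate k vs)"
proof -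
  let ?N = "length vs"
  have N: "3 \<le> ?N" and d: "distinct vs"
    and e: "\<And>i. i < ?N \<Longrightarrow> {vs ! i, vs ! (Suc i mod ?N)} \<in> E"
    using assms by (auto simp: is_cycle_def)
  have "{rotate k vs ! i, rotate k vs ! (Suc i mod ?N)} \<in> E" if "i < ?N" for i
  proof -
    have "rotate k vs ! i = vs ! ((k + i) mod ?N)" using that by (simp add: nth_rotate)
    moreover have "rotate k vs ! (Suc i mod ?N) = vs ! ((k + Suc i mod ?N) mod ?N)"
      using N that by (intro nth_rotate mod_less_divisor) linarith
    moreover have "(k + Suc i mod ?N) mod ?N = Suc ((k + i) mod ?N) mod ?N"
      by (simp add: mod_simps)
    moreover have "(k + i) mod ?N < ?N" using N by (intro mod_less_divisor) auto
    ultimately show ?thesis using e by metis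
  qed
  with N d show ?thesis by (simp add: is_cycle_def)
qed

lemma same_tree_sym: "same_tree E u v \<Longrightarrow> same_tree E v u"
proof -
  have "sym {(x, y). {x, y} \<in> E}" by (auto simp: sym_def insert_commute)
  then show "same_tree E u v \<Longrightarrow> same_tree E v u"
    unfolding same_tree_def by (metis sym_rtrancl symE)
qed

text \<open>A new cycle must use \<open>{u, v}\<close>. Once it is rotated so that this edge closes
  the list, the other consecutive pairs are edges of \<open>E\<close> and connect \<open>u\<close>
  to \<open>v\<close>, against the hypothesis.\<close>

lemma forest_insert:
  assumes F: "forest n E" and uv: "u < n" "v < n" and nt: "\<not> same_tree E u v"
  shows "forest n (insert {u, v} E)"
proof -
  have "u \<noteq> v" using nt by (auto simp: same_tree_def)
  then have "graph_on n (insert {u, v} E)"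
    using F uv by (auto simp: forest_def graph_on_def)
  moreover have False if cyc: "is_cycle (insert {u, v} E) vs" for vs
  proof -
    have "\<not> is_cycle E vs" using F by (auto simp: forest_def)
    with cyc obtain i where i: "i < length vs" "{vs ! i, vs ! (Suc i mod length vs)} = {u, v}"
      by (auto simp: is_cycle_def)
    define ws where "ws = rotate (Suc i) vs"
    define N where "N = length vs"
    have ws: "is_cycle (insert {u, v} E) ws" "length ws = N" "distinct ws"
      using is_cycle_rotate[OF cyc, of "Suc i"] cyc unfolding ws_def N_def
      by (simp_all add: is_cycle_def del: insert_iff)
    have N: "3 \<le> N" using cyc by (auto simp: is_cycle_def N_def)
    have w0: "ws ! 0 = vs ! (Suc i mod N)"
      unfolding ws_def N_def using i by (subst nth_rotate) auto
    have wN: "ws ! (N - 1) = vs ! i"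
    proof -
      have "(Suc i + (N - 1)) mod N = i"
      proof -
        have "Suc i + (N - 1) = i + N" using N by simp
        then show ?thesis using i by (simp add: N_def)
      qed
      then show ?thesis unfolding ws_def using N by (subst nth_rotate) (auto simp: N_def)
    qed
    have uvw: "{u, v} = {ws ! (N - 1), ws ! 0}" using i w0 wN by (simp add: N_def)
    have "same_tree E (ws ! 0) (ws ! k)" if "k \<le> N - 1" for k
      using that
    proof (induction k)
      case 0 show ?case by (simp add: same_tree_def)
    next
      case (Suc k)
      have "k < N" "Suc k mod N = Suc k" using Suc.prems N by simp_all
      then have "{ws ! k, ws ! Suc k} \<in> insert {u, v} E"
        using ws unfolding is_cycle_def by metis
      moreover have "{ws ! k, ws ! Suc k} \<noteq> {u, v}"
      proof
        assume "{ws ! k, ws ! Suc k} = {u, v}"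
        then have "ws ! k = ws ! (N - 1) \<or> ws ! k = ws ! 0 \<and> ws ! Suc k = ws ! (N - 1)"
          using uvw by (auto simp: doubleton_eq_iff)
        then show False
          using ws Suc.prems N by (auto simp: nth_eq_iff_index_eq)
      qed
      ultimately have "{ws ! k, ws ! Suc k} \<in> E" by simp
      with Suc show ?case unfolding same_tree_def by (auto intro: rtrancl_into_rtrancl)
    qed
    from this[of "N - 1"] have "same_tree E (ws ! 0) (ws ! (N - 1))" by simp
    with uvw nt same_tree_sym show False by (auto simp: doubleton_eq_iff)
  qed
  ultimately show ?thesis by (auto simp: forest_def)
qed

text \<open>A union of connected components. A set of this kind that contains one vertex and misses
  the other is the certificate by which trees are shown to be distinct.\<close>

definition closed_zone :: "coloring \<Rightarrow> nat set \<Rightarrow> bool" where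
  "closed_zone \<phi> Z \<longleftrightarrow> (\<forall>f\<in>dom \<phi>. f \<inter> Z \<noteq> {} \<longrightarrow> f \<subseteq> Z)"

lemma closed_zone_not_same_tree:
  assumes "closed_zone \<phi> Z" "u \<in> Z" "v \<notin> Z"
  shows "\<not> same_tree (dom \<phi>) u v"
proof
  assume "same_tree (dom \<phi>) u v"
  then have "(u, v) \<in> {(x, y). {x, y} \<in> dom \<phi>}\<^sup>*" by (simp add: same_tree_def)
  then have "v \<in> Z"
  proof induction
    case base then show ?case using assms by simp
  next
    case (step y z)
    then have "{y, z} \<in> dom \<phi>" "{y, z} \<inter> Z \<noteq> {}" by auto
    then have "{y, z} \<subseteq> Z" using assms(1) unfolding closed_zone_def by metis
    then show ?case by simp
  qed
  with assms show False by simp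
qed

section \<open>Proper colorings described by the colors seen at each vertex\<close>

lemma proper_dom: "proper_edge_coloring \<kappa> E \<phi> \<Longrightarrow> dom \<phi> = E"
  by (simp add: proper_edge_coloring_def)

lemma proper_inj:
  assumes p: "proper_edge_coloring \<kappa> E \<phi>" and fg: "\<phi> f = Some a" "\<phi> g = Some a" "v \<in> f" "v \<in> g"
  shows "f = g"
proof (rule ccontr)
  assume "f \<noteq> g"
  moreover have "f \<in> E" "g \<in> E" using p fg by (auto simp: proper_edge_coloring_def)
  moreover have "f \<inter> g \<noteq> {}" using fg by blast
  ultimately have "\<phi> f \<noteq> \<phi> g" using p by (simp add: proper_edge_coloring_def)
  with fg show False by simp
qed

lemma proper_range:
  assumes "proper_edge_coloring \<kappa> E \<phi>" and "\<phi> f = Some a"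
  shows "a \<in> {1..\<kappa>}"
proof -
  have "ran \<phi> \<subseteq> {1..\<kappa>}" using assms(1) by (simp add: proper_edge_coloring_def)
  with ranI[of \<phi> f a] assms(2) show ?thesis by blast
qed

lemma col_subset: "proper_edge_coloring \<kappa> E \<phi> \<Longrightarrow> col \<phi> v \<subseteq> {1..\<kappa>}"
  unfolding col_def using proper_range[of \<kappa> E \<phi>] by blast

lemma finite_col: "proper_edge_coloring \<kappa> E \<phi> \<Longrightarrow> finite (col \<phi> v)"
  by (rule finite_subset[OF col_subset]) auto

text \<open>At a fixed vertex a proper coloring is a bijection from incident edges to colors, so
  degree bounds can be stated as bounds on \<open>card (col \<phi> v)\<close>.\<close>

lemma degree_eq_card_col:
  assumes "proper_edge_coloring \<kappa> (dom \<phi>) \<phi>"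
  shows "degree (dom \<phi>) v = card (col \<phi> v)"
proof -
  have "bij_betw (\<lambda>f. the (\<phi> f)) {e \<in> dom \<phi>. v \<in> e} (col \<phi> v)"
    unfolding bij_betw_def
  proof
    show "inj_on (\<lambda>f. the (\<phi> f)) {e \<in> dom \<phi>. v \<in> e}"
    proof (rule inj_onI)
      fix f g assume fg: "f \<in> {e \<in> dom \<phi>. v \<in> e}" "g \<in> {e \<in> dom \<phi>. v \<in> e}"
        "the (\<phi> f) = the (\<phi> g)"
      then have "\<phi> f = Some (the (\<phi> f))" "\<phi> g = Some (the (\<phi> f))" by auto
      with fg proper_inj[OF assms] show "f = g" by blast
    qed
    show "(\<lambda>f. the (\<phi> f)) ` {e \<in> dom \<phi>. v \<in> e} = col \<phi> v"
      by (force simp: col_def)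
  qed
  then show ?thesis unfolding degree_def by (rule bij_betw_same_card)
qed

lemma proper_edge_coloringI:
  assumes "\<And>f a. \<phi> f = Some a \<Longrightarrow> a \<in> {1..\<kappa>}"
    and "\<And>f g a v. \<lbrakk>\<phi> f = Some a; \<phi> g = Some a; v \<in> f; v \<in> g\<rbrakk> \<Longrightarrow> f = g"
  shows "proper_edge_coloring \<kappa> (dom \<phi>) \<phi>"
  unfolding proper_edge_coloring_def
proof (intro conjI ballI impI)
  show "ran \<phi> \<subseteq> {1..\<kappa>}" using assms(1) unfolding ran_def by blast
next
  fix f g assume "f \<in> dom \<phi>" "g \<in> dom \<phi>" and fg: "f \<noteq> g \<and> f \<inter> g \<noteq> {}"
  then obtain a where a: "\<phi> f = Some a" by blast
  show "\<phi> f \<noteq> \<phi> g"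
  proof
    assume "\<phi> f = \<phi> g"
    with a have "\<phi> g = Some a" by simp
    moreover obtain v where "v \<in> f" "v \<in> g" using fg by blast
    ultimately have "f = g" using assms(2)[OF a] by metis
    with fg show False by simp
  qed
qed simp

lemma proper_restrict:
  assumes p: "proper_edge_coloring \<kappa> (dom \<phi>) \<phi>"
  shows "proper_edge_coloring \<kappa> (dom (\<phi> |` D)) (\<phi> |` D)"
proof (rule proper_edge_coloringI)
  have sub: "\<phi> f = Some a" if "(\<phi> |` D) f = Some a" for f a
    using that by (simp add: restrict_map_def split: if_splits)
  show "a \<in> {1..\<kappa>}" if "(\<phi> |` D) f = Some a" for f a
    by (rule proper_range[OF p sub[OF that]])
  show "f = g" if "(\<phi> |` D) f = Some a" "(\<phi> |` D) g = Some a" "v \<in> f" "v \<in> g" for f g a v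
    by (rule proper_inj[OF p sub sub]) (use that in auto)
qed

lemma degree_mono: "finite E \<Longrightarrow> E' \<subseteq> E \<Longrightarrow> degree E' v \<le> degree E v"
  unfolding degree_def by (rule card_mono) auto

lemma colored_forest_proper:
  "colored_forest n \<Delta> \<kappa> \<phi> \<Longrightarrow> proper_edge_coloring \<kappa> (dom \<phi>) \<phi>"
  by (simp add: colored_forest_def)

lemma colored_forest_graph: "colored_forest n \<Delta> \<kappa> \<phi> \<Longrightarrow> graph_on n (dom \<phi>)"
  by (simp add: colored_forest_def forest_def)

lemma colored_forest_finite: "colored_forest n \<Delta> \<kappa> \<phi> \<Longrightarrow> finite (dom \<phi>)"
  using colored_forest_graph graph_on_finite by blast

lemma colored_forest_restrict:
  assumes "colored_forest n \<Delta> \<kappa> \<phi>"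
  shows "colored_forest n \<Delta> \<kappa> (\<phi> |` D)"
proof -
  have fin: "finite (dom \<phi>)" using assms by (rule colored_forest_finite)
  have deg: "degree (dom \<phi> \<inter> D) v \<le> \<Delta>" if "v < n" for v
  proof -
    have "degree (dom \<phi> \<inter> D) v \<le> degree (dom \<phi>) v"
      by (rule degree_mono) (use fin in auto)
    also have "\<dots> \<le> \<Delta>"
      using assms that by (simp add: colored_forest_def max_degree_le_def)
    finally show ?thesis .
  qed
  have "forest n (dom \<phi> \<inter> D)"
    by (rule forest_subset[of _ "dom \<phi>"]) (use assms in \<open>auto simp: colored_forest_def\<close>)
  with deg proper_restrict[OF colored_forest_proper[OF assms], of D] show ?thesis
    by (simp add: colored_forest_def max_degree_le_def)
qed

lemma availableD: "a \<in> available \<kappa> \<phi> v \<Longrightarrow> v \<in> f \<Longrightarrow> \<phi> f \<noteq> Some a"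
  unfolding available_def by blast

lemma available_range: "a \<in> available \<kappa> \<phi> v \<Longrightarrow> a \<in> {1..\<kappa>}"
  unfolding available_def by blast

text \<open>The edge \<open>f\<close> is the only one colored \<open>a\<close> that meets
  \<open>e\<close>: at \<open>u\<close> the color is free, and at \<open>v\<close> properness admits
  one such edge. Uncoloring \<open>f\<close> makes room for \<open>a\<close> on
  \<open>e\<close>.\<close>

lemma shift_proper:
  assumes p: "proper_edge_coloring \<kappa> (dom \<phi>) \<phi>" and e: "e = {u, v}"
    and a: "a \<in> available \<kappa> \<phi> u" and f: "v \<in> f" "\<phi> f = Some a"
  shows "proper_edge_coloring \<kappa> (dom (\<phi>(f := None, e \<mapsto> a))) (\<phi>(f := None, e \<mapsto> a))"
proof (rule proper_edge_coloringI)
  have ne: "g = f" if "\<phi> g = Some a" "x \<in> g" "x \<in> e" for g x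
  proof -
    from that e consider "x = u" | "x = v" by blast
    then show ?thesis
    proof cases
      case 1 with that a availableD show ?thesis by metis
    next
      case 2 with that f proper_inj[OF p] show ?thesis by metis
    qed
  qed
  show "b \<in> {1..\<kappa>}" if "(\<phi>(f := None, e \<mapsto> a)) g = Some b" for g b
    using that proper_range[OF p, of g b] available_range[OF a]
    by (simp only: fun_upd_apply split: if_splits) simp_all
  show "g = h" if "(\<phi>(f := None, e \<mapsto> a)) g = Some b" "(\<phi>(f := None, e \<mapsto> a)) h = Some b"
    "x \<in> g" "x \<in> h" for g h b x
    using that ne[of h x] ne[of g x] proper_inj[OF p, of g b h x]
    by (simp only: fun_upd_apply split: if_splits) simp_all
qed

lemma stop_proper:
  assumes p: "proper_edge_coloring \<kappa> (dom \<phi>) \<phi>" and e: "e = {u, v}"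
    and a: "a \<in> available \<kappa> \<phi> u" "a \<in> available \<kappa> \<phi> v"
  shows "proper_edge_coloring \<kappa> (dom (\<phi>(e \<mapsto> a))) (\<phi>(e \<mapsto> a))"
proof (rule proper_edge_coloringI)
  have ne: "\<phi> g \<noteq> Some a" if "x \<in> g" "x \<in> e" for g x
    using that e a availableD by blast
  show "b \<in> {1..\<kappa>}" if "(\<phi>(e \<mapsto> a)) g = Some b" for g b
    using that proper_range[OF p, of g b] available_range[OF a(1)]
    by (simp only: fun_upd_apply split: if_splits) simp_all
  show "g = h" if "(\<phi>(e \<mapsto> a)) g = Some b" "(\<phi>(e \<mapsto> a)) h = Some b"
    "x \<in> g" "x \<in> h" for g h b x
    using that ne[of x h] ne[of x g] proper_inj[OF p, of g b h x]
    by (simp only: fun_upd_apply split: if_splits) simp_all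
qed

lemma dom_color: "dom (\<phi>(e \<mapsto> b)) = insert e (dom \<phi>)"
  by (simp add: dom_fun_upd)

lemma dom_shift: "\<phi> f = Some a \<Longrightarrow> e \<noteq> f \<Longrightarrow> dom (\<phi>(f := None, e \<mapsto> b)) = insert e (dom \<phi> - {f})"
  by (simp add: dom_fun_upd)

lemma shift_chain_proper:
  assumes "shift_chain \<kappa> \<phi> e es \<psi>" "proper_edge_coloring \<kappa> (dom \<phi>) \<phi>" "e \<notin> dom \<phi>"
  shows "dom \<psi> = insert e (dom \<phi>) \<and> proper_edge_coloring \<kappa> (dom \<psi>) \<psi>"
  using assms
proof induction
  case (stop e u v a \<phi>)
  show ?case
    by (rule conjI[OF _ stop_proper[OF stop.prems(1) stop.hyps(1,3,4)]]) (rule dom_color)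
next
  case (shift e u v a \<phi> f es \<psi>)
  let ?\<phi> = "\<phi>(f := None, e \<mapsto> a)"
  have ne: "e \<noteq> f" using shift.hyps(6) shift.prems(2) by (metis domI)
  have d: "dom ?\<phi> = insert e (dom \<phi> - {f})" by (rule dom_shift[of \<phi> f a, OF shift.hyps(6) ne])
  have "f \<notin> dom ?\<phi>" unfolding d using ne by blast
  note IH = shift.IH[OF shift_proper[OF shift.prems(1) shift.hyps(1,3,5,6)] this]
  have dom_IH: "dom \<psi> = insert f (dom ?\<phi>)" by (rule conjunct1[OF IH])
  have "f \<in> dom \<phi>" using shift.hyps(6) by blast
  then have "insert f (insert e (dom \<phi> - {f})) = insert e (dom \<phi>)" by blast
  then have "dom \<psi> = insert e (dom \<phi>)" by (simp only: dom_IH d)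
  then show ?case by (rule conjI[OF _ conjunct2[OF IH]])
qed

section \<open>Insertions without recourse\<close>

text \<open>An existential one-step relation, so that reachability composes freely by transitivity;
  an explicit update sequence is extracted only once, in \<open>reach_run\<close>.\<close>

definition update_step :: "nat \<Rightarrow> nat \<Rightarrow> algorithm \<Rightarrow> coloring \<Rightarrow> coloring \<Rightarrow> bool" where
  "update_step n \<Delta> alg \<phi> \<psi> \<longleftrightarrow>
     (\<exists>u. legal_update n \<Delta> (dom \<phi>) u \<and> \<psi> = apply_update alg \<phi> u)"

definition spare :: "coloring \<Rightarrow> nat set \<Rightarrow> bool" where
  "spare \<phi> Z \<longleftrightarrow> (\<forall>f\<in>dom \<phi>. f \<inter> Z = {})"

definition changes_in :: "nat set \<Rightarrow> coloring \<Rightarrow> coloring \<Rightarrow> bool" where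
  "changes_in Z \<phi> \<psi> \<longleftrightarrow> (\<forall>f. \<not> f \<subseteq> Z \<longrightarrow> \<psi> f = \<phi> f)"

text \<open>Number of isolated vertices that suffice for a star with \<open>p\<close> prescribed
  colors. There are 2 ^ (\<Delta> + c) color sets, so among \<open>Suc c\<close> times as many
  copies for one color less some set occurs at least c + 1 times. Each copy gets \<Delta> further
  vertices for padding, and the final 1 is the vertex to which equal copies are joined.\<close>

primrec gadget_size :: "nat \<Rightarrow> nat \<Rightarrow> nat \<Rightarrow> nat" where
  "gadget_size \<Delta> c 0 = 1"
| "gadget_size \<Delta> c (Suc p) = (Suc c * 2 ^ (\<Delta> + c)) * (gadget_size \<Delta> c p + \<Delta>) + 1"

lemma gadget_size_mono: "p \<le> q \<Longrightarrow> gadget_size \<Delta> c p \<le> gadget_size \<Delta> c q"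
proof (rule lift_Suc_mono_le[of "gadget_size \<Delta> c"])
  fix p
  have "1 * gadget_size \<Delta> c p \<le> (Suc c * 2 ^ (\<Delta> + c)) * (gadget_size \<Delta> c p + \<Delta>)"
    by (rule mult_le_mono) (use one_le_mult_iff[of "Suc c" "2 ^ (\<Delta> + c)"] in auto)
  then show "gadget_size \<Delta> c p \<le> gadget_size \<Delta> c (Suc p)" by simp
qed

lemma spare_col: "spare \<phi> Z \<Longrightarrow> v \<in> Z \<Longrightarrow> col \<phi> v = {}"
  unfolding spare_def col_def by blast

lemma spare_subset: "spare \<phi> Z \<Longrightarrow> Z' \<subseteq> Z \<Longrightarrow> spare \<phi> Z'"
  unfolding spare_def by blast

lemma spare_closed: "spare \<phi> Z \<Longrightarrow> closed_zone \<phi> Z"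
  unfolding spare_def closed_zone_def by blast

lemma spare_None: "spare \<phi> Z \<Longrightarrow> f \<inter> Z \<noteq> {} \<Longrightarrow> \<phi> f = None"
  unfolding spare_def by blast

lemma changes_in_col: "changes_in Z \<phi> \<psi> \<Longrightarrow> v \<notin> Z \<Longrightarrow> col \<psi> v = col \<phi> v"
proof -
  assume ch: "changes_in Z \<phi> \<psi>" and v: "v \<notin> Z"
  have "\<psi> f = \<phi> f" if "v \<in> f" for f
  proof -
    have "\<not> f \<subseteq> Z" using that v by blast
    with ch show ?thesis by (simp add: changes_in_def)
  qed
  then show ?thesis unfolding col_def by (metis (no_types, lifting))
qed

lemma changes_in_trans: "changes_in Z \<phi> \<psi> \<Longrightarrow> changes_in Z \<psi> \<chi> \<Longrightarrow> changes_in Z \<phi> \<chi>"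
  by (simp add: changes_in_def)

lemma changes_in_refl: "changes_in Z \<phi> \<phi>"
  by (simp add: changes_in_def)

lemma changes_in_mono: "changes_in Z \<phi> \<psi> \<Longrightarrow> Z \<subseteq> Z' \<Longrightarrow> changes_in Z' \<phi> \<psi>"
  unfolding changes_in_def by (meson order_trans)

lemma changes_in_spare:
  assumes "spare \<phi> Z" "changes_in Y \<phi> \<psi>" "Y \<inter> Z = {}"
  shows "spare \<psi> Z"
  unfolding spare_def
proof
  fix f assume f: "f \<in> dom \<psi>"
  show "f \<inter> Z = {}"
  proof (cases "f \<subseteq> Y")
    case True then show ?thesis using assms(3) by blast
  next
    case False
    then have "f \<in> dom \<phi>" using f assms(2) by (auto simp: changes_in_def dom_def)
    then show ?thesis using assms(1) by (simp add: spare_def)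
  qed
qed

lemma changes_in_closed:
  assumes "spare \<phi> Z" "changes_in Z \<phi> \<psi>"
  shows "closed_zone \<psi> Z"
  unfolding closed_zone_def
proof (intro ballI impI, rule ccontr)
  fix f assume f: "f \<in> dom \<psi>" "f \<inter> Z \<noteq> {}" "\<not> f \<subseteq> Z"
  then have "\<psi> f = \<phi> f" using assms(2) by (simp add: changes_in_def)
  with spare_None[OF assms(1) f(2)] f(1) show False by auto
qed

lemma col_upd:
  assumes "\<phi> e = None"
  shows "col (\<phi>(e \<mapsto> b)) v = (if v \<in> e then insert b (col \<phi> v) else col \<phi> v)"
proof (rule set_eqI)
  fix a
  have "a \<in> col (\<phi>(e \<mapsto> b)) v \<longleftrightarrow> (\<exists>f. v \<in> f \<and> (f = e \<and> a = b \<or> f \<noteq> e \<and> \<phi> f = Some a))"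
    unfolding col_def fun_upd_apply mem_Collect_eq by (intro ex_cong1) auto
  also have "\<dots> \<longleftrightarrow> v \<in> e \<and> a = b \<or> (\<exists>f. v \<in> f \<and> \<phi> f = Some a)"
    using assms by (metis option.distinct(1))
  also have "\<dots> \<longleftrightarrow> a \<in> (if v \<in> e then insert b (col \<phi> v) else col \<phi> v)"
    unfolding col_def by (cases "v \<in> e") auto
  finally show "a \<in> col (\<phi>(e \<mapsto> b)) v \<longleftrightarrow> a \<in> (if v \<in> e then insert b (col \<phi> v) else col \<phi> v)" .
qed

text \<open>The cleaning step: once the old edges and \<open>e\<close> have the right colors,
  deleting everything else discards the temporary gadgets.\<close>

lemma restrict_extension:
  assumes "\<And>f. f \<in> dom \<phi> \<Longrightarrow> \<psi> f = \<phi> f" "\<psi> e = Some a"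
  shows "\<psi> |` (insert e (dom \<phi>)) = \<phi>(e \<mapsto> a)"
proof
  fix f
  show "(\<psi> |` (insert e (dom \<phi>))) f = (\<phi>(e \<mapsto> a)) f"
  proof (cases "f = e")
    case True then show ?thesis using assms by (simp add: restrict_map_def)
  next
    case False
    then show ?thesis using assms(1)[of f]
      by (cases "f \<in> dom \<phi>") (simp_all add: restrict_map_def domIff)
  qed
qed

text \<open>Covers both algorithms at once. Of the admissible chains it is only assumed that path
  chains are among them: every chain exhibited as a competitor, a single edge or the shifted spine,
  is a path, while the lower bounds hold for arbitrary chains.\<close>

locale greedy_algorithm =
  fixes n \<Delta> c :: nat and adm :: "edge list \<Rightarrow> bool" and alg :: algorithm
  assumes greedy: "greedy adm n \<Delta> (\<Delta> + c) alg"
    and adm_path: "\<And>es. form_path es \<Longrightarrow> adm es"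
    and \<Delta>: "3 \<le> \<Delta>" and c: "c \<le> \<Delta> - 2"
begin

abbreviation "\<kappa> \<equiv> \<Delta> + c"
abbreviation "cf \<equiv> colored_forest n \<Delta> \<kappa>"

definition reach :: "coloring \<Rightarrow> coloring \<Rightarrow> bool" where
  "reach = (update_step n \<Delta> alg)\<^sup>*\<^sup>*"

lemma reach_refl: "reach \<phi> \<phi>"
  by (simp add: reach_def)

lemma reach_trans: "reach \<phi> \<psi> \<Longrightarrow> reach \<psi> \<chi> \<Longrightarrow> reach \<phi> \<chi>"
  unfolding reach_def by (rule rtranclp_trans)

lemma reach_step: "legal_update n \<Delta> (dom \<phi>) u \<Longrightarrow> reach \<phi> (apply_update alg \<phi> u)"
  unfolding reach_def update_step_def by blast

lemma adm_single: "u \<noteq> v \<Longrightarrow> adm [{u, v}]"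
  by (rule adm_path) (auto simp: form_path_def intro!: exI[of _ "[u, v]"])

lemma alg_chain:
  assumes "cf \<phi>" "legal_update n \<Delta> (dom \<phi>) (Insert e)"
  obtains es where "adm es" "shift_chain \<kappa> \<phi> e es (alg \<phi> e)"
  using greedy assms unfolding greedy_def by metis

lemma alg_minimal:
  assumes "cf \<phi>" "legal_update n \<Delta> (dom \<phi>) (Insert e)" "adm es" "shift_chain \<kappa> \<phi> e es \<psi>"
  shows "recourse \<phi> (alg \<phi> e) \<le> recourse \<phi> \<psi>"
  using greedy assms unfolding greedy_def by metis

lemma legal_insert_notin:
  assumes "legal_update n \<Delta> E (Insert e)"
  shows "e \<notin> E"
proof
  assume "e \<in> E"
  obtain u v where uv: "e = {u, v}" "\<not> same_tree E u v" using assms by auto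
  with \<open>e \<in> E\<close> have "(u, v) \<in> {(x, y). {x, y} \<in> E}" by simp
  then have "same_tree E u v" unfolding same_tree_def by (rule r_into_rtrancl)
  with uv show False by simp
qed

lemma alg_insert:
  assumes "cf \<phi>" "legal_update n \<Delta> (dom \<phi>) (Insert e)"
  shows "dom (alg \<phi> e) = insert e (dom \<phi>)" "cf (alg \<phi> e)"
proof -
  obtain es where es: "shift_chain \<kappa> \<phi> e es (alg \<phi> e)" using alg_chain[OF assms] .
  from shift_chain_proper[OF es colored_forest_proper[OF assms(1)] legal_insert_notin[OF assms(2)]]
  have d: "dom (alg \<phi> e) = insert e (dom \<phi>)"
    and p: "proper_edge_coloring \<kappa> (dom (alg \<phi> e)) (alg \<phi> e)" by blast+
  show "dom (alg \<phi> e) = insert e (dom \<phi>)" by (rule d)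
  obtain u v where uv: "e = {u, v}" "u < n" "v < n" "\<not> same_tree (dom \<phi>) u v"
    using assms(2) by auto
  have "forest n (insert e (dom \<phi>))"
    unfolding uv(1) using assms(1) uv by (intro forest_insert) (auto simp: colored_forest_def)
  with p assms(2) show "cf (alg \<phi> e)" by (simp add: colored_forest_def d)
qed

lemma reach_colored_forest:
  assumes "reach \<phi> \<psi>" "cf \<phi>"
  shows "cf \<psi>"
  using assms unfolding reach_def
proof induction
  case base then show ?case .
next
  case (step \<psi> \<chi>)
  then have "cf \<psi>" by simp
  obtain u where u: "legal_update n \<Delta> (dom \<psi>) u" "\<chi> = apply_update alg \<psi> u"
    using step.hyps(2) unfolding update_step_def by blast
  show ?case
  proof (cases u)
    case (Insert e)
    then show ?thesis using alg_insert[OF \<open>cf \<psi>\<close>] u by simp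
  next
    case (Delete e)
    have "\<chi> = \<psi> |` (- {e})" using u(2) Delete by (simp add: restrict_complement_singleton_eq)
    then show ?thesis using colored_forest_restrict[OF \<open>cf \<psi>\<close>] by simp
  qed
qed

lemma reach_delete: "e \<in> dom \<phi> \<Longrightarrow> reach \<phi> (\<phi>(e := None))"
  using reach_step[of \<phi> "Delete e"] by simp

text \<open>Deletions keep all colors, so any part of the current coloring is reached by deleting
  the rest edge by edge.\<close>

lemma reach_restrict:
  assumes "cf \<phi>"
  shows "reach \<phi> (\<phi> |` D)"
proof -
  have "finite F \<Longrightarrow> F \<subseteq> dom \<phi> \<Longrightarrow> reach \<phi> (\<phi> |` (- F))" for F
  proof (induction F rule: finite_induct)
    case empty
    have "\<phi> |` (- {}) = \<phi>" by (simp add: restrict_map_def)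
    then show ?case by (simp add: reach_refl)
  next
    case (insert e F)
    have "(\<phi> |` (- F))(e := None) = \<phi> |` (- insert e F)"
      by (rule ext) (simp add: restrict_map_def)
    moreover have "e \<in> dom (\<phi> |` (- F))" using insert by (auto simp: restrict_map_def)
    ultimately have "reach (\<phi> |` (- F)) (\<phi> |` (- insert e F))" using reach_delete by metis
    with insert show ?case by (meson insert_subset reach_trans)
  qed
  moreover have "finite (dom \<phi> - D)" using colored_forest_finite[OF assms] by simp
  moreover have "\<phi> |` (- (dom \<phi> - D)) = \<phi> |` D"
    by (rule ext) (auto simp: restrict_map_def)
  ultimately show ?thesis by (metis Diff_subset)
qed

text \<open>Legality of a sequence refers to \<open>edges_at\<close>, legality of a single step to
  the domain of the current coloring. That the two agree at the end is carried along so that the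
  next update can be appended.\<close>

lemma reach_run:
  assumes "reach \<phi> \<psi>" "cf \<phi>"
  shows "\<exists>\<sigma> T. legal_updates n \<Delta> (dom \<phi>) \<sigma> T \<and> run alg \<phi> \<sigma> T = \<psi> \<and> edges_at (dom \<phi>) \<sigma> T = dom \<psi>"
  using assms unfolding reach_def
proof induction
  case base
  have "legal_updates n \<Delta> (dom \<phi>) undefined 0" by (simp add: legal_updates_def)
  then show ?case by (metis run.simps(1) edges_at.simps(1))
next
  case (step \<psi> \<chi>)
  then obtain \<sigma> T where \<sigma>: "legal_updates n \<Delta> (dom \<phi>) \<sigma> T" "run alg \<phi> \<sigma> T = \<psi>"
    "edges_at (dom \<phi>) \<sigma> T = dom \<psi>" by blast
  have "cf \<psi>" using reach_colored_forest[of \<phi> \<psi>] step by (simp add: reach_def)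
  obtain u where u: "legal_update n \<Delta> (dom \<psi>) u" "\<chi> = apply_update alg \<psi> u"
    using step.hyps(2) unfolding update_step_def by blast
  let ?\<sigma> = "\<sigma>(T := u)"
  have e: "edges_at (dom \<phi>) ?\<sigma> t = edges_at (dom \<phi>) \<sigma> t" if "t \<le> T" for t
    using that by (induction t) auto
  have r: "run alg \<phi> ?\<sigma> t = run alg \<phi> \<sigma> t" if "t \<le> T" for t
    using that by (induction t) auto
  have "legal_updates n \<Delta> (dom \<phi>) ?\<sigma> (Suc T)"
    using \<sigma> u e unfolding legal_updates_def by (auto simp: less_Suc_eq)
  moreover have "run alg \<phi> ?\<sigma> (Suc T) = \<chi>" using r \<sigma> u by simp
  moreover have "edges_at (dom \<phi>) ?\<sigma> (Suc T) = dom \<chi>"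
  proof (cases u)
    case (Insert f)
    then show ?thesis using alg_insert[OF \<open>cf \<psi>\<close>] u e \<sigma> by simp
  next
    case (Delete f)
    then show ?thesis using u e \<sigma> by simp
  qed
  ultimately show ?case by blast
qed

lemma cf_empty: "cf Map.empty"
  by (auto simp: colored_forest_def forest_def graph_on_def is_cycle_def max_degree_le_def
      degree_def proper_edge_coloring_def intro!: exI[of _ 0])

lemma reach_empty: "reach Map.empty \<phi> \<Longrightarrow> reachable_from_empty n \<Delta> alg \<phi>"
  using reach_run[OF _ cf_empty] unfolding reachable_from_empty_def by fastforce

lemma legal_insertI:
  assumes cf: "cf \<phi>" and uv: "u < n" "v < n" "\<not> same_tree (dom \<phi>) u v"
    and card: "card (col \<phi> u) < \<Delta>" "card (col \<phi> v) < \<Delta>"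
  shows "legal_update n \<Delta> (dom \<phi>) (Insert {u, v})"
proof -
  have fin: "finite (dom \<phi>)" using cf by (rule colored_forest_finite)
  have "degree (insert {u, v} (dom \<phi>)) x \<le> \<Delta>" if "x < n" for x
  proof (cases "x \<in> {u, v}")
    case True
    have "{e \<in> insert {u, v} (dom \<phi>). x \<in> e} \<subseteq> insert {u, v} {e \<in> dom \<phi>. x \<in> e}" by blast
    then have "degree (insert {u, v} (dom \<phi>)) x \<le> card (insert {u, v} {e \<in> dom \<phi>. x \<in> e})"
      unfolding degree_def by (intro card_mono) (use fin in auto)
    also have "\<dots> \<le> Suc (degree (dom \<phi>) x)"
      unfolding degree_def by (rule card_insert_le_m1) (use fin in auto)
    also have "\<dots> \<le> \<Delta>"
      using True card degree_eq_card_col[OF colored_forest_proper[OF cf]] by auto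
    finally show ?thesis .
  next
    case False
    then have "{e \<in> insert {u, v} (dom \<phi>). x \<in> e} = {e \<in> dom \<phi>. x \<in> e}" by blast
    then show ?thesis using cf that by (simp add: degree_def colored_forest_def max_degree_le_def)
  qed
  with uv show ?thesis by (auto simp: max_degree_le_def)
qed

text \<open>If some color is free at both ends, the one-edge chain has recourse 0, so the chain
  actually performed leaves all old colors intact as well. Which common free color the new edge
  receives is up to the algorithm, hence the existential \<open>b\<close>.\<close>

lemma free_insert:
  assumes cf: "cf \<phi>" and uv: "u < n" "v < n" "\<not> same_tree (dom \<phi>) u v"
    and card: "card (col \<phi> u) < \<Delta>" "card (col \<phi> v) < \<Delta>"
    and free: "\<not> {1..\<kappa>} \<subseteq> col \<phi> u \<union> col \<phi> v"
  obtains b where "b \<in> {1..\<kappa>}" "b \<notin> col \<phi> u" "b \<notin> col \<phi> v" "\<phi> {u, v} = None"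
    "reach \<phi> (\<phi>({u, v} \<mapsto> b))"
proof -
  let ?e = "{u, v}"
  have legal: "legal_update n \<Delta> (dom \<phi>) (Insert ?e)"
    using assms by (intro legal_insertI) auto
  have e: "?e \<notin> dom \<phi>" using legal_insert_notin[OF legal] .
  have ne: "u \<noteq> v" using uv by (auto simp: same_tree_def)
  have p: "proper_edge_coloring \<kappa> (dom \<phi>) \<phi>" by (rule colored_forest_proper[OF cf])
  obtain a where a: "a \<in> available \<kappa> \<phi> u" "a \<in> available \<kappa> \<phi> v"
    using free unfolding available_eq by blast
  let ?\<psi> = "alg \<phi> ?e"
  obtain es where es: "shift_chain \<kappa> \<phi> ?e es ?\<psi>" using alg_chain[OF cf legal] .
  have "recourse \<phi> ?\<psi> \<le> recourse \<phi> (\<phi>(?e \<mapsto> a))"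
    by (rule alg_minimal[OF cf legal adm_single[OF ne]])
      (rule shift_chain.stop[OF refl ne a])
  also have "\<dots> = 0"
  proof -
    have "{f \<in> dom \<phi> \<inter> dom (\<phi>(?e \<mapsto> a)). \<phi> f \<noteq> (\<phi>(?e \<mapsto> a)) f} = {}"
      using e by (auto simp: fun_upd_apply)
    then show ?thesis unfolding recourse_def by (metis card.empty)
  qed
  finally have r0: "recourse \<phi> ?\<psi> = 0" by simp
  from shift_chain_proper[OF es p e]
  have d: "dom ?\<psi> = insert ?e (dom \<phi>)" and p\<psi>: "proper_edge_coloring \<kappa> (dom ?\<psi>) ?\<psi>" by blast+
  have "finite {f \<in> dom \<phi> \<inter> dom ?\<psi>. \<phi> f \<noteq> ?\<psi> f}"
    by (rule finite_subset[OF _ colored_forest_finite[OF cf]]) blast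
  with r0 have same: "?\<psi> f = \<phi> f" if "f \<in> dom \<phi>" for f
    using that d unfolding recourse_def by auto
  have "?e \<in> dom ?\<psi>" unfolding d by blast
  then obtain b where b: "?\<psi> ?e = Some b" by blast
  have nb: "b \<notin> col \<phi> x" if x: "x \<in> ?e" for x
  proof
    assume "b \<in> col \<phi> x"
    then obtain f where f: "x \<in> f" "\<phi> f = Some b" unfolding col_def by blast
    then have "f \<in> dom \<phi>" by blast
    with f same have "?\<psi> f = Some b" by simp
    from proper_inj[OF p\<psi> this b f(1) x] \<open>f \<in> dom \<phi>\<close> e show False by simp
  qed
  have "?\<psi> = ?\<psi> |` (dom ?\<psi>)" by (rule ext) (auto simp: restrict_map_def)
  also have "\<dots> = \<phi>(?e \<mapsto> b)" unfolding d by (rule restrict_extension[of \<phi> ?\<psi>, OF same b])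
  finally have \<psi>: "?\<psi> = \<phi>(?e \<mapsto> b)" .
  have "reach \<phi> (\<phi>(?e \<mapsto> b))"
    using reach_step[OF legal] unfolding apply_update.simps \<psi> .
  moreover have "\<phi> ?e = None" using e by auto
  ultimately show thesis
    using that[of b] proper_range[OF p\<psi> b] nb by blast
qed

end

section \<open>Stars with prescribed colors\<close>

lemma closed_zone_upd:
  assumes "closed_zone \<phi> Z" "e \<inter> Z = {} \<or> e \<subseteq> Z"
  shows "closed_zone (\<phi>(e \<mapsto> a)) Z"
  unfolding closed_zone_def
proof (intro ballI impI)
  fix f assume "f \<in> dom (\<phi>(e \<mapsto> a))" "f \<inter> Z \<noteq> {}"
  then have "f = e \<or> f \<in> dom \<phi>" "f \<inter> Z \<noteq> {}" by (auto simp: dom_fun_upd)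
  then show "f \<subseteq> Z" using assms unfolding closed_zone_def by metis
qed

lemma changes_in_upd: "changes_in Z \<phi> \<psi> \<Longrightarrow> e \<subseteq> Z \<Longrightarrow> changes_in Z \<phi> (\<psi>(e \<mapsto> a))"
  unfolding changes_in_def by (metis fun_upd_other)

lemma not_same_tree_sym: "\<not> same_tree E u v \<Longrightarrow> \<not> same_tree E v u"
  using same_tree_sym by blast

lemma disjoint_blocks:
  "r * k \<le> card Z \<Longrightarrow> finite Z \<Longrightarrow>
    \<exists>B::nat \<Rightarrow> 'a set. (\<forall>i<r. B i \<subseteq> Z \<and> card (B i) = k) \<and> disjoint_family_on B {..<r}"
proof (induction r arbitrary: Z)
  case 0
  then show ?case by (simp add: disjoint_family_on_def)
next
  case (Suc r)
  obtain Y where Y: "Y \<subseteq> Z" "card Y = k"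
    using Suc.prems obtain_subset_with_card_n[of k Z] by auto
  have "r * k \<le> card (Z - Y)" using Suc.prems Y by (simp add: card_Diff_subset finite_subset)
  with Suc.IH[of "Z - Y"] Suc.prems obtain B :: "nat \<Rightarrow> 'a set" where
    B: "\<forall>i<r. B i \<subseteq> Z - Y \<and> card (B i) = k" "disjoint_family_on B {..<r}" by auto
  have "disjoint_family_on (B(r := Y)) {..<Suc r}"
    using B unfolding disjoint_family_on_def
    by (intro ballI impI) (fastforce simp: less_Suc_eq)
  moreover have "\<forall>i<Suc r. (B(r := Y)) i \<subseteq> Z \<and> card ((B(r := Y)) i) = k"
    using B Y by (auto simp: less_Suc_eq)
  ultimately show ?case by blast
qed

context greedy_algorithm
begin

text \<open>Pads the color set at \<open>x\<close> to an exact size by fresh leaves. Their colors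
  are uncontrolled and only their number matters.\<close>

lemma junk:
  assumes "cf \<phi>" "x < n" "x \<notin> J" "spare \<phi> J" "J \<subseteq> {..<n}"
    "card (col \<phi> x) + k \<le> \<Delta>" "k \<le> card J"
  shows "\<exists>\<psi>. reach \<phi> \<psi> \<and> changes_in (insert x J) \<phi> \<psi> \<and> col \<phi> x \<subseteq> col \<psi> x \<and>
    card (col \<psi> x) = card (col \<phi> x) + k"
  using assms
proof (induction k arbitrary: \<phi> J)
  case 0
  show ?case by (rule exI[of _ \<phi>]) (simp add: changes_in_refl reach_refl)
next
  case (Suc k)
  have finJ: "finite J" using Suc.prems(5) finite_subset by blast
  obtain j where j: "j \<in> J" using Suc.prems(7) by fastforce
  have j': "j < n" "j \<noteq> x" "col \<phi> j = {}" using Suc.prems(3,5) j spare_col[OF Suc.prems(4) j] by auto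
  have fc: "finite (col \<phi> x)" using finite_col[OF colored_forest_proper[OF Suc.prems(1)]] .
  have sp: "spare \<phi> {j}" using spare_subset[OF Suc.prems(4)] j by simp
  have nt: "\<not> same_tree (dom \<phi>) x j"
    by (rule not_same_tree_sym, rule closed_zone_not_same_tree[OF spare_closed[OF sp]]) (use j' in auto)
  have free: "\<not> {1..\<kappa>} \<subseteq> col \<phi> x \<union> col \<phi> j"
  proof
    assume "{1..\<kappa>} \<subseteq> col \<phi> x \<union> col \<phi> j"
    then have "card {1..\<kappa>} \<le> card (col \<phi> x)" using j' fc by (intro card_mono) auto
    with Suc.prems(6) show False by simp
  qed
  obtain b where b: "b \<notin> col \<phi> x" "\<phi> {x, j} = None" "reach \<phi> (\<phi>({x, j} \<mapsto> b))"
    by (rule free_insert[OF Suc.prems(1,2) j'(1) nt _ _ free]) (use Suc.prems(6) j' \<Delta> in auto)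
  define \<phi>' where "\<phi>' = \<phi>({x, j} \<mapsto> b)"
  have cx: "col \<phi>' x = insert b (col \<phi> x)"
    unfolding \<phi>'_def using col_upd[of \<phi> "{x, j}" b x] b(2) by simp
  have c1: "changes_in {x, j} \<phi> \<phi>'"
    unfolding \<phi>'_def by (rule changes_in_upd[OF changes_in_refl]) simp
  have r1: "reach \<phi> \<phi>'" unfolding \<phi>'_def by (rule b(3))
  have "spare \<phi>' (J - {j})"
    by (rule changes_in_spare[OF spare_subset[OF Suc.prems(4)] c1]) (use Suc.prems(3) in auto)
  moreover have "cf \<phi>'" using reach_colored_forest[OF r1 Suc.prems(1)] .
  ultimately have "\<exists>\<psi>. reach \<phi>' \<psi> \<and> changes_in (insert x (J - {j})) \<phi>' \<psi> \<and> col \<phi>' x \<subseteq> col \<psi> x \<and>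
    card (col \<psi> x) = card (col \<phi>' x) + k"
    using Suc.prems finJ j b(1) fc by (intro Suc.IH) (auto simp: cx)
  then obtain \<psi> where \<psi>: "reach \<phi>' \<psi>" "changes_in (insert x (J - {j})) \<phi>' \<psi>"
    "col \<phi>' x \<subseteq> col \<psi> x" "card (col \<psi> x) = card (col \<phi>' x) + k" by blast
  have "changes_in (insert x J) \<phi> \<psi>"
    by (rule changes_in_trans[OF changes_in_mono[OF c1] changes_in_mono[OF \<psi>(2)]]) (use j in auto)
  moreover have "reach \<phi> \<psi>" using r1 \<psi>(1) by (rule reach_trans)
  moreover have "card (col \<psi> x) = card (col \<phi> x) + Suc k" using \<psi>(4) cx b(1) fc by simp
  moreover have "col \<phi> x \<subseteq> col \<psi> x" using \<psi>(3) cx by blast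
  ultimately show ?case by blast
qed

text \<open>All \<open>xs i\<close> miss the same colors. Each insertion of \<open>{xs i, y}\<close>
  takes one of these not yet at \<open>y\<close>; if it is not \<open>z\<close>, it is blocked at
  \<open>y\<close> from then on. By the last hypothesis there are at least as many copies as colors
  outside \<open>U\<close> that are not at \<open>y\<close>, a balance kept by each insertion, so
  \<open>z\<close> must come up.\<close>

lemma force_color_from_copies:
  assumes "finite I" "cf \<phi>" "y < n" "disjoint_family_on Zs I"
    "\<And>i. i \<in> I \<Longrightarrow> closed_zone \<phi> (Zs i) \<and> xs i \<in> Zs i \<and> xs i < n \<and> y \<notin> Zs i \<and> col \<phi> (xs i) = U"
    "z \<in> {1..\<kappa>}" "z \<notin> U" "z \<notin> col \<phi> y" "col \<phi> y \<inter> U = {}" "card U = \<Delta> - 1" "U \<subseteq> {1..\<kappa>}"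
    "\<kappa> \<le> card I + card U + card (col \<phi> y)"
  shows "\<exists>\<psi>. \<exists>i\<in>I. reach \<phi> \<psi> \<and> insert z U \<subseteq> col \<psi> (xs i) \<and> changes_in (insert y (\<Union>i\<in>I. Zs i)) \<phi> \<psi>"
  using assms
proof (induction I arbitrary: \<phi> rule: finite_induct)
  case (empty \<phi>)
  have V: "col \<phi> y \<subseteq> {1..\<kappa>}" "finite (col \<phi> y)"
    using col_subset finite_col colored_forest_proper[OF empty.prems(1)] by blast+
  \<comment> \<open>With no copy left, \<open>U\<close> and the colors at \<open>y\<close> would
    fill the palette, although neither contains \<open>z\<close>.\<close>
  have "card (U \<union> col \<phi> y) \<le> card ({1..\<kappa>} - {z})"
    using empty.prems V by (intro card_mono) auto
  moreover have "card (U \<union> col \<phi> y) = card U + card (col \<phi> y)"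
    using empty.prems V by (intro card_Un_disjoint) (auto intro: finite_subset)
  ultimately show ?case using empty.prems(5,11) \<Delta> by (simp add: card_Diff_singleton)
next
  case (insert i I \<phi>)
  have V: "col \<phi> y \<subseteq> {1..\<kappa>}" "finite (col \<phi> y)"
    using col_subset finite_col colored_forest_proper[OF insert.prems(1)] by blast+
  have i: "closed_zone \<phi> (Zs i)" "xs i \<in> Zs i" "xs i < n" "y \<notin> Zs i" "col \<phi> (xs i) = U"
    using insert.prems(4)[of i] by auto
  have nt: "\<not> same_tree (dom \<phi>) (xs i) y" by (rule closed_zone_not_same_tree[OF i(1,2,4)])
  \<comment> \<open>As \<open>z\<close> is still missing and \<open>U\<close> has \<Delta> - 1
    elements, \<open>y\<close> has at most c \<le> \<Delta> - 2 colors and can take another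
    edge.\<close>
  have le: "card U + card (col \<phi> y) \<le> \<kappa> - 1"
  proof -
    have "card (U \<union> col \<phi> y) \<le> card ({1..\<kappa>} - {z})"
      using insert.prems V by (intro card_mono) auto
    moreover have "card (U \<union> col \<phi> y) = card U + card (col \<phi> y)"
      using insert.prems V by (intro card_Un_disjoint) (auto intro: finite_subset)
    ultimately show ?thesis using insert.prems(5) by (simp add: card_Diff_singleton)
  qed
  have "card (col \<phi> y) < \<Delta>" using le insert.prems(9) \<Delta> c by linarith
  moreover have "card (col \<phi> (xs i)) < \<Delta>" using i(5) insert.prems(9) \<Delta> by simp
  moreover have "\<not> {1..\<kappa>} \<subseteq> col \<phi> (xs i) \<union> col \<phi> y" using insert.prems(5-7) i(5) by blast
  ultimately obtain a where a: "a \<in> {1..\<kappa>}" "a \<notin> col \<phi> (xs i)" "a \<notin> col \<phi> y"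
    "\<phi> {xs i, y} = None" "reach \<phi> (\<phi>({xs i, y} \<mapsto> a))"
    using free_insert[OF insert.prems(1) i(3) insert.prems(2) nt] by metis
  define \<phi>' where "\<phi>' = \<phi>({xs i, y} \<mapsto> a)"
  have col': "col \<phi>' v = (if v \<in> {xs i, y} then insert a (col \<phi> v) else col \<phi> v)" for v
    unfolding \<phi>'_def by (rule col_upd[of \<phi> "{xs i, y}", OF a(4)])
  have cy: "col \<phi>' y = insert a (col \<phi> y)" and cx: "col \<phi>' (xs i) = insert a U"
    using i(5) by (simp_all add: col')
  have ch: "changes_in (insert y (Zs i)) \<phi> \<phi>'"
    unfolding \<phi>'_def by (rule changes_in_upd[OF changes_in_refl]) (use i in auto)
  have r1: "reach \<phi> \<phi>'" unfolding \<phi>'_def by (rule a(5))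
  show ?case
  proof (cases "a = z")
    case True
    have "changes_in (insert y (\<Union>i\<in>insert i I. Zs i)) \<phi> \<phi>'" by (rule changes_in_mono[OF ch]) auto
    moreover have "insert z U \<subseteq> col \<phi>' (xs i)" using True cx by simp
    ultimately show ?thesis using r1 by blast
  next
    case False
    have "\<exists>\<psi>. \<exists>i\<in>I. reach \<phi>' \<psi> \<and> insert z U \<subseteq> col \<psi> (xs i) \<and>
      changes_in (insert y (\<Union>i\<in>I. Zs i)) \<phi>' \<psi>"
    proof (rule insert.IH)
      show "cf \<phi>'" using reach_colored_forest[OF r1 insert.prems(1)] .
      show "disjoint_family_on Zs I" using insert.prems(3) by (auto simp: disjoint_family_on_def)
      fix j assume j: "j \<in> I"
      then have "Zs i \<inter> Zs j = {}" using insert.prems(3) insert.hyps(2)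
        by (auto simp: disjoint_family_on_def)
      then have d: "{xs i, y} \<inter> Zs j = {}" using i insert.prems(4)[of j] j by auto
      have xj: "xs j \<notin> {xs i, y}" using d insert.prems(4)[of j] j by auto
      then have "col \<phi>' (xs j) = col \<phi> (xs j)" unfolding col' by simp
      moreover have "closed_zone \<phi>' (Zs j)"
        unfolding \<phi>'_def by (rule closed_zone_upd) (use insert.prems(4)[of j] j d in auto)
      ultimately show "closed_zone \<phi>' (Zs j) \<and> xs j \<in> Zs j \<and> xs j < n \<and> y \<notin> Zs j \<and> col \<phi>' (xs j) = U"
        using insert.prems(4)[of j] j by simp
    qed (use insert.prems False cy a i insert.hyps V in auto)
    then obtain \<psi> j where \<psi>: "j \<in> I" "reach \<phi>' \<psi>" "insert z U \<subseteq> col \<psi> (xs j)"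
      "changes_in (insert y (\<Union>i\<in>I. Zs i)) \<phi>' \<psi>" by blast
    have "changes_in (insert y (\<Union>i\<in>insert i I. Zs i)) \<phi> \<psi>"
      by (rule changes_in_trans[OF changes_in_mono[OF ch] changes_in_mono[OF \<psi>(4)]]) auto
    moreover have "reach \<phi> \<psi>" using r1 \<psi>(2) by (rule reach_trans)
    ultimately show ?thesis using \<psi>(1,3) by blast
  qed
qed

text \<open>Only edges at the center with a color outside \<open>P\<close> are deleted. Edges not
  inside \<open>Z\<close> are safe, because no edge met \<open>Z\<close> before the
  construction.\<close>

lemma trim_star:
  assumes "cf \<psi>" "spare \<phi> Z" "changes_in Z \<phi> \<psi>" "x \<in> Z" "P \<subseteq> col \<psi> x"
  shows "\<exists>\<chi>. reach \<psi> \<chi> \<and> changes_in Z \<phi> \<chi> \<and> col \<chi> x = P"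
proof -
  define \<chi> where "\<chi> = \<psi> |` {f. x \<in> f \<longrightarrow> the (\<psi> f) \<in> P}"
  have "reach \<psi> \<chi>" unfolding \<chi>_def by (rule reach_restrict[OF assms(1)])
  moreover have "changes_in Z \<phi> \<chi>"
    unfolding changes_in_def
  proof (intro allI impI)
    fix f assume f: "\<not> f \<subseteq> Z"
    then have e: "\<psi> f = \<phi> f" using assms(3) by (simp add: changes_in_def)
    show "\<chi> f = \<phi> f"
    proof (cases "x \<in> f")
      case True
      then have "\<phi> f = None" using spare_None[OF assms(2), of f] assms(4) by blast
      then show ?thesis using e by (simp add: \<chi>_def restrict_map_def)
    next
      case False
      then show ?thesis using e by (simp add: \<chi>_def restrict_map_def)
    qed
  qed
  moreover have "col \<chi> x = P"
  proof (rule set_eqI)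
    fix a
    have "a \<in> col \<chi> x \<longleftrightarrow> (\<exists>f. x \<in> f \<and> \<psi> f = Some a \<and> a \<in> P)"
      unfolding \<chi>_def col_def mem_Collect_eq by (intro ex_cong1) (auto simp: restrict_map_def)
    also have "\<dots> \<longleftrightarrow> a \<in> P" using assms(5) unfolding col_def by blast
    finally show "a \<in> col \<chi> x \<longleftrightarrow> a \<in> P" .
  qed
  ultimately show ?thesis by blast
qed

text \<open>The induction hypothesis of \<open>attain\<close> enters as an assumption, to be used in
  \<open>r\<close> disjoint zones. Padding each copy to \<Delta> - 1 colors leaves one free slot at
  its center and just c + 1 missing colors. The clause on unchanged edges also excludes new edges
  between different zones, which later makes every zone closed.\<close>

lemma attain_copies:
  fixes r :: nat
  assumes IH: "\<And>\<phi> Z. \<lbrakk>cf \<phi>; spare \<phi> Z; Z \<subseteq> {..<n}; N \<le> card Z\<rbrakk> \<Longrightarrow>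
      \<exists>\<psi>. \<exists>x\<in>Z. reach \<phi> \<psi> \<and> changes_in Z \<phi> \<psi> \<and> col \<psi> x = U"
    and U: "card U \<le> \<Delta> - 1"
    and cf: "cf \<phi>"
    and Zs: "\<And>i. i < r \<Longrightarrow> spare \<phi> (Zs i) \<and> Zs i \<subseteq> {..<n} \<and> N + \<Delta> \<le> card (Zs i)"
    and disj: "disjoint_family_on Zs {..<r}"
  shows "\<exists>\<psi> xs. reach \<phi> \<psi> \<and> (\<forall>f. (\<forall>i<r. \<not> f \<subseteq> Zs i) \<longrightarrow> \<psi> f = \<phi> f) \<and>
    (\<forall>i<r. xs i \<in> Zs i \<and> U \<subseteq> col \<psi> (xs i) \<and> card (col \<psi> (xs i)) = \<Delta> - 1)"
  using Zs disj
proof (induction r)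
  case 0
  then show ?case using reach_refl by blast
next
  case (Suc r)
  have dr: "disjoint_family_on Zs {..<r}"
    using Suc.prems(2) by (auto simp: disjoint_family_on_def)
  obtain \<psi> xs where \<psi>: "reach \<phi> \<psi>" "\<forall>f. (\<forall>i<r. \<not> f \<subseteq> Zs i) \<longrightarrow> \<psi> f = \<phi> f"
    "\<forall>i<r. xs i \<in> Zs i \<and> U \<subseteq> col \<psi> (xs i) \<and> card (col \<psi> (xs i)) = \<Delta> - 1"
    using Suc.IH[OF _ dr] Suc.prems(1) by (metis less_Suc_eq)
  have cf\<psi>: "cf \<psi>" using reach_colored_forest[OF \<psi>(1) cf] .
  have dis: "Zs i \<inter> Zs r = {}" if "i < r" for i
    using Suc.prems(2) that by (auto simp: disjoint_family_on_def)
  have ch: "changes_in (\<Union>i<r. Zs i) \<phi> \<psi>" using \<psi>(2) unfolding changes_in_def by blast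
  have Zr: "Zs r \<subseteq> {..<n}" "N + \<Delta> \<le> card (Zs r)" "spare \<phi> (Zs r)" using Suc.prems(1) by auto
  have spr: "spare \<psi> (Zs r)"
    by (rule changes_in_spare[OF Zr(3) ch]) (use dis in blast)
  have finr: "finite (Zs r)" using Zr(1) finite_subset by blast
  obtain Y where Y: "Y \<subseteq> Zs r" "card Y = N"
    using obtain_subset_with_card_n[of N "Zs r"] Zr(2) by auto
  obtain \<psi>1 x where \<psi>1: "x \<in> Y" "reach \<psi> \<psi>1" "changes_in Y \<psi> \<psi>1" "col \<psi>1 x = U"
    using IH[OF cf\<psi> spare_subset[OF spr Y(1)]] Y Zr(1) by (metis order_refl subset_trans)
  have cf1: "cf \<psi>1" using reach_colored_forest[OF \<psi>1(2) cf\<psi>] .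
  have sp1: "spare \<psi>1 (Zs r - Y)"
    by (rule changes_in_spare[OF spare_subset[OF spr] \<psi>1(3)]) auto
  have "card (Zs r - Y) \<ge> \<Delta>"
    using Y Zr(2) finr by (simp add: card_Diff_subset finite_subset)
  then have "\<exists>\<psi>2. reach \<psi>1 \<psi>2 \<and> changes_in (insert x (Zs r - Y)) \<psi>1 \<psi>2 \<and> col \<psi>1 x \<subseteq> col \<psi>2 x \<and>
    card (col \<psi>2 x) = card (col \<psi>1 x) + (\<Delta> - 1 - card U)"
    using \<psi>1 Y Zr U by (intro junk[OF cf1 _ _ sp1]) auto
  then obtain \<psi>2 where \<psi>2: "reach \<psi>1 \<psi>2" "changes_in (insert x (Zs r - Y)) \<psi>1 \<psi>2" "U \<subseteq> col \<psi>2 x"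
    "card (col \<psi>2 x) = \<Delta> - 1"
    using \<psi>1(4) U by auto
  have ch2: "changes_in (Zs r) \<psi> \<psi>2"
    by (rule changes_in_trans[OF changes_in_mono[OF \<psi>1(3) Y(1)] changes_in_mono[OF \<psi>2(2)]])
      (use \<psi>1(1) Y(1) in auto)
  have "reach \<phi> \<psi>2" using \<psi>(1) \<psi>1(2) \<psi>2(1) by (meson reach_trans)
  moreover have "\<forall>f. (\<forall>i<Suc r. \<not> f \<subseteq> Zs i) \<longrightarrow> \<psi>2 f = \<phi> f"
    using \<psi>(2) ch2 unfolding changes_in_def by (metis less_Suc_eq)
  moreover have "(xs(r := x)) i \<in> Zs i \<and> U \<subseteq> col \<psi>2 ((xs(r := x)) i) \<and>
      card (col \<psi>2 ((xs(r := x)) i)) = \<Delta> - 1" if "i < Suc r" for i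
  proof (cases "i = r")
    case True
    then show ?thesis using \<psi>2 \<psi>1(1) Y(1) by auto
  next
    case False
    then have ir: "i < r" using that by simp
    then have "xs i \<notin> Zs r" using \<psi>(3) dis by blast
    then have "col \<psi>2 (xs i) = col \<psi> (xs i)" by (rule changes_in_col[OF ch2])
    then show ?thesis using \<psi>(3) ir by simp
  qed
  ultimately show ?case by blast
qed

text \<open>Induction on the prescribed colors, adding \<open>z\<close> to \<open>U\<close>. The
  padding may already have produced \<open>z\<close> at some center; otherwise all centers miss it
  and enough of them have equal color sets to force it. Surplus colors are trimmed only at the
  end.\<close>

lemma attain:
  assumes "finite P" "P \<subseteq> {1..\<kappa>}" "card P \<le> \<Delta>"
    "cf \<phi>" "spare \<phi> Z" "Z \<subseteq> {..<n}" "gadget_size \<Delta> c (card P) \<le> card Z"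
  shows "\<exists>\<psi>. \<exists>x\<in>Z. reach \<phi> \<psi> \<and> changes_in Z \<phi> \<psi> \<and> col \<psi> x = P"
  using assms
proof (induction P arbitrary: \<phi> Z rule: finite_induct)
  case (empty \<phi> Z)
  then obtain x where "x \<in> Z" by fastforce
  then show ?case using spare_col[OF empty.prems(4)] changes_in_refl reach_refl by blast
next
  case (insert z U \<phi> Z)
  define N where "N = gadget_size \<Delta> c (card U)"
  define r where "r = Suc c * 2 ^ \<kappa>"
  have finZ: "finite Z" using insert.prems(5) finite_subset by blast
  have cardU: "card U \<le> \<Delta> - 1" using insert by simp
  have cardZ: "r * (N + \<Delta>) + 1 \<le> card Z"
    using insert.prems(6) insert.hyps by (simp add: N_def r_def)
  then obtain y where y: "y \<in> Z" by fastforce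
  have "r * (N + \<Delta>) \<le> card (Z - {y})" using cardZ y finZ by simp
  then obtain Zs :: "nat \<Rightarrow> nat set" where Zs: "\<forall>i<r. Zs i \<subseteq> Z - {y} \<and> card (Zs i) = N + \<Delta>"
    "disjoint_family_on Zs {..<r}"
    using disjoint_blocks[of r "N + \<Delta>" "Z - {y}"] finZ by auto
  have copies: "\<exists>\<psi> xs. reach \<phi> \<psi> \<and> (\<forall>f. (\<forall>i<r. \<not> f \<subseteq> Zs i) \<longrightarrow> \<psi> f = \<phi> f) \<and>
    (\<forall>i<r. xs i \<in> Zs i \<and> U \<subseteq> col \<psi> (xs i) \<and> card (col \<psi> (xs i)) = \<Delta> - 1)"
  proof (rule attain_copies[where N = N and U = U and r = r and Zs = Zs, OF _ cardU insert.prems(3) _ Zs(2)])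
    show "\<exists>\<psi>. \<exists>x\<in>Z. reach \<phi> \<psi> \<and> changes_in Z \<phi> \<psi> \<and> col \<psi> x = U"
      if "cf \<phi>" "spare \<phi> Z" "Z \<subseteq> {..<n}" "N \<le> card Z" for \<phi> Z
      by (rule insert.IH) (use that insert.prems cardU in \<open>auto simp: N_def\<close>)
    show "spare \<phi> (Zs i) \<and> Zs i \<subseteq> {..<n} \<and> N + \<Delta> \<le> card (Zs i)" if "i < r" for i
    proof -
      have "Zs i \<subseteq> Z" "card (Zs i) = N + \<Delta>" using Zs(1) that by auto
      then show ?thesis using spare_subset[OF insert.prems(4), of "Zs i"] insert.prems(5) by auto
    qed
  qed
  then obtain \<psi> xs where \<psi>: "reach \<phi> \<psi>" "\<forall>f. (\<forall>i<r. \<not> f \<subseteq> Zs i) \<longrightarrow> \<psi> f = \<phi> f"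
    "\<forall>i<r. xs i \<in> Zs i \<and> U \<subseteq> col \<psi> (xs i) \<and> card (col \<psi> (xs i)) = \<Delta> - 1" by blast
  have cf\<psi>: "cf \<psi>" using reach_colored_forest[OF \<psi>(1) insert.prems(3)] .
  have ch: "changes_in (Z - {y}) \<phi> \<psi>" using \<psi>(2) Zs(1) unfolding changes_in_def by blast
  have ch': "changes_in Z \<phi> \<psi>" by (rule changes_in_mono[OF ch]) auto
  have colsub: "col \<psi> x \<subseteq> {1..\<kappa>}" for x by (rule col_subset[OF colored_forest_proper[OF cf\<psi>]])
  have "\<exists>\<psi>'. \<exists>x\<in>Z. reach \<psi> \<psi>' \<and> changes_in Z \<psi> \<psi>' \<and> insert z U \<subseteq> col \<psi>' x"
  proof (cases "\<exists>i<r. z \<in> col \<psi> (xs i)")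
    case True
    then obtain i where "i < r" "z \<in> col \<psi> (xs i)" by blast
    then show ?thesis using \<psi>(3) Zs(1) changes_in_refl reach_refl
      by (intro exI[of _ \<psi>] bexI[of _ "xs i"]) auto
  next
    case False
    let ?g = "\<lambda>i. col \<psi> (xs i)"
    have "?g \<in> {..<r} \<rightarrow> Pow {1..\<kappa>}" using colsub by blast
    then have "\<exists>W\<in>Pow {1..\<kappa>}. r \<le> card (?g -` {W} \<inter> {..<r}) * card (Pow {1..\<kappa>})"
      using pigeonhole_card[of ?g "{..<r}" "Pow {1..\<kappa>}"] by auto
    then obtain W where W: "W \<in> Pow {1..\<kappa>}" "r \<le> card (?g -` {W} \<inter> {..<r}) * card (Pow {1..\<kappa>})"
      by blast
    define I where "I = ?g -` {W} \<inter> {..<r}"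
    have "Suc c * 2 ^ \<kappa> \<le> card I * 2 ^ \<kappa>" using W(2) by (simp add: card_Pow r_def I_def)
    \<comment> \<open>Cancelling the number 2 ^ \<kappa> of color sets leaves c + 1 equal copies, as
      many as there are colors outside \<open>W\<close>.\<close>
    then have cardI: "Suc c \<le> card I" by (simp only: mult_le_cancel2) simp
    then obtain i0 where i0: "i0 \<in> I" by fastforce
    have I: "i < r" "col \<psi> (xs i) = W" if "i \<in> I" for i using that by (auto simp: I_def)
    have UW: "U \<subseteq> W" "card W = \<Delta> - 1" "z \<notin> W" using I[OF i0] \<psi>(3) False by auto
    have coly: "col \<psi> y = {}"
      using changes_in_col[OF ch] spare_col[OF insert.prems(4) y] by simp
    have "\<exists>\<psi>'. \<exists>i\<in>I. reach \<psi> \<psi>' \<and> insert z W \<subseteq> col \<psi>' (xs i) \<and>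
      changes_in (insert y (\<Union>i\<in>I. Zs i)) \<psi> \<psi>'"
    proof (rule force_color_from_copies[OF _ cf\<psi>])
      show "finite I" by (simp add: I_def)
      show "disjoint_family_on Zs I" using Zs(2) I by (auto simp: disjoint_family_on_def)
      show "y < n" using y insert.prems(5) by auto
      show "z \<in> {1..\<kappa>}" using insert.prems(1) by simp
      show "\<kappa> \<le> card I + card W + card (col \<psi> y)" using cardI UW(2) \<Delta> by simp
      fix i assume i: "i \<in> I"
      have "closed_zone \<psi> (Zs i)"
        unfolding closed_zone_def
      proof (intro ballI impI, rule ccontr)
        fix f assume f: "f \<in> dom \<psi>" "f \<inter> Zs i \<noteq> {}" "\<not> f \<subseteq> Zs i"
        have "\<not> f \<subseteq> Zs j" if "j < r" for j
          using f(2,3) Zs(2) that I(1)[OF i] unfolding disjoint_family_on_def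
          by (cases "j = i") blast+
        then have "\<psi> f = \<phi> f" using \<psi>(2) by blast
        moreover have "f \<inter> Z \<noteq> {}" using f(2) Zs(1) I(1)[OF i] by blast
        ultimately show False using spare_None[OF insert.prems(4), of f] f(1) by auto
      qed
      then show "closed_zone \<psi> (Zs i) \<and> xs i \<in> Zs i \<and> xs i < n \<and> y \<notin> Zs i \<and> col \<psi> (xs i) = W"
        using I[OF i] \<psi>(3) Zs(1) insert.prems(5) by blast
    qed (use UW W coly in auto)
    then obtain \<psi>' i where \<psi>': "i \<in> I" "reach \<psi> \<psi>'" "insert z W \<subseteq> col \<psi>' (xs i)"
      "changes_in (insert y (\<Union>i\<in>I. Zs i)) \<psi> \<psi>'" by blast
    have "changes_in Z \<psi> \<psi>'" by (rule changes_in_mono[OF \<psi>'(4)]) (use y I Zs(1) in blast)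
    moreover have "xs i \<in> Z" using I[OF \<psi>'(1)] \<psi>(3) Zs(1) by blast
    ultimately show ?thesis using \<psi>' UW(1) by blast
  qed
  then obtain \<psi>' x where \<psi>': "x \<in> Z" "reach \<psi> \<psi>'" "changes_in Z \<psi> \<psi>'" "insert z U \<subseteq> col \<psi>' x"
    by blast
  from trim_star[OF reach_colored_forest[OF \<psi>'(2) cf\<psi>] insert.prems(4)
      changes_in_trans[OF ch' \<psi>'(3)] \<psi>'(1,4)]
  show ?case using \<psi>(1) \<psi>'(1,2) by (meson reach_trans)
qed

end

section \<open>Reaching a colored forest from the empty graph\<close>

text \<open>An order of construction in which each edge brings a new vertex \<open>w\<close>.
  Acyclicity then holds automatically, and a color only has to be new at \<open>u\<close>.\<close>

inductive leaf_built :: "coloring \<Rightarrow> bool" where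
  empty: "leaf_built Map.empty"
| leaf: "\<lbrakk>leaf_built \<phi>; u \<noteq> w; \<forall>f\<in>dom \<phi>. w \<notin> f; a \<notin> col \<phi> u\<rbrakk> \<Longrightarrow> leaf_built (\<phi>({u, w} \<mapsto> a))"

lemma leaf_built_forest:
  assumes "leaf_built \<phi>" "graph_on n (dom \<phi>)"
  shows "forest n (dom \<phi>)"
  using assms
proof induction
  case empty
  then show ?case by (auto simp: forest_def graph_on_def is_cycle_def intro!: exI[of _ 0])
next
  case (leaf \<phi> u w a)
  have d: "dom (\<phi>({u, w} \<mapsto> a)) = insert {u, w} (dom \<phi>)" by (rule dom_color)
  have g: "graph_on n (insert {u, w} (dom \<phi>))" using leaf.prems unfolding d .
  then have "forest n (dom \<phi>)" by (intro leaf.IH) (rule graph_on_subset, auto)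
  moreover have "u < n" "w < n" using g by (auto simp: graph_on_def)
  moreover have "spare \<phi> {w}" using leaf.hyps(3) by (auto simp: spare_def)
  then have "\<not> same_tree (dom \<phi>) w u"
    by (rule closed_zone_not_same_tree[OF spare_closed]) (use leaf.hyps(2) in auto)
  then have "\<not> same_tree (dom \<phi>) u w" by (rule not_same_tree_sym)
  ultimately show ?case unfolding d by (intro forest_insert)
qed

context greedy_algorithm
begin

abbreviation "gsize \<equiv> gadget_size \<Delta> c (\<Delta> - 1)"

text \<open>The star built at \<open>j\<close> has exactly the colors outside \<open>Q\<close>, so
  the edge from \<open>v\<close> to \<open>j\<close> must take a color in \<open>Q\<close>. At least
  c + 1 colors in \<open>Q\<close> keep the star at \<Delta> - 1 colors or fewer, leaving room for
  this edge.\<close>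

lemma attach_colored_leaf:
  assumes cf: "cf \<phi>" and v: "v < n" "v \<notin> Z" and Z: "spare \<phi> Z" "Z \<subseteq> {..<n}" "gsize \<le> card Z"
    and Q: "Q \<subseteq> {1..\<kappa>}" "Suc c \<le> card Q" "\<not> Q \<subseteq> col \<phi> v" and deg: "card (col \<phi> v) < \<Delta>"
  shows "\<exists>j\<in>Z. \<exists>a\<in>Q - col \<phi> v. reach \<phi> (\<phi>({v, j} \<mapsto> a))"
proof -
  define P where "P = {1..\<kappa>} - Q"
  have "card P = \<kappa> - card Q" using Q finite_subset[OF Q(1)] by (simp add: P_def card_Diff_subset)
  then have cP: "card P \<le> \<Delta> - 1" using Q(2) by linarith
  have finP: "finite P" and subP: "P \<subseteq> {1..\<kappa>}" by (auto simp: P_def)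
  have "gadget_size \<Delta> c (card P) \<le> card Z" using gadget_size_mono[OF cP] Z(3) by (rule order_trans)
  then obtain \<psi> j where \<psi>: "j \<in> Z" "reach \<phi> \<psi>" "changes_in Z \<phi> \<psi>" "col \<psi> j = P"
    using attain[of P, OF _ _ _ cf Z(1,2)] cP finP subP by (meson diff_le_self order_trans)
  have cf\<psi>: "cf \<psi>" using reach_colored_forest[OF \<psi>(2) cf] .
  have colv: "col \<psi> v = col \<phi> v" by (rule changes_in_col[OF \<psi>(3) v(2)])
  have nt: "\<not> same_tree (dom \<psi>) v j"
    by (rule not_same_tree_sym, rule closed_zone_not_same_tree[OF changes_in_closed[OF Z(1) \<psi>(3)]])
      (use \<psi> v in auto)
  have "\<not> {1..\<kappa>} \<subseteq> col \<psi> v \<union> col \<psi> j" using Q(1,3) colv \<psi>(4) by (auto simp: P_def)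
  moreover have "card (col \<psi> v) < \<Delta>" "card (col \<psi> j) < \<Delta>" using deg colv \<psi>(4) cP \<Delta> by auto
  moreover have "j < n" using \<psi>(1) Z(2) by auto
  ultimately obtain a where a: "a \<in> {1..\<kappa>}" "a \<notin> col \<psi> v" "a \<notin> col \<psi> j" "\<psi> {v, j} = None"
    "reach \<psi> (\<psi>({v, j} \<mapsto> a))"
    using free_insert[OF cf\<psi> v(1) _ nt] by metis
  define \<chi> where "\<chi> = \<psi>({v, j} \<mapsto> a)"
  have \<chi>: "reach \<psi> \<chi>" unfolding \<chi>_def by (rule a(5))
  have same: "\<chi> f = \<phi> f" if "f \<in> dom \<phi>" for f
  proof -
    have "f \<inter> Z = {}" using Z(1) that by (simp add: spare_def)
    moreover have "card f = 2" using colored_forest_graph[OF cf] that by (simp add: graph_on_def)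
    then have "f \<noteq> {}" by auto
    ultimately have "\<not> f \<subseteq> Z" "f \<noteq> {v, j}" using \<psi>(1) by auto
    then show ?thesis using \<psi>(3) by (simp add: \<chi>_def changes_in_def)
  qed
  have "\<chi> |` (insert {v, j} (dom \<phi>)) = \<phi>({v, j} \<mapsto> a)"
    by (rule restrict_extension[of \<phi> \<chi>, OF same]) (auto simp: \<chi>_def)
  moreover have "reach \<chi> (\<chi> |` (insert {v, j} (dom \<phi>)))"
    by (rule reach_restrict[OF reach_colored_forest[OF \<chi> cf\<psi>]])
  ultimately have "reach \<phi> (\<phi>({v, j} \<mapsto> a))" using \<psi>(2) \<chi> reach_trans by metis
  moreover have "a \<in> Q - col \<phi> v" using a \<psi>(4) colv by (auto simp: P_def)
  ultimately show ?thesis using \<psi>(1) by blast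
qed

text \<open>The gadget is dismantled after each leaf, so \<open>k\<close> leaves use up only
  \<open>k\<close> reserve vertices, and the rest is returned as \<open>Z'\<close>. The color set
  \<open>A\<close> is the algorithm's choice; that freedom vanishes when \<open>k\<close> equals the
  number of colors of \<open>Q\<close> missing at \<open>v\<close>.\<close>

lemma attach_colored_leaves:
  assumes "cf \<phi>" "v < n" "v \<notin> Z" "spare \<phi> Z" "Z \<subseteq> {..<n}" "gsize + k \<le> card Z"
    "Q \<subseteq> {1..\<kappa>}" "Suc c \<le> card Q" "k \<le> card (Q - col \<phi> v)" "card (col \<phi> v) + k \<le> \<Delta>"
  shows "\<exists>\<psi> A. A \<subseteq> Q - col \<phi> v \<and> card A = k \<and> reach \<phi> \<psi> \<and> (\<forall>f\<in>dom \<phi>. \<psi> f = \<phi> f) \<and>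
    changes_in (insert v Z) \<phi> \<psi> \<and> (\<forall>f\<in>dom \<psi> - dom \<phi>. v \<in> f) \<and> col \<psi> v = col \<phi> v \<union> A \<and>
    (\<exists>Z'\<subseteq>Z. spare \<psi> Z' \<and> card Z' + k = card Z)"
  using assms
proof (induction k arbitrary: \<phi> Z)
  case (0 \<phi> Z)
  show ?case
    by (rule exI[of _ \<phi>], rule exI[of _ "{}"]) (use 0 in \<open>auto simp: reach_refl changes_in_refl\<close>)
next
  case (Suc k \<phi> Z)
  have finZ: "finite Z" using Suc.prems(5) finite_subset by blast
  have finQ: "finite (Q - col \<phi> v)" using Suc.prems(7) finite_subset by blast
  have nQ: "\<not> Q \<subseteq> col \<phi> v"
  proof
    assume "Q \<subseteq> col \<phi> v"
    then have "Q - col \<phi> v = {}" by blast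
    with Suc.prems(9) show False by (simp del: Diff_eq_empty_iff)
  qed
  have fc: "finite (col \<phi> v)" by (rule finite_col[OF colored_forest_proper[OF Suc.prems(1)]])
  obtain j a where ja: "j \<in> Z" "a \<in> Q - col \<phi> v" "reach \<phi> (\<phi>({v, j} \<mapsto> a))"
    using attach_colored_leaf[OF Suc.prems(1-5) _ Suc.prems(7,8) nQ] Suc.prems(6,10) by auto
  define \<phi>' where "\<phi>' = \<phi>({v, j} \<mapsto> a)"
  have r1: "reach \<phi> \<phi>'" unfolding \<phi>'_def by (rule ja(3))
  have none: "\<phi> {v, j} = None" by (rule spare_None[OF Suc.prems(4)]) (use ja(1) in auto)
  have colv: "col \<phi>' v = insert a (col \<phi> v)"
    unfolding \<phi>'_def using col_upd[of \<phi> "{v, j}", OF none] by simp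
  have ch: "changes_in {v, j} \<phi> \<phi>'" unfolding \<phi>'_def by (rule changes_in_upd[OF changes_in_refl]) simp
  have sp: "spare \<phi>' (Z - {j})"
    by (rule changes_in_spare[OF spare_subset[OF Suc.prems(4)] ch]) (use Suc.prems(3) in auto)
  have dom': "dom \<phi>' = insert {v, j} (dom \<phi>)" unfolding \<phi>'_def by (rule dom_color)
  have cfk: "cf \<phi>'" by (rule reach_colored_forest[OF r1 Suc.prems(1)])
  have Qa: "Q - col \<phi>' v = (Q - col \<phi> v) - {a}" by (auto simp: colv)
  have "k \<le> card (Q - col \<phi>' v)" unfolding Qa using ja(2) Suc.prems(9) finQ by (simp add: card_Diff_singleton)
  moreover have "card (col \<phi>' v) + k \<le> \<Delta>" using Suc.prems(10) ja(2) fc by (simp add: colv)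
  moreover have "gsize + k \<le> card (Z - {j})" using Suc.prems(6) ja(1) finZ by simp
  moreover have "v \<notin> Z - {j}" "Z - {j} \<subseteq> {..<n}" using Suc.prems by auto
  ultimately obtain \<psi> A where \<psi>: "A \<subseteq> Q - col \<phi>' v" "card A = k" "reach \<phi>' \<psi>" "\<forall>f\<in>dom \<phi>'. \<psi> f = \<phi>' f"
    "changes_in (insert v (Z - {j})) \<phi>' \<psi>" "\<forall>f\<in>dom \<psi> - dom \<phi>'. v \<in> f" "col \<psi> v = col \<phi>' v \<union> A"
    "\<exists>Z'\<subseteq>Z - {j}. spare \<psi> Z' \<and> card Z' + k = card (Z - {j})"
    using Suc.IH[OF cfk Suc.prems(2) _ sp _ _ Suc.prems(7,8)] by metis
  have f1: "insert a A \<subseteq> Q - col \<phi> v" using \<psi>(1) ja(2) colv by blast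
  have f2: "card (insert a A) = Suc k"
    using \<psi>(1,2) colv finite_subset[OF \<psi>(1)] finQ Qa by (subst card_insert_disjoint) auto
  have f3: "reach \<phi> \<psi>" using r1 \<psi>(3) by (rule reach_trans)
  have f4: "\<forall>f\<in>dom \<phi>. \<psi> f = \<phi> f"
  proof
    fix f assume that: "f \<in> dom \<phi>"
    have "f \<noteq> {v, j}" using that none by auto
    then show "\<psi> f = \<phi> f" using \<psi>(4) that by (simp add: dom' \<phi>'_def)
  qed
  have f5: "changes_in (insert v Z) \<phi> \<psi>"
    by (rule changes_in_trans[OF changes_in_mono[OF ch] changes_in_mono[OF \<psi>(5)]]) (use ja(1) in auto)
  have f6: "\<forall>f\<in>dom \<psi> - dom \<phi>. v \<in> f"
  proof
    fix f assume "f \<in> dom \<psi> - dom \<phi>"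
    then show "v \<in> f" using \<psi>(6) dom' by (cases "f = {v, j}") auto
  qed
  have f7: "col \<psi> v = col \<phi> v \<union> insert a A" using \<psi>(7) colv by simp
  have f8: "\<exists>Z'\<subseteq>Z. spare \<psi> Z' \<and> card Z' + Suc k = card Z"
    using \<psi>(8) ja(1) finZ card_Suc_Diff1[OF finZ ja(1)] by (metis Diff_subset add_Suc_right subset_trans)
  show ?case
    by (rule exI[of _ \<psi>], rule exI[of _ "insert a A"]) (intro conjI f1 f2 f3 f4 f5 f6 f7 f8)
qed

text \<open>Leaves on \<open>u\<close> in colors other than \<open>b\<close> leave at most c + 1
  other colors missing there, and \<open>w\<close> is then given all of these. Only \<open>b\<close>
  remains free at both ends, so the insertion must use it. The reserve of 2\<Delta> vertices beyond
  the gadget covers the leaves at both ends.\<close>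

lemma force_leaf:
  assumes cf: "cf \<phi>" and uw: "u < n" "w < n" "u \<noteq> w" "spare \<phi> {w}"
    and b: "b \<in> {1..\<kappa>}" "b \<notin> col \<phi> u" and deg: "card (col \<phi> u) < \<Delta>"
    and Z: "spare \<phi> Z" "Z \<subseteq> {..<n}" "u \<notin> Z" "w \<notin> Z" "gsize + 2 * \<Delta> \<le> card Z"
  shows "reach \<phi> (\<phi>({u, w} \<mapsto> b))"
proof -
  \<comment> \<open>Truncated subtraction: a vertex with \<Delta> - 1 colors gets no further leaf.
    In every case \<open>u\<close> ends with \<Delta> - 2 or \<Delta> - 1 colors and can still take
    \<open>{u, w}\<close>.\<close>
  define k where "k = \<Delta> - 2 - card (col \<phi> u)"
  have fc: "finite (col \<phi> u)" by (rule finite_col[OF colored_forest_proper[OF cf]])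
  have cs: "col \<phi> u \<subseteq> {1..\<kappa>}" by (rule col_subset[OF colored_forest_proper[OF cf]])
  have "card ({1..\<kappa>} - {b} - col \<phi> u) = card ({1..\<kappa>} - {b}) - card (col \<phi> u)"
    by (rule card_Diff_subset) (use cs b fc in auto)
  also have "\<dots> = \<kappa> - 1 - card (col \<phi> u)" using b by (simp add: card_Diff_singleton)
  finally have "k \<le> card ({1..\<kappa>} - {b} - col \<phi> u)" by (simp add: k_def)
  moreover have "Suc c \<le> card ({1..\<kappa>} - {b})" using b \<Delta> by (simp add: card_Diff_singleton)
  moreover have "gsize + k \<le> card Z" using Z(5) by (simp add: k_def)
  moreover have "card (col \<phi> u) + k \<le> \<Delta>" using deg by (simp add: k_def)
  ultimately obtain \<psi> A where \<psi>: "A \<subseteq> {1..\<kappa>} - {b} - col \<phi> u" "card A = k" "reach \<phi> \<psi>"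
    "\<forall>f\<in>dom \<phi>. \<psi> f = \<phi> f" "changes_in (insert u Z) \<phi> \<psi>" "\<forall>f\<in>dom \<psi> - dom \<phi>. u \<in> f"
    "col \<psi> u = col \<phi> u \<union> A" "\<exists>Z'\<subseteq>Z. spare \<psi> Z' \<and> card Z' + k = card Z"
    using attach_colored_leaves[OF cf uw(1) Z(3,1,2), of k "{1..\<kappa>} - {b}"] by auto
  then obtain Z' where Z': "Z' \<subseteq> Z" "spare \<psi> Z'" "card Z' + k = card Z" by blast
  have cf\<psi>: "cf \<psi>" using reach_colored_forest[OF \<psi>(3) cf] .
  have spw: "spare \<psi> {w}"
    by (rule changes_in_spare[OF uw(4) \<psi>(5)]) (use uw Z in auto)
  have colw: "col \<psi> w = {}" using spare_col[OF spw] by simp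
  have bu: "b \<notin> col \<psi> u" using \<psi>(1,7) b by auto
  have csu: "col \<psi> u \<subseteq> {1..\<kappa>}" by (rule col_subset[OF colored_forest_proper[OF cf\<psi>]])
  have fu: "finite (col \<psi> u)" by (rule finite_col[OF colored_forest_proper[OF cf\<psi>]])
  have "card (col \<psi> u) = card (col \<phi> u) + k"
    unfolding \<psi>(7) using \<psi>(1,2) fc by (subst card_Un_disjoint) (auto intro: finite_subset)
  then have cu: "\<Delta> - 2 \<le> card (col \<psi> u)" "card (col \<psi> u) < \<Delta>" using deg \<Delta> by (auto simp: k_def)
  define M where "M = {1..\<kappa>} - {b} - col \<psi> u"
  have "card M = card ({1..\<kappa>} - {b}) - card (col \<psi> u)"
    unfolding M_def by (rule card_Diff_subset) (use csu bu fu in auto)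
  then have cM: "card M \<le> Suc c" using cu b by (simp add: card_Diff_singleton)
  \<comment> \<open>\<open>M\<close> is enlarged to exactly c + 1 colors, the least number that
    \<open>attach_colored_leaves\<close> accepts; asking for c + 1 leaves then exhausts
    \<open>Q\<close>.\<close>
  obtain Q where Q: "M \<subseteq> Q" "Q \<subseteq> {1..\<kappa>} - {b}" "card Q = Suc c"
  proof -
    have "Suc c \<le> card ({1..\<kappa>} - {b})" "M \<subseteq> {1..\<kappa>} - {b}" "finite ({1..\<kappa>} - {b})"
      using b \<Delta> by (auto simp: M_def card_Diff_singleton)
    from exists_subset_between[OF cM this] show thesis using that by blast
  qed
  have q: "w \<notin> Z'" "Z' \<subseteq> {..<n}" "Q \<subseteq> {1..\<kappa>}" "Suc c \<le> card Q" "Suc c \<le> card (Q - col \<psi> w)"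
    "card (col \<psi> w) + Suc c \<le> \<Delta>"
    using Z Z'(1) Q colw c \<Delta> by auto
  have "gsize + Suc c \<le> card Z'" using Z'(3) Z(5) c \<Delta> by (simp add: k_def)
  then obtain \<chi> B where \<chi>: "B \<subseteq> Q - col \<psi> w" "card B = Suc c" "reach \<psi> \<chi>"
    "\<forall>f\<in>dom \<psi>. \<chi> f = \<psi> f" "changes_in (insert w Z') \<psi> \<chi>" "\<forall>f\<in>dom \<chi> - dom \<psi>. w \<in> f"
    "col \<chi> w = col \<psi> w \<union> B"
    using attach_colored_leaves[OF cf\<psi> uw(2) q(1) Z'(2) q(2) _ q(3-6)] by metis
  have cf\<chi>: "cf \<chi>" using reach_colored_forest[OF \<chi>(3) cf\<psi>] .
  have "finite Q" using Q(2) finite_subset by blast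
  then have "B = Q" using \<chi>(1,2) Q(3) colw by (intro card_subset_eq) auto
  then have colw': "col \<chi> w = Q" using \<chi>(7) colw by simp
  have colu': "col \<chi> u = col \<psi> u" by (rule changes_in_col[OF \<chi>(5)]) (use uw Z Z' in auto)
  have spwz: "spare \<psi> (insert w Z')" using spw Z'(2) by (auto simp: spare_def)
  have nt: "\<not> same_tree (dom \<chi>) u w"
    by (rule not_same_tree_sym, rule closed_zone_not_same_tree[OF changes_in_closed[OF spwz \<chi>(5)]])
      (use uw Z Z' in auto)
  have "b \<notin> col \<chi> u \<union> col \<chi> w" using bu colu' colw' Q(2) by auto
  then have free: "\<not> {1..\<kappa>} \<subseteq> col \<chi> u \<union> col \<chi> w" using b by blast
  have "card (col \<chi> u) < \<Delta>" "card (col \<chi> w) < \<Delta>" using colu' cu colw' Q(3) c \<Delta> by auto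
  then obtain a where a: "a \<in> {1..\<kappa>}" "a \<notin> col \<chi> u" "a \<notin> col \<chi> w" "\<chi> {u, w} = None"
    "reach \<chi> (\<chi>({u, w} \<mapsto> a))"
    using free_insert[OF cf\<chi> uw(1,2) nt _ _ free] by metis
  have "a = b" using a(1-3) Q(1) colu' colw' by (auto simp: M_def)
  define \<omega> where "\<omega> = \<chi>({u, w} \<mapsto> b)"
  have \<omega>: "reach \<chi> \<omega>" unfolding \<omega>_def using a(5) \<open>a = b\<close> by simp
  have same: "\<omega> f = \<phi> f" if "f \<in> dom \<phi>" for f
  proof -
    have "\<psi> f = \<phi> f" using \<psi>(4) that by simp
    moreover then have "f \<in> dom \<psi>" using that by (metis domIff)
    then have "\<chi> f = \<psi> f" using \<chi>(4) by simp
    moreover have "f \<noteq> {u, w}" using that uw(4) by (auto simp: spare_def)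
    ultimately show ?thesis by (simp add: \<omega>_def)
  qed
  have "\<omega> |` (insert {u, w} (dom \<phi>)) = \<phi>({u, w} \<mapsto> b)"
    by (rule restrict_extension[of \<phi> \<omega>, OF same]) (auto simp: \<omega>_def)
  moreover have "reach \<omega> (\<omega> |` (insert {u, w} (dom \<phi>)))"
    by (rule reach_restrict[OF reach_colored_forest[OF \<omega> cf\<chi>]])
  ultimately show ?thesis using \<psi>(3) \<chi>(3) \<omega> reach_trans by metis
qed

lemma reach_leaf_built:
  assumes "leaf_built \<phi>" "cf \<phi>" "spare \<phi> Z" "Z \<subseteq> {..<n}" "gsize + 2 * \<Delta> \<le> card Z"
  shows "reach Map.empty \<phi>"
  using assms
proof induction
  case empty
  show ?case by (rule reach_refl)
next
  case (leaf \<phi> u w a)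
  define \<psi> where "\<psi> = \<phi>({u, w} \<mapsto> a)"
  have none: "\<phi> {u, w} = None"
  proof (rule ccontr)
    assume "\<phi> {u, w} \<noteq> None"
    then have "{u, w} \<in> dom \<phi>" by (simp add: domIff)
    then show False using leaf.hyps(3) by auto
  qed
  have cf\<psi>: "cf \<psi>" unfolding \<psi>_def by (rule leaf.prems(1))
  have spZ: "spare \<psi> Z" unfolding \<psi>_def by (rule leaf.prems(2))
  have d: "dom \<psi> = insert {u, w} (dom \<phi>)" unfolding \<psi>_def by (rule dom_color)
  have res: "\<psi> |` (- {{u, w}}) = \<phi>"
    by (rule ext) (use none in \<open>auto simp: \<psi>_def restrict_map_def\<close>)
  have cf\<phi>: "cf \<phi>" using colored_forest_restrict[OF cf\<psi>, of "- {{u, w}}"] unfolding res .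
  have sp: "spare \<phi> Z" using spZ d by (simp add: spare_def)
  have uw: "u < n" "w < n" using colored_forest_graph[OF cf\<psi>] by (auto simp: d graph_on_def)
  have uwZ: "u \<notin> Z" "w \<notin> Z" using spZ by (auto simp: d spare_def)
  have spw: "spare \<phi> {w}" using leaf.hyps(3) by (simp add: spare_def)
  have pr: "proper_edge_coloring \<kappa> (dom \<psi>) \<psi>" by (rule colored_forest_proper[OF cf\<psi>])
  have a: "a \<in> {1..\<kappa>}" by (rule proper_range[OF pr, of "{u, w}"]) (simp add: \<psi>_def)
  have "col \<psi> u = insert a (col \<phi> u)" unfolding \<psi>_def using col_upd[of \<phi> "{u, w}", OF none] by simp
  then have "card (col \<psi> u) = Suc (card (col \<phi> u))"
    using leaf.hyps(4) finite_col[OF colored_forest_proper[OF cf\<phi>]] by simp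
  moreover have "card (col \<psi> u) \<le> \<Delta>"
    using cf\<psi> uw(1) degree_eq_card_col[OF pr] by (simp add: colored_forest_def max_degree_le_def)
  ultimately have deg: "card (col \<phi> u) < \<Delta>" by simp
  have "reach \<phi> (\<phi>({u, w} \<mapsto> a))"
    by (rule force_leaf[OF cf\<phi> uw leaf.hyps(2) spw a leaf.hyps(4) deg sp leaf.prems(3) uwZ leaf.prems(4)])
  moreover have "reach Map.empty \<phi>" by (rule leaf.IH[OF cf\<phi> sp leaf.prems(3,4)])
  ultimately show ?case using reach_trans by metis
qed

end

section \<open>Moving the hole\<close>

definition shift_step :: "coloring \<Rightarrow> edge \<Rightarrow> edge \<Rightarrow> nat \<Rightarrow> coloring" where
  "shift_step \<phi> f h a = \<phi>(f := None, h \<mapsto> a)"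

lemma col_shift_step:
  assumes "\<phi> h = None" "b \<in> col \<phi> y" "y \<in> f \<Longrightarrow> b \<noteq> a" "\<phi> f = Some a"
  shows "b \<in> col (shift_step \<phi> f h a) y"
proof -
  obtain g where g: "y \<in> g" "\<phi> g = Some b" using assms(2) unfolding col_def by blast
  have "g \<noteq> h" using g assms(1) by auto
  moreover have "g \<noteq> f"
  proof
    assume "g = f"
    then have "b = a" "y \<in> f" using g assms(4) by auto
    with assms(3) show False by simp
  qed
  ultimately have "shift_step \<phi> f h a g = Some b" using g by (simp add: shift_step_def)
  with g(1) show ?thesis by (rule colI)
qed

lemma col_shift_step_new: "y \<in> h \<Longrightarrow> a \<in> col (shift_step \<phi> f h a) y"
  by (rule colI[of y h]) (simp_all add: shift_step_def)

lemma degree_remove: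
  assumes "finite E" "f \<in> E" "v \<in> f"
  shows "Suc (degree (E - {f}) v) = degree E v"
proof -
  have "{e \<in> E - {f}. v \<in> e} = {e \<in> E. v \<in> e} - {f}" by blast
  then have "Suc (degree (E - {f}) v) = Suc (card ({e \<in> E. v \<in> e} - {f}))"
    by (simp add: degree_def)
  also have "\<dots> = card {e \<in> E. v \<in> e}" by (rule card_Suc_Diff1) (use assms in auto)
  finally show ?thesis by (simp add: degree_def)
qed

text \<open>Abstract setting for the insertion of \<open>e0\<close> between the roots
  \<open>r0\<close> and \<open>r1\<close>. \<open>D\<close> includes the hole besides the colored
  edges, so \<open>degD\<close> counts it. \<open>S\<close> and \<open>T\<close> are the two halves,
  \<open>G\<close> the pendant colors, whose edges \<open>DG\<close> never move; \<open>I\<close>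
  are the interior vertices and \<open>Ch\<close> the vertices with an active parent edge. Every
  active edge has an interior end, so the colors at the hole are controlled from at least one
  side.\<close>

locale hole_tree =
  fixes \<kappa> \<Delta> :: nat and S T G :: "nat set" and side :: "nat \<Rightarrow> bool" and I Ch :: "nat set"
    and D DG :: "edge set" and par dep :: "nat \<Rightarrow> nat" and \<phi>0 :: coloring and e0 :: edge
    and r0 r1 :: nat
  assumes colors: "{1..\<kappa>} = S \<union> T \<union> G" "S \<inter> T = {}" "S \<inter> G = {}" "T \<inter> G = {}"
    and card_classes: "card S + card G + 1 = \<Delta>" "card T = card S"
    and finD: "finite D" and degD: "\<And>y. degree D y \<le> \<Delta>"
    and e0: "e0 = {r0, r1}" "r0 \<noteq> r1" "side r0 \<noteq> side r1" "r0 \<in> I" "r1 \<in> I"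
    and proper0: "proper_edge_coloring \<kappa> (D - {e0}) \<phi>0"
    and G0: "\<And>f a. \<phi>0 f = Some a \<Longrightarrow> a \<in> G \<longleftrightarrow> f \<in> DG"
    and active: "D - DG = insert e0 ((\<lambda>x. {x, par x}) ` Ch)"
    and child: "\<And>x. x \<in> Ch \<Longrightarrow> side (par x) \<noteq> side x \<and> (x \<in> I \<or> par x \<in> I) \<and> par x \<in> I \<union> Ch \<and>
        dep x = Suc (dep (par x)) \<and> (par x \<in> Ch \<or> dep (par x) = 0)"
    and root: "r0 \<notin> Ch" "r1 \<notin> Ch"
    and color0: "\<And>x. x \<in> Ch \<Longrightarrow> \<exists>a. \<phi>0 {x, par x} = Some a \<and> a \<in> (if side (par x) then S else T)"
    and full0: "\<And>y. y \<in> I \<Longrightarrow> (if side y then S else T) \<union> G \<subseteq> col \<phi>0 y"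
    and fullG0: "\<And>x. x \<in> Ch \<Longrightarrow> G \<subseteq> col \<phi>0 x"
begin

abbreviation "C y \<equiv> (if side y then S else T)"

definition hole_inv :: "coloring \<Rightarrow> edge \<Rightarrow> bool" where
  "hole_inv \<phi> h \<longleftrightarrow> proper_edge_coloring \<kappa> (D - {h}) \<phi> \<and> h \<in> D - DG \<and>
     (\<forall>f a. \<phi> f = Some a \<longrightarrow> (a \<in> G \<longleftrightarrow> f \<in> DG)) \<and>
     (\<forall>y\<in>I. C y \<union> G \<subseteq> col \<phi> y) \<and> (\<forall>x\<in>Ch. G \<subseteq> col \<phi> x)"

lemma hole_inv_start: "hole_inv \<phi>0 e0"
  unfolding hole_inv_def using proper0 active G0 full0 fullG0 by auto

lemma active_edge:
  assumes "f \<in> D - DG" "f = {u, v}"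
  shows "side u \<noteq> side v" "u \<in> I \<or> v \<in> I" "u \<in> I \<union> Ch"
proof -
  have "f = {r0, r1} \<or> (\<exists>x\<in>Ch. f = {x, par x})" using assms(1) unfolding active using e0(1) by auto
  then have "side u \<noteq> side v \<and> (u \<in> I \<or> v \<in> I) \<and> u \<in> I \<union> Ch"
    using e0 child unfolding assms(2) by (auto simp: doubleton_eq_iff)
  then show "side u \<noteq> side v" "u \<in> I \<or> v \<in> I" "u \<in> I \<union> Ch" by auto
qed

lemma active_edge_other:
  assumes "f \<in> D - DG" "v \<in> f"
  obtains z where "f = {v, z}"
proof -
  have "f = {r0, r1} \<or> (\<exists>x\<in>Ch. f = {x, par x})" using assms(1) unfolding active using e0(1) by auto
  with assms(2) that show thesis by (auto simp: insert_commute)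
qed

lemma finite_classes: "finite S" "finite T" "finite G"
proof -
  have "finite (S \<union> T \<union> G)" unfolding colors(1)[symmetric] by simp
  then show "finite S" "finite T" "finite G" by simp_all
qed

lemma card_full: "card (C y \<union> G) = \<Delta> - 1"
proof -
  have "card (C y \<union> G) = card (C y) + card G"
    by (rule card_Un_disjoint) (use finite_classes colors in auto)
  then show ?thesis using card_classes by (auto split: if_splits)
qed

text \<open>The hole occupies one of at most \<Delta> edges at \<open>y\<close>. At most \<Delta> -
  1 colors remain, and \<open>C y \<union> G\<close> already has that many.\<close>

lemma hole_exact:
  assumes "hole_inv \<phi> h" "y \<in> I" "y \<in> h"
  shows "col \<phi> y = C y \<union> G"
proof -
  have p: "proper_edge_coloring \<kappa> (D - {h}) \<phi>" and h: "h \<in> D" and sub: "C y \<union> G \<subseteq> col \<phi> y"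
    using assms by (auto simp: hole_inv_def)
  have "card (col \<phi> y) = degree (D - {h}) y"
    using degree_eq_card_col[of \<kappa> \<phi> y] p proper_dom[OF p] by simp
  also have "\<dots> \<le> card (C y \<union> G)"
    using degree_remove[OF finD h assms(3)] degD[of y] unfolding card_full by linarith
  finally have "C y \<union> G = col \<phi> y"
    by (intro card_seteq[OF finite_col[OF p] sub])
  then show ?thesis by simp
qed

lemma class_complement: "a \<in> {1..\<kappa>} \<Longrightarrow> a \<notin> C y \<union> G \<Longrightarrow> side z \<noteq> side y \<Longrightarrow> a \<in> C z"
  unfolding colors(1) by (auto split: if_splits)

lemma class_disjoint: "a \<in> C y \<Longrightarrow> side z \<noteq> side y \<Longrightarrow> a \<notin> C z \<union> G"
  using colors(2-4) by (auto split: if_splits)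

text \<open>A color missing at an interior \<open>u\<close> lies in the opposite class, which is
  that of \<open>v\<close>. If \<open>u\<close> is not interior, then \<open>v\<close> is and sees
  only \<open>C v\<close> and \<open>G\<close>, while \<open>G\<close> is present at
  \<open>u\<close> too.\<close>

lemma hole_step_color:
  assumes inv: "hole_inv \<phi> h" and h: "h = {u, v}"
    and a: "a \<in> available \<kappa> \<phi> u" "a \<notin> available \<kappa> \<phi> v"
  shows "a \<in> C v"
proof -
  have hD: "h \<in> D - DG" using inv by (simp add: hole_inv_def)
  note ends = active_edge[OF hD h]
  have a': "a \<in> {1..\<kappa>}" "a \<notin> col \<phi> u" "a \<in> col \<phi> v" using a by (auto simp: available_eq)
  show ?thesis
  proof (cases "u \<in> I")
    case True
    then have "a \<notin> C u \<union> G" using hole_exact[OF inv] h a'(2) by auto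
    then show ?thesis by (rule class_complement[OF a'(1)]) (use ends in auto)
  next
    case False
    then have "v \<in> I" "u \<in> Ch" using ends by auto
    then have "a \<in> C v \<union> G" using hole_exact[OF inv, of v] h a'(3) by auto
    moreover have "G \<subseteq> col \<phi> u" using inv \<open>u \<in> Ch\<close> by (simp add: hole_inv_def)
    ultimately show ?thesis using a'(2) by auto
  qed
qed

text \<open>Only the ends of \<open>f\<close> can lose \<open>a\<close>. The end \<open>v\<close>
  regains it through \<open>h\<close>, and the far end \<open>z\<close> is on the other side, whose
  class does not contain \<open>a\<close>.\<close>

lemma hole_step:
  assumes inv: "hole_inv \<phi> h" and h: "h = {u, v}"
    and a: "a \<in> available \<kappa> \<phi> u" "a \<notin> available \<kappa> \<phi> v" and f: "v \<in> f" "\<phi> f = Some a"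
  shows "hole_inv (shift_step \<phi> f h a) f"
proof -
  have p: "proper_edge_coloring \<kappa> (D - {h}) \<phi>" and hD: "h \<in> D - DG"
    and GD: "\<And>f a. \<phi> f = Some a \<Longrightarrow> a \<in> G \<longleftrightarrow> f \<in> DG"
    and full: "\<And>y. y \<in> I \<Longrightarrow> C y \<union> G \<subseteq> col \<phi> y" and fullG: "\<And>x. x \<in> Ch \<Longrightarrow> G \<subseteq> col \<phi> x"
    using inv by (auto simp: hole_inv_def)
  have dom: "dom \<phi> = D - {h}" by (rule proper_dom[OF p])
  have none: "\<phi> h = None" using dom by auto
  have aC: "a \<in> C v" by (rule hole_step_color[OF inv h a])
  then have aG: "a \<notin> G" using colors(3,4) by (auto split: if_splits)
  have "f \<in> dom \<phi>" using f(2) by blast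
  then have fD: "f \<in> D - DG" using dom GD[OF f(2)] aG by auto
  have fh: "f \<noteq> h" using none f(2) by auto
  obtain z where z: "f = {v, z}" using active_edge_other[OF fD f(1)] .
  have sz: "side v \<noteq> side z" using active_edge(1)[OF fD z] .
  have "dom (shift_step \<phi> f h a) = insert h (dom \<phi> - {f})"
    unfolding shift_step_def by (rule dom_shift[of \<phi> f a, OF f(2)]) (use fh in auto)
  then have d: "dom (shift_step \<phi> f h a) = D - {f}" using hD fh unfolding dom by auto
  have "proper_edge_coloring \<kappa> (dom \<phi>) \<phi>" using p dom by simp
  then have "proper_edge_coloring \<kappa> (dom (shift_step \<phi> f h a)) (shift_step \<phi> f h a)"
    unfolding shift_step_def by (rule shift_proper[OF _ h a(1) f])
  then have p': "proper_edge_coloring \<kappa> (D - {f}) (shift_step \<phi> f h a)" unfolding d .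
  have keep: "b \<in> col (shift_step \<phi> f h a) y" if "b \<in> col \<phi> y" "y \<in> f \<Longrightarrow> b \<noteq> a" for b y
    by (rule col_shift_step[of \<phi>, OF none that f(2)])
  have "b \<in> G \<longleftrightarrow> g \<in> DG" if "shift_step \<phi> f h a g = Some b" for g b
  proof (cases "g = h")
    case True
    then have "b = a" using that by (simp add: shift_step_def)
    then show ?thesis using True aG hD by simp
  next
    case False
    then have "\<phi> g = Some b" using that by (simp add: shift_step_def split: if_splits)
    then show ?thesis by (rule GD)
  qed
  moreover have "C y \<union> G \<subseteq> col (shift_step \<phi> f h a) y" if y: "y \<in> I" for y
  proof
    fix b assume b: "b \<in> C y \<union> G"
    show "b \<in> col (shift_step \<phi> f h a) y"
    proof (cases "y = v \<and> b = a")
      case True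
      then show ?thesis using col_shift_step_new[of v h] h by simp
    next
      case False
      have "b \<noteq> a" if "y \<in> f"
        using that False b class_disjoint[OF aC, of z] sz z by auto
      then show ?thesis using keep full[OF y] b by blast
    qed
  qed
  moreover have "G \<subseteq> col (shift_step \<phi> f h a) x" if "x \<in> Ch" for x
    using keep fullG[OF that] aG by blast
  ultimately show ?thesis unfolding hole_inv_def using p' fD by blast
qed

section \<open>Recording the route of the hole\<close>

lemma funpow_dep:
  assumes "z \<in> Ch" "k < dep z"
  shows "(par ^^ k) z \<in> Ch \<and> dep ((par ^^ k) z) = dep z - k"
  using assms(2)
proof (induction k)
  case 0
  then show ?case using assms by simp
next
  case (Suc k)
  then have "(par ^^ k) z \<in> Ch" "dep ((par ^^ k) z) = dep z - k" by auto
  then show ?case using child[of "(par ^^ k) z"] Suc.prems by auto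
qed

abbreviation "up_edge z k \<equiv> {(par ^^ k) z, par ((par ^^ k) z)}"

lemma child_edge_inj:
  assumes "x \<in> Ch" "y \<in> Ch" "{x, par x} = {y, par y}"
  shows "x = y"
  using child[OF assms(1)] child[OF assms(2)] assms(3) by (auto simp: doubleton_eq_iff)

text \<open>All edges on the way from the inserted edge to the hole have been shifted.\<close>

definition toward :: "coloring \<Rightarrow> edge \<Rightarrow> bool" where
  "toward \<phi> h \<longleftrightarrow> (\<forall>z\<in>Ch. h = {z, par z} \<longrightarrow>
     (\<forall>k. 0 < k \<and> k < dep z \<longrightarrow> (\<exists>b\<in>C ((par ^^ k) z). \<phi> (up_edge z k) = Some b)))"

lemma toward_start: "toward \<phi> e0"
  unfolding toward_def using root e0(1) by (auto simp: doubleton_eq_iff)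

lemma up_edge_below:
  assumes "x \<in> Ch" "z \<in> Ch" "k < dep z" "dep z - k \<noteq> dep x"
  shows "up_edge z k \<noteq> {x, par x}"
proof
  assume eq: "up_edge z k = {x, par x}"
  have "(par ^^ k) z = x"
    by (rule child_edge_inj[OF _ assms(1) eq]) (use funpow_dep[OF assms(2,3)] in simp)
  then show False using funpow_dep[OF assms(2,3)] assms(4) by simp
qed

text \<open>Below the roots the hole moves to a parent, child or sibling edge. The edges above the
  new hole are among those above the old one, except that a move to a child adds the old hole
  itself, which has just been colored from the class of its lower end.\<close>

lemma toward_step:
  assumes tow: "toward \<phi> h" and h: "h \<in> D - DG" "v \<in> h" and f: "f \<in> D - DG" "v \<in> f" "f \<noteq> h"
    and a: "a \<in> C v"
  shows "toward (shift_step \<phi> f h a) f"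
  unfolding toward_def
proof (intro ballI impI allI)
  fix z k assume z: "z \<in> Ch" "f = {z, par z}" and k: "0 < k \<and> k < dep z"
  have zk: "(par ^^ k) z \<in> Ch" using funpow_dep[OF z(1)] k by simp
  have keep: "shift_step \<phi> f h a (up_edge z k) = \<phi> (up_edge z k)" if "up_edge z k \<noteq> h"
  proof -
    have "up_edge z k \<noteq> f" unfolding z(2) by (rule up_edge_below[OF z(1,1)]) (use k in auto)
    then show ?thesis using that unfolding shift_step_def by simp
  qed
  have v: "v = z \<or> v = par z" using f(2) z(2) by auto
  \<comment> \<open>From 0 < k < \<open>dep z\<close> the parent of \<open>z\<close> is not a root,
    so the old hole is not \<open>e0\<close>.\<close>
  have "v \<in> Ch"
    using v z(1) funpow_dep[OF z(1), of 1] k by auto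
  then have "h \<noteq> e0" using h(2) root e0(1) by auto
  then obtain x where x: "x \<in> Ch" "h = {x, par x}" using h(1) unfolding active by blast
  show "\<exists>b\<in>C ((par ^^ k) z). shift_step \<phi> f h a (up_edge z k) = Some b"
  proof (cases "up_edge z k = h")
    case True
    then have "(par ^^ k) z = x" using child_edge_inj[OF zk x(1)] x(2) by simp
    then have dx: "dep x = dep z - k" using funpow_dep[OF z(1), of k] k by simp
    have "v = x"
      using v h(2) x(2) dx k child[OF z(1)] child[OF x(1)] by auto
    then have "a \<in> C ((par ^^ k) z)" using a \<open>(par ^^ k) z = x\<close> by simp
    moreover have "shift_step \<phi> f h a h = Some a" by (simp add: shift_step_def)
    ultimately show ?thesis using True by auto
  next
    case False
    have T: "\<exists>b\<in>C ((par ^^ l) x). \<phi> (up_edge x l) = Some b" if "0 < l" "l < dep x" for l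
      using tow x that by (auto simp: toward_def)
    have "\<exists>l. 0 < l \<and> l < dep x \<and> (par ^^ l) x = (par ^^ k) z"
    proof -
      consider "v = z" "v = par x" | "v = par z" "v = x" | "v = par z" "v = par x"
        using v h(2) x(2) f(3) z(2) by auto
      then show ?thesis
      proof cases
        case 1
        then have "(par ^^ Suc k) x = (par ^^ k) z" by (simp add: funpow_swap1)
        moreover have "Suc k < dep x" using 1 k child[OF x(1)] by simp
        ultimately show ?thesis by blast
      next
        case 2
        have k1: "(par ^^ k) z = (par ^^ (k - 1)) x"
        proof -
          have "(par ^^ Suc (k - 1)) z = (par ^^ (k - 1)) (par z)" by (simp add: funpow_swap1)
          then show ?thesis using 2 k by simp
        qed
        have "k \<noteq> 1"
        proof
          assume "k = 1"
          then have "up_edge z k = h" using k1 x(2) by simp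
          with False show False by simp
        qed
        then show ?thesis using k k1 2 child[OF z(1)] by (intro exI[of _ "k - 1"]) auto
      next
        case 3
        have "(par ^^ Suc (k - 1)) z = (par ^^ Suc (k - 1)) x"
          unfolding funpow_Suc_right comp_def using 3 by simp
        then have "(par ^^ k) x = (par ^^ k) z" using k by simp
        moreover have "dep x = dep z" using 3 child[OF x(1)] child[OF z(1)] by simp
        ultimately show ?thesis using k by auto
      qed
    qed
    then obtain l where l: "0 < l" "l < dep x" "(par ^^ l) x = (par ^^ k) z" by blast
    show ?thesis using T[OF l(1,2)] unfolding l(3) keep[OF False] .
  qed
qed

lemma hole_chain:
  assumes "shift_chain \<kappa> \<phi> h es \<psi>" "hole_inv \<phi> h" "toward \<phi> h"
  shows "\<exists>\<phi>' h' u v a. hole_inv \<phi>' h' \<and> toward \<phi>' h' \<and> h' = {u, v} \<and> a \<in> available \<kappa> \<phi>' u \<and>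
    a \<in> available \<kappa> \<phi>' v \<and> \<psi> = \<phi>'(h' \<mapsto> a)"
  using assms
proof induction
  case (stop h u v a \<phi>)
  show ?case
    by (rule exI[of _ \<phi>], rule exI[of _ h], rule exI[of _ u], rule exI[of _ v], rule exI[of _ a])
      (intro conjI stop refl)
next
  case (shift h u v a \<phi> f es \<psi>)
  have inv: "hole_inv (shift_step \<phi> f h a) f"
    by (rule hole_step[OF shift.prems(1) shift.hyps(1,3,4,5,6)])
  have h: "h \<in> D - DG" "proper_edge_coloring \<kappa> (D - {h}) \<phi>"
    using shift.prems(1) unfolding hole_inv_def by blast+
  have f: "f \<in> D - DG" using inv by (simp add: hole_inv_def)
  have "f \<noteq> h" using proper_dom[OF h(2)] shift.hyps(6) by auto
  then have "toward (shift_step \<phi> f h a) f"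
    by (intro toward_step[OF shift.prems(2) h(1) _ f shift.hyps(5)]
        hole_step_color[OF shift.prems(1) shift.hyps(1,3,4)]) (use shift.hyps(1) in auto)
  with inv show ?case unfolding shift_step_def by (rule shift.IH)
qed

text \<open>Two interior ends of the hole would miss disjoint color sets, so the chain stops at an
  edge with an end outside \<open>I\<close>. From a suitable such \<open>z\<close> upwards, every
  edge then carries a color of the class of its lower end, whereas initially it was that of its
  upper end.\<close>

lemma chain_result:
  assumes chain: "shift_chain \<kappa> \<phi>0 e0 es \<psi>"
  shows "\<exists>z. z \<in> Ch \<and> z \<notin> I \<and> (\<forall>k<dep z. \<exists>a\<in>C ((par ^^ k) z). \<psi> (up_edge z k) = Some a)"
proof -
  obtain \<phi> h u v a where inv: "hole_inv \<phi> h" and tow: "toward \<phi> h" and h: "h = {u, v}"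
    and a: "a \<in> available \<kappa> \<phi> u" "a \<in> available \<kappa> \<phi> v" and \<psi>: "\<psi> = \<phi>(h \<mapsto> a)"
    using hole_chain[OF chain hole_inv_start toward_start] by blast
  have p: "proper_edge_coloring \<kappa> (D - {h}) \<phi>" and hD: "h \<in> D - DG"
    using inv by (auto simp: hole_inv_def)
  have dom: "dom \<phi> = D - {h}" by (rule proper_dom[OF p])
  have a1: "a \<in> {1..\<kappa>}" by (rule available_range[OF a(1)])
  have anot: "a \<notin> C y \<union> G" if "y \<in> I" "y \<in> h" for y
  proof -
    have "y = u \<or> y = v" using that(2) unfolding h by simp
    then have "a \<notin> col \<phi> y" using a by (auto simp: available_eq)
    then show ?thesis unfolding hole_exact[OF inv that] .
  qed
  have "\<not> (u \<in> I \<and> v \<in> I)"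
  proof
    assume uv: "u \<in> I \<and> v \<in> I"
    then have "a \<notin> C u \<union> G" "a \<notin> C v \<union> G" using anot h by auto
    then show False using class_complement[OF a1, of u v] active_edge(1)[OF hD h] by auto
  qed
  then have notI: "\<not> h \<subseteq> I" unfolding h by simp
  moreover have "e0 \<subseteq> I" using e0 by simp
  ultimately have "h \<noteq> e0" by blast
  then obtain x where x: "x \<in> Ch" "h = {x, par x}" using hD unfolding active by blast
  have up: "\<exists>b\<in>C ((par ^^ k) x). \<psi> (up_edge x k) = Some b" if "0 < k" "k < dep x" for k
  proof -
    have "up_edge x k \<noteq> h" unfolding x(2) by (rule up_edge_below[OF x(1,1)]) (use that in auto)
    moreover have "\<exists>b\<in>C ((par ^^ k) x). \<phi> (up_edge x k) = Some b"
      using tow x that by (auto simp: toward_def)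
    ultimately show ?thesis unfolding \<psi> by simp
  qed
  show ?thesis
  proof (cases "par x \<in> I")
    case True
    then have xI: "x \<notin> I" using notI x(2) by simp
    have aC: "a \<in> C x"
      by (rule class_complement[OF a1 anot[OF True]]) (use child[OF x(1)] x(2) in auto)
    have "\<exists>b\<in>C ((par ^^ k) x). \<psi> (up_edge x k) = Some b" if "k < dep x" for k
    proof (cases "k = 0")
      case True
      moreover have "\<psi> h = Some a" by (simp add: \<psi>)
      ultimately show ?thesis using aC x(2) by auto
    next
      case False
      then show ?thesis using up[of k] that by simp
    qed
    with x(1) xI show ?thesis by blast
  next
    case False
    \<comment> \<open>Here the hole lies just below a non-interior vertex; that vertex, not the
      lower end of the hole, is the witness.\<close>
    then have q: "par x \<in> Ch" using child[OF x(1)] by blast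
    have "\<exists>b\<in>C ((par ^^ k) (par x)). \<psi> (up_edge (par x) k) = Some b" if "k < dep (par x)" for k
      using up[of "Suc k"] that child[OF x(1)] by (simp add: funpow_swap1)
    with q False show ?thesis by blast
  qed
qed

text \<open>Each of the \<open>dep z\<close> edges above \<open>z\<close> has passed to a disjoint
  class and therefore counts. If the recourse is no larger than that, no other old edge has changed;
  this equality case pins down the cheapest chain.\<close>

lemma chain_recourse:
  assumes chain: "shift_chain \<kappa> \<phi>0 e0 es \<psi>"
  obtains z where "z \<in> Ch" "z \<notin> I" "dep z \<le> recourse \<phi>0 \<psi>"
    "\<And>k. k < dep z \<Longrightarrow> \<exists>a\<in>C ((par ^^ k) z). \<psi> (up_edge z k) = Some a"
    "\<And>f. \<lbrakk>recourse \<phi>0 \<psi> \<le> dep z; f \<in> dom \<phi>0; \<And>k. k < dep z \<Longrightarrow> f \<noteq> up_edge z k\<rbrakk> \<Longrightarrow> \<psi> f = \<phi>0 f"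
proof -
  obtain z where z: "z \<in> Ch" "z \<notin> I"
    and up: "\<And>k. k < dep z \<Longrightarrow> \<exists>a\<in>C ((par ^^ k) z). \<psi> (up_edge z k) = Some a"
    using chain_result[OF chain] by blast
  define X where "X = {f \<in> dom \<phi>0 \<inter> dom \<psi>. \<phi>0 f \<noteq> \<psi> f}"
  have dom0: "dom \<phi>0 = D - {e0}" by (rule proper_dom[OF proper0])
  have "finite (dom \<phi>0)" using finD dom0 by simp
  then have finX: "finite X" by (simp add: X_def)
  have sub: "up_edge z ` {..<dep z} \<subseteq> X"
  proof
    fix f assume "f \<in> up_edge z ` {..<dep z}"
    then obtain k where k: "k < dep z" "f = up_edge z k" by blast
    have x: "(par ^^ k) z \<in> Ch" using funpow_dep[OF z(1) k(1)] by simp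
    obtain a where a: "a \<in> C ((par ^^ k) z)" "\<psi> f = Some a" using up[OF k(1)] k(2) by blast
    obtain b where b: "b \<in> C (par ((par ^^ k) z))" "\<phi>0 f = Some b" using color0[OF x] k(2) by auto
    have "b \<notin> C ((par ^^ k) z)"
      using class_disjoint[OF b(1), of "(par ^^ k) z"] child[OF x] by blast
    then have "a \<noteq> b" using a(1) by blast
    then show "f \<in> X" using a(2) b(2) by (simp add: X_def domIff)
  qed
  have inj: "inj_on (up_edge z) {..<dep z}"
  proof (rule inj_onI)
    fix k l assume kl: "k \<in> {..<dep z}" "l \<in> {..<dep z}" "up_edge z k = up_edge z l"
    have "(par ^^ k) z = (par ^^ l) z"
      by (rule child_edge_inj[OF _ _ kl(3)]) (use funpow_dep[OF z(1)] kl in auto)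
    then have "dep z - k = dep z - l"
      using funpow_dep[OF z(1), of k] funpow_dep[OF z(1), of l] kl(1,2) by auto
    then show "k = l" using kl(1,2) by auto
  qed
  have le: "dep z \<le> recourse \<phi>0 \<psi>"
    using card_mono[OF finX sub] card_image[OF inj] by (simp add: recourse_def X_def)
  show thesis
  proof (rule that[OF z le up])
    fix f assume rec: "recourse \<phi>0 \<psi> \<le> dep z" and f: "f \<in> dom \<phi>0"
      and nf: "\<And>k. k < dep z \<Longrightarrow> f \<noteq> up_edge z k"
    have "card X \<le> card (up_edge z ` {..<dep z})"
      using rec card_image[OF inj] by (simp add: recourse_def X_def)
    then have "up_edge z ` {..<dep z} = X" by (rule card_seteq[OF finX sub])
    then have "f \<notin> X" using nf by blast
    moreover have "e0 \<notin> dom \<phi>0" using dom0 by simp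
    then have "dom \<psi> = insert e0 (dom \<phi>0)"
      using shift_chain_proper[OF chain] proper0 dom0 by simp
    ultimately show "\<psi> f = \<phi>0 f" using f by (auto simp: X_def)
  qed
qed

end

section \<open>The bad forest\<close>

text \<open>Tree edges are named by their lower vertex, so colors can be given as a function of
  vertices and transported along an injective \<open>E\<close>.\<close>

definition indexed_coloring :: "'a set \<Rightarrow> ('a \<Rightarrow> edge) \<Rightarrow> ('a \<Rightarrow> nat) \<Rightarrow> coloring" where
  "indexed_coloring V E \<chi> f = (if f \<in> E ` V then Some (\<chi> (inv_into V E f)) else None)"

lemma indexed_coloring_dom: "dom (indexed_coloring V E \<chi>) = E ` V"
  by (auto simp: indexed_coloring_def dom_def)

lemma indexed_coloring_Some:
  assumes "inj_on E V"
  shows "indexed_coloring V E \<chi> f = Some a \<longleftrightarrow> (\<exists>v\<in>V. f = E v \<and> a = \<chi> v)"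
  using assms by (auto simp: indexed_coloring_def)

lemma indexed_coloring_edge: "inj_on E V \<Longrightarrow> v \<in> V \<Longrightarrow> indexed_coloring V E \<chi> (E v) = Some (\<chi> v)"
  using indexed_coloring_Some[of E V \<chi>] by blast

lemma indexed_coloring_insert:
  assumes "inj_on E (insert v V)" "v \<notin> V"
  shows "indexed_coloring (insert v V) E \<chi> = (indexed_coloring V E \<chi>)(E v \<mapsto> \<chi> v)"
proof (rule map_le_antisym; unfold map_le_def; intro ballI)
  have inj: "inj_on E V" using assms(1) inj_on_subset by blast
  have new: "E v \<notin> E ` V" using assms by auto
  fix f
  show "indexed_coloring (insert v V) E \<chi> f = ((indexed_coloring V E \<chi>)(E v \<mapsto> \<chi> v)) f" for f
  proof (cases "f = E v")
    case True
    then show ?thesis using indexed_coloring_edge[OF assms(1), of v \<chi>] by simp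
  next
    case False
    show ?thesis
    proof (cases "f \<in> E ` V")
      case True
      then obtain w where w: "w \<in> V" "f = E w" by blast
      then show ?thesis
        using False indexed_coloring_edge[OF assms(1), of w \<chi>] indexed_coloring_edge[OF inj, of w \<chi>] by simp
    next
      case nin: False
      then show ?thesis using False by (simp add: indexed_coloring_def)
    qed
  qed
  then show "((indexed_coloring V E \<chi>)(E v \<mapsto> \<chi> v)) f = indexed_coloring (insert v V) E \<chi> f" by simp
qed

text \<open>The vertex \<open>(i, as, 0)\<close> lies in the tree that hangs off the \<open>i\<close>-th vertex \<open>(i, [], 0)\<close> of
  the spine, and \<open>as\<close> lists the branches taken on the way from it to the spine. The vertices
  \<open>(i, as, b)\<close> with \<open>b > 0\<close> are pendant leaves at \<open>(i, as, 0)\<close> that never get recolored.\<close>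

type_synonym vertex = "nat \<times> nat list \<times> nat"

text \<open>A full product, hence easy to count and closed under mirroring. Triples that violate
  \<open>branch_address\<close> only name isolated vertices.\<close>

definition vertices :: "nat \<Rightarrow> nat \<Rightarrow> nat \<Rightarrow> vertex set" where
  "vertices K g m = {..Suc m} \<times> {as. set as \<subseteq> {..<K} \<and> length as \<le> m} \<times> {..g}"

text \<open>At the inner vertices of the spine, branch \<open>0\<close> is the next edge of the spine.\<close>

definition branch_address :: "nat \<Rightarrow> nat \<Rightarrow> nat \<Rightarrow> nat list \<Rightarrow> bool" where
  "branch_address K m i as \<longleftrightarrow> i \<le> Suc m \<and> set as \<subseteq> {..<K} \<and> length as \<le> m \<and>
     (as \<noteq> [] \<and> 1 \<le> i \<and> i \<le> m \<longrightarrow> last as \<noteq> 0)"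

text \<open>Among the triples that satisfy the address condition, the roots left out are (0, [], 0),
  (1, [], 0) and (m + 1, [], 0). The two spine edges absent between these three trees are the one to
  be inserted and its mirror image.\<close>

definition children :: "nat \<Rightarrow> nat \<Rightarrow> nat \<Rightarrow> vertex set" where
  "children K g m = {(i, as, b). branch_address K m i as \<and> b \<le> g \<and> (0 < b \<or> as \<noteq> [] \<or> 2 \<le> i \<and> i \<le> m)}"

fun parent :: "vertex \<Rightarrow> vertex" where
  "parent (i, as, b) = (if 0 < b then (i, as, 0) else if as \<noteq> [] then (i, tl as, 0) else (i - 1, [], 0))"

definition branch_color :: "nat \<Rightarrow> nat \<Rightarrow> nat \<Rightarrow> nat" where
  "branch_color K j p = (if even p then Suc j else K + Suc j)"

fun edge_color :: "nat \<Rightarrow> vertex \<Rightarrow> nat" where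
  "edge_color K (i, as, b) = (if 0 < b then 2 * K + b else
     if as \<noteq> [] then branch_color K (hd as) (i + length (tl as)) else branch_color K 0 (i - 1))"

fun even_vertex :: "vertex \<Rightarrow> bool" where
  "even_vertex (i, as, b) \<longleftrightarrow> even (i + length as)"

text \<open>Truncated \<open>i - 1\<close> is 0 at both ends of the inserted edge; the root with
  index \<open>m + 1\<close> needs its own case.\<close>

fun depth :: "nat \<Rightarrow> vertex \<Rightarrow> nat" where
  "depth m (i, as, b) = (if i = Suc m then 0 else i - 1) + length as"

fun rank :: "vertex \<Rightarrow> nat" where
  "rank (i, as, b) = i + length as + b"

text \<open>Left out are the deepest side tree vertices and the spine vertex with index
  \<open>m\<close>, where branch 0 would be the absent edge to index \<open>m + 1\<close>.\<close>

definition interior :: "nat \<Rightarrow> nat \<Rightarrow> vertex set" where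
  "interior K m = {(i, as, b). branch_address K m i as \<and> b = 0 \<and> length as < m \<and> \<not> (i = m \<and> as = [])}"

definition parent_edge :: "(vertex \<Rightarrow> nat) \<Rightarrow> vertex \<Rightarrow> edge" where
  "parent_edge enc v = {enc v, enc (parent v)}"

definition tree_coloring :: "nat \<Rightarrow> nat \<Rightarrow> nat \<Rightarrow> (vertex \<Rightarrow> nat) \<Rightarrow> coloring" where
  "tree_coloring K g m enc = indexed_coloring (children K g m) (parent_edge enc) (edge_color K)"

definition spine_edge :: "(vertex \<Rightarrow> nat) \<Rightarrow> nat \<Rightarrow> edge" where
  "spine_edge enc i = {enc (i, [], 0), enc (Suc i, [], 0)}"

definition colors_below :: "nat \<Rightarrow> bool \<Rightarrow> nat set" where
  "colors_below K p = (if p then {1..K} else {Suc K..2 * K})"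

lemma finite_vertices: "finite (vertices K g m)"
  unfolding vertices_def by (intro finite_cartesian_product finite_lists_length_le) auto

lemma set_tl_subset: "set (tl as) \<subseteq> set as"
  by (cases as) auto

lemma branch_address_tl: "branch_address K m i as \<Longrightarrow> branch_address K m i (tl as)"
  using set_tl_subset[of as] by (cases as) (auto simp: branch_address_def split: if_splits)

lemma branch_color_mem: "j < K \<Longrightarrow> branch_color K j p \<in> colors_below K (even p)"
  by (auto simp: branch_color_def colors_below_def)

lemma branch_color_inj: "branch_color K j p = branch_color K j' p \<Longrightarrow> j = j'"
  by (auto simp: branch_color_def split: if_splits)

lemma branch_color_parity: "even p = even q \<Longrightarrow> branch_color K j p = branch_color K j q"
  by (simp add: branch_color_def)

lemma colors_belowE:
  assumes "a \<in> colors_below K (even p)"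
  obtains j where "j < K" "a = branch_color K j p"
proof (cases "even p")
  case True
  then show ?thesis using assms that[of "a - 1"] by (auto simp: colors_below_def branch_color_def)
next
  case False
  then show ?thesis using assms that[of "a - Suc K"] by (auto simp: colors_below_def branch_color_def)
qed

lemma colors_below_disjoint: "a \<in> colors_below K p \<Longrightarrow> a \<notin> colors_below K (\<not> p)"
  by (auto simp: colors_below_def split: if_splits)

lemma colors_below_le: "a \<in> colors_below K p \<Longrightarrow> 1 \<le> a \<and> a \<le> 2 * K"
  by (auto simp: colors_below_def split: if_splits)

lemma children_rank: "v \<in> children K g m \<Longrightarrow> rank (parent v) < rank v"
  by (cases v) (auto simp: children_def)

lemma children_vertices: "v \<in> children K g m \<Longrightarrow> v \<in> vertices K g m \<and> parent v \<in> vertices K g m"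
  using set_tl_subset by (cases v) (fastforce simp: children_def vertices_def branch_address_def)

lemma finite_children: "finite (children K g m)"
  by (rule finite_subset[OF _ finite_vertices[of K g m]]) (use children_vertices in blast)

lemma edge_color_cases:
  assumes "(i, as, b) \<in> children K g m" "1 \<le> K"
  shows "if 0 < b then edge_color K (i, as, b) \<in> {Suc (2 * K)..2 * K + g}
    else edge_color K (i, as, b) \<in> colors_below K (even_vertex (parent (i, as, b))) \<and>
      even_vertex (parent (i, as, b)) \<noteq> even_vertex (i, as, b)"
proof (cases "0 < b")
  case True
  then show ?thesis using assms by (simp add: children_def)
next
  case False
  show ?thesis
  proof (cases as)
    case Nil
    then have "2 \<le> i" using assms False by (simp add: children_def)
    then show ?thesis using Nil False assms(2) branch_color_mem[of 0 K "i - 1"] by simp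
  next
    case (Cons j bs)
    then have "j < K" using assms by (simp add: children_def branch_address_def)
    then show ?thesis using Cons False branch_color_mem[of j K "i + length bs"] by simp
  qed
qed

text \<open>The delicate case compares the next spine edge with an edge into the side tree: the
  former has the color of branch 0, which \<open>branch_address\<close> bars from the
  latter.\<close>

lemma edge_color_siblings:
  assumes x: "(i, as, b) \<in> children K g m" and y: "(i', as', b') \<in> children K g m" and K: "1 \<le> K"
    and p: "parent (i, as, b) = parent (i', as', b')" and c: "edge_color K (i, as, b) = edge_color K (i', as', b')"
  shows "(i, as, b) = (i', as', b')"
proof -
  have b: "0 < b \<longleftrightarrow> 0 < b'"
    using edge_color_cases[OF x K] edge_color_cases[OF y K] c colors_below_le
    by (fastforce split: if_splits)
  show ?thesis
  proof (cases "0 < b")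
    case True
    then show ?thesis using b p c by simp
  next
    case False
    with b have b0: "b = 0" "b' = 0" by simp_all
    show ?thesis
    proof (cases as; cases as')
      assume "as = []" "as' = []"
      then show ?thesis using x y p b0 by (auto simp: children_def)
    next
      fix j bs assume A: "as = []" "as' = j # bs"
      then have e: "i' = i - 1" "bs = []" "2 \<le> i" "i \<le> m" using x p b0 by (auto simp: children_def)
      then have "j \<noteq> 0" using y A by (auto simp: children_def branch_address_def)
      moreover have "branch_color K 0 (i - 1) = branch_color K j (i - 1)" using c A b0 e by simp
      ultimately show ?thesis using branch_color_inj by blast
    next
      fix j bs assume A: "as' = []" "as = j # bs"
      then have e: "i = i' - 1" "bs = []" "2 \<le> i'" "i' \<le> m" using y p b0 by (auto simp: children_def)
      then have "j \<noteq> 0" using x A by (auto simp: children_def branch_address_def)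
      moreover have "branch_color K j (i' - 1) = branch_color K 0 (i' - 1)" using c A b0 e by simp
      ultimately show ?thesis using branch_color_inj by blast
    next
      fix j bs j' bs' assume A: "as = j # bs" "as' = j' # bs'"
      then have e: "i = i'" "bs = bs'" using p b0 by auto
      then have "branch_color K j (i + length bs) = branch_color K j' (i + length bs)" using c A b0 by simp
      then show ?thesis using branch_color_inj A e b0 by blast
    qed
  qed
qed

lemma edge_color_siblings':
  assumes "v \<in> children K g m" "w \<in> children K g m" "1 \<le> K"
    "parent v = parent w" "edge_color K v = edge_color K w"
  shows "v = w"
  using edge_color_siblings[of "fst v" "fst (snd v)" "snd (snd v)" K g m "fst w" "fst (snd w)" "snd (snd w)"] assms
  unfolding prod.collapse by blast

lemma edge_color_parent:
  assumes x: "v \<in> children K g m" and p: "parent v \<in> children K g m" and K: "1 \<le> K"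
  shows "edge_color K v \<noteq> edge_color K (parent v)"
proof -
  obtain i as b where v: "v = (i, as, b)" by (cases v)
  obtain i' as' b' where pv: "parent v = (i', as', b')" by (cases "parent v")
  have b': "b' = 0" using pv v by (auto split: if_splits)
  note 1 = edge_color_cases[OF p[unfolded pv] K] and 2 = edge_color_cases[OF x[unfolded v] K]
  have c1: "edge_color K (parent v) \<in> colors_below K (even_vertex (parent (parent v)))"
    "even_vertex (parent (parent v)) \<noteq> even_vertex (parent v)"
    using 1 b' unfolding pv by auto
  show ?thesis
  proof (cases "0 < b")
    case True
    then show ?thesis using 2 colors_below_le[OF c1(1)] unfolding v by auto
  next
    case False
    then have "edge_color K v \<in> colors_below K (even_vertex (parent v))" using 2 unfolding v by auto
    then have "edge_color K v \<notin> colors_below K (\<not> even_vertex (parent v))"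
      by (rule colors_below_disjoint)
    moreover have flip: "even_vertex (parent (parent v)) = (\<not> even_vertex (parent v))" using c1(2) by blast
    have "edge_color K (parent v) \<in> colors_below K (\<not> even_vertex (parent v))"
      by (rule c1(1)[unfolded flip])
    ultimately show ?thesis by (metis (no_types))
  qed
qed

text \<open>The embedding \<open>enc\<close> is a parameter so that the mirror image, with
  \<open>enc\<close> composed with a reflection, is again an instance and inherits every
  result.\<close>

locale spine_tree =
  fixes K g m n :: nat and enc :: "vertex \<Rightarrow> nat"
  assumes K: "1 \<le> K" and m: "2 \<le> m"
    and enc_inj: "inj_on enc (vertices K g m)" and enc_less: "\<And>v. v \<in> vertices K g m \<Longrightarrow> enc v < n"
begin

abbreviation "V \<equiv> vertices K g m"
abbreviation "Ks \<equiv> children K g m"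
abbreviation "X \<equiv> tree_coloring K g m enc"
abbreviation "E \<equiv> parent_edge enc"
abbreviation "e \<equiv> spine_edge enc"
abbreviation "P i \<equiv> enc (i, [], 0)"
abbreviation "\<kappa> \<equiv> 2 * K + g"
abbreviation "\<Delta> \<equiv> K + g + 1"
abbreviation "pendant_colors \<equiv> {Suc (2 * K)..2 * K + g}"

lemma enc_eq: "v \<in> V \<Longrightarrow> w \<in> V \<Longrightarrow> enc v = enc w \<longleftrightarrow> v = w"
  using enc_inj by (auto simp: inj_on_def)

lemma child_in_V: "v \<in> Ks \<Longrightarrow> v \<in> V" "v \<in> Ks \<Longrightarrow> parent v \<in> V"
  using children_vertices by blast+

lemma inj_edges: "inj_on E Ks"
proof (rule inj_onI)
  fix v w assume vw: "v \<in> Ks" "w \<in> Ks" "E v = E w"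
  then have "enc v = enc w \<or> enc v = enc (parent w) \<and> enc (parent v) = enc w"
    by (auto simp: parent_edge_def doubleton_eq_iff)
  then have "v = w \<or> v = parent w \<and> parent v = w"
    using vw child_in_V enc_eq by blast
  then show "v = w" using children_rank[OF vw(1)] children_rank[OF vw(2)] by auto
qed

lemma X_Some: "X f = Some a \<longleftrightarrow> (\<exists>v\<in>Ks. f = E v \<and> a = edge_color K v)"
  unfolding tree_coloring_def by (rule indexed_coloring_Some[OF inj_edges])

lemma X_edge: "v \<in> Ks \<Longrightarrow> X (E v) = Some (edge_color K v)"
  using X_Some by blast

lemma X_dom: "dom X = E ` Ks"
  unfolding tree_coloring_def by (rule indexed_coloring_dom)

lemma enc_in_edge:
  assumes "v \<in> V" "w \<in> Ks"
  shows "enc v \<in> E w \<longleftrightarrow> w = v \<or> parent w = v"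
  using enc_eq[OF assms(1) child_in_V(1)[OF assms(2)]] enc_eq[OF assms(1) child_in_V(2)[OF assms(2)]]
  by (auto simp: parent_edge_def)

lemma edge_color_inj:
  assumes "v \<in> Ks" "w \<in> Ks" "x \<in> E v" "x \<in> E w" "edge_color K v = edge_color K w"
  shows "v = w"
proof -
  have "x = enc v \<or> x = enc (parent v)" using assms(3) by (auto simp: parent_edge_def)
  then obtain y where y: "y \<in> V" "x = enc y" using child_in_V[OF assms(1)] by blast
  have "v = y \<or> parent v = y" "w = y \<or> parent w = y"
    using assms y enc_in_edge by blast+
  moreover have "v = w" if "parent v = y" "parent w = y"
    by (rule edge_color_siblings'[OF assms(1,2) K _ assms(5)]) (use that in simp)
  moreover have False if "v = y" "parent w = y"
    using edge_color_parent[of w K g m] K assms that by simp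
  moreover have False if "w = y" "parent v = y"
    using edge_color_parent[of v K g m] K assms that by simp
  ultimately show ?thesis by blast
qed

lemma edge_color_range:
  assumes "v \<in> Ks"
  shows "edge_color K v \<in> {1..\<kappa>}"
proof -
  obtain i as b where v: "v = (i, as, b)" by (cases v)
  show ?thesis
    using edge_color_cases[OF assms[unfolded v] K] colors_below_le unfolding v
    by (fastforce split: if_splits)
qed

lemma X_proper: "proper_edge_coloring \<kappa> (dom X) X"
proof (rule proper_edge_coloringI)
  fix f a assume "X f = Some a"
  then obtain v where "v \<in> Ks" "a = edge_color K v" using iffD1[OF X_Some] by blast
  then show "a \<in> {1..\<kappa>}" using edge_color_range by simp
next
  fix f h a x assume f: "X f = Some a" "x \<in> f" and h: "X h = Some a" "x \<in> h"
  obtain v where v: "v \<in> Ks" "f = E v" "a = edge_color K v" using iffD1[OF X_Some f(1)] by blast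
  obtain w where w: "w \<in> Ks" "h = E w" "a = edge_color K w" using iffD1[OF X_Some h(1)] by blast
  have "v = w" using edge_color_inj[OF v(1) w(1)] f(2) h(2) v w by simp
  then show "f = h" using v w by simp
qed

lemma X_graph: "graph_on n (dom X)"
  unfolding graph_on_def X_dom
proof (intro ballI conjI)
  fix f assume "f \<in> E ` Ks"
  then obtain v where v: "v \<in> Ks" "f = E v" by blast
  have "v \<noteq> parent v" using children_rank[OF v(1)] by auto
  then have "enc v \<noteq> enc (parent v)" using enc_eq child_in_V[OF v(1)] by blast
  then show "card f = 2" using v(2) by (simp add: parent_edge_def)
  show "f \<subseteq> {..<n}" using v child_in_V enc_less by (auto simp: parent_edge_def)
qed

text \<open>When vertices are added by nondecreasing \<open>rank\<close>, each new one is a fresh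
  leaf: a present edge through it would belong to one of its children, whose rank is larger.\<close>

lemma X_leaf_built: "leaf_built X"
proof -
  have "W \<subseteq> Ks \<longrightarrow> leaf_built (indexed_coloring W E (edge_color K))" if "finite W" for W
    using that
  proof (induction W rule: finite_ranking_induct[where f = rank])
    case empty
    have "indexed_coloring {} E (edge_color K) = Map.empty"
      by (rule ext) (simp add: indexed_coloring_def)
    then show ?case by (simp add: leaf_built.empty)
  next
    case (insert v W)
    show ?case
    proof (cases "v \<in> W")
      case True
      then show ?thesis using insert by (simp add: insert_absorb)
    next
      case False
      show ?thesis
      proof
        assume sub: "insert v W \<subseteq> Ks"
        then have v: "v \<in> Ks" "W \<subseteq> Ks" by auto
        let ?\<phi> = "indexed_coloring W E (edge_color K)"
        have injW: "inj_on E W" using inj_edges v(2) inj_on_subset by blast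
        have new: "enc v \<notin> E w" if w: "w \<in> W" for w
        proof
          assume "enc v \<in> E w"
          then have "w = v \<or> parent w = v" using enc_in_edge child_in_V v w by blast
          then show False using False w insert.hyps(2)[OF w] children_rank[of w K g m] v(2) by auto
        qed
        have "parent v \<noteq> v" using children_rank[OF v(1)] by auto
        then have ne: "enc (parent v) \<noteq> enc v" using enc_eq child_in_V[OF v(1)] by blast
        have "leaf_built (?\<phi>({enc (parent v), enc v} \<mapsto> edge_color K v))"
        proof (rule leaf_built.leaf[OF _ ne])
          show "leaf_built ?\<phi>" using insert.IH v(2) by blast
          show "\<forall>f\<in>dom ?\<phi>. enc v \<notin> f" unfolding indexed_coloring_dom using new by blast
          show "edge_color K v \<notin> col ?\<phi> (enc (parent v))"
          proof
            assume "edge_color K v \<in> col ?\<phi> (enc (parent v))"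
            then obtain w where w: "w \<in> W" "enc (parent v) \<in> E w" "edge_color K v = edge_color K w"
              unfolding col_def using indexed_coloring_Some[OF injW] by blast
            have "enc (parent v) \<in> E v" by (simp add: parent_edge_def)
            then have "v = w" using edge_color_inj[OF v(1) _ _ w(2,3)] v(2) w(1) by blast
            with w(1) False show False by simp
          qed
        qed
        moreover have "{enc (parent v), enc v} = E v" by (simp add: parent_edge_def insert_commute)
        moreover have "inj_on E (insert v W)" using inj_edges sub inj_on_subset by blast
        ultimately show "leaf_built (indexed_coloring (insert v W) E (edge_color K))"
          using indexed_coloring_insert[OF _ False] by metis
      qed
    qed
  qed
  from this[OF finite_children] show ?thesis by (simp add: tree_coloring_def)
qed

section \<open>Colors and degrees in the bad forest\<close>

lemma col_X:
  assumes "v \<in> V"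
  shows "col X (enc v) = edge_color K ` {w \<in> Ks. w = v \<or> parent w = v}"
proof (rule set_eqI)
  fix a
  have "a \<in> col X (enc v) \<longleftrightarrow> (\<exists>w\<in>Ks. enc v \<in> E w \<and> a = edge_color K w)"
    unfolding col_def using X_Some by blast
  also have "\<dots> \<longleftrightarrow> (\<exists>w\<in>Ks. (w = v \<or> parent w = v) \<and> a = edge_color K w)"
    using enc_in_edge[OF assms] by blast
  finally show "a \<in> col X (enc v) \<longleftrightarrow> a \<in> edge_color K ` {w \<in> Ks. w = v \<or> parent w = v}" by blast
qed

lemma col_X_outside:
  assumes "x \<notin> enc ` V"
  shows "col X x = {}"
proof (rule equals0I)
  fix a assume "a \<in> col X x"
  then obtain f where f: "x \<in> f" "X f = Some a" unfolding col_def by blast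
  then obtain v where v: "v \<in> Ks" "f = E v" using iffD1[OF X_Some] by blast
  then have "f \<subseteq> enc ` V" using child_in_V[OF v(1)] by (simp add: parent_edge_def)
  with f(1) assms show False by blast
qed

lemma col_X_subset:
  assumes "v \<in> V"
  shows "col X (enc v) \<subseteq> colors_below K (even_vertex v) \<union> pendant_colors \<union>
    (if v \<in> Ks then {edge_color K v} else {})"
proof
  fix a assume "a \<in> col X (enc v)"
  then obtain w where w: "w \<in> Ks" "w = v \<or> parent w = v" "a = edge_color K w"
    unfolding col_X[OF assms] by blast
  obtain i as b where w': "w = (i, as, b)" by (cases w)
  show "a \<in> colors_below K (even_vertex v) \<union> pendant_colors \<union> (if v \<in> Ks then {edge_color K v} else {})"
    using w edge_color_cases[OF w(1)[unfolded w'] K] unfolding w' by (auto split: if_splits)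
qed

lemma pendant_col:
  assumes "branch_address K m i as"
  shows "pendant_colors \<subseteq> col X (enc (i, as, 0))"
proof
  fix a assume a: "a \<in> pendant_colors"
  have V: "(i, as, 0) \<in> V" using assms by (simp add: vertices_def branch_address_def)
  have "(i, as, a - 2 * K) \<in> Ks" using assms a by (auto simp: children_def)
  moreover have "edge_color K (i, as, a - 2 * K) = a" "parent (i, as, a - 2 * K) = (i, as, 0)"
    using a by auto
  ultimately show "a \<in> col X (enc (i, as, 0))" unfolding col_X[OF V] by (metis (mono_tags, lifting) imageI mem_Collect_eq)
qed

lemma interior_col:
  assumes "v \<in> interior K m"
  shows "colors_below K (even_vertex v) \<union> pendant_colors \<subseteq> col X (enc v)"
proof -
  obtain i as where v: "v = (i, as, 0)" and a: "branch_address K m i as" "length as < m" "\<not> (i = m \<and> as = [])"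
    using assms by (auto simp: interior_def)
  have V: "v \<in> V" using a by (simp add: v vertices_def branch_address_def)
  have "a \<in> col X (enc v)" if "a \<in> colors_below K (even_vertex v)" for a
  proof -
    have "a \<in> colors_below K (even (i + length as))" using that by (simp add: v)
    then obtain j where j: "j < K" "a = branch_color K j (i + length as)" by (rule colors_belowE)
    \<comment> \<open>On the inner spine, branch 0 is the spine edge to index i + 1. It exists
      because \<open>interior\<close> excludes index \<open>m\<close>.\<close>
    have "\<exists>w\<in>Ks. parent w = v \<and> edge_color K w = a"
    proof (cases "as = [] \<and> 1 \<le> i \<and> i \<le> m \<and> j = 0")
      case True
      then have "(Suc i, [], 0) \<in> Ks" using a by (auto simp: children_def branch_address_def)
      moreover have "parent (Suc i, [], 0) = v" "edge_color K (Suc i, [], 0) = a"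
        using True j v by auto
      ultimately show ?thesis by blast
    next
      case False
      then have "(i, j # as, 0) \<in> Ks" using a j by (auto simp: children_def branch_address_def)
      moreover have "parent (i, j # as, 0) = v" "edge_color K (i, j # as, 0) = a"
        using j v by auto
      ultimately show ?thesis by blast
    qed
    then show ?thesis unfolding col_X[OF V] by blast
  qed
  then show ?thesis using pendant_col[OF a(1)] unfolding v by blast
qed

text \<open>A vertex with a parent edge may have degree \<Delta>, a root stays one below. This slack
  makes it legal to insert an edge between roots.\<close>

lemma card_col_X:
  assumes "v \<in> V"
  shows "card (col X (enc v)) \<le> (if v \<in> Ks then \<Delta> else \<Delta> - 1)"
proof -
  let ?C = "colors_below K (even_vertex v)"
  have "card (?C \<union> pendant_colors) \<le> card ?C + card pendant_colors" by (rule card_Un_le)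
  then have base: "card (?C \<union> pendant_colors) \<le> K + g" "finite (?C \<union> pendant_colors)"
    by (auto simp: colors_below_def)
  show ?thesis
  proof (cases "v \<in> Ks")
    case True
    have "card (col X (enc v)) \<le> card (insert (edge_color K v) (?C \<union> pendant_colors))"
      by (rule card_mono) (use base True col_X_subset[OF assms] in auto)
    also have "\<dots> \<le> Suc (card (?C \<union> pendant_colors))" by (rule card_insert_le_m1) (use base in auto)
    finally show ?thesis using True base by simp
  next
    case False
    have "card (col X (enc v)) \<le> card (?C \<union> pendant_colors)"
      by (rule card_mono) (use base False col_X_subset[OF assms] in auto)
    then show ?thesis using False base by simp
  qed
qed

lemma degree_X: "degree (dom X) x \<le> \<Delta>"
proof (cases "x \<in> enc ` V")
  case True
  then obtain v where "v \<in> V" "x = enc v" by blast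
  then show ?thesis using card_col_X[of v] degree_eq_card_col[OF X_proper, of x] by (simp split: if_splits)
next
  case False
  then show ?thesis using degree_eq_card_col[OF X_proper, of x] col_X_outside by simp
qed

lemma X_colored_forest: "colored_forest n \<Delta> \<kappa> X"
  using leaf_built_forest[OF X_leaf_built X_graph] degree_X X_proper
  by (simp add: colored_forest_def max_degree_le_def)

lemma ends_V: "(0, [], 0) \<in> V" "(Suc 0, [], 0) \<in> V"
  by (auto simp: vertices_def)

lemma ends_not_children: "(0, [], 0) \<notin> Ks" "(Suc 0, [], 0) \<notin> Ks"
  by (auto simp: children_def)

lemma ends_interior: "(0, [], 0) \<in> interior K m" "(Suc 0, [], 0) \<in> interior K m"
  using m by (auto simp: interior_def branch_address_def)

lemma spine_V: "i \<le> Suc m \<Longrightarrow> (i, [], 0) \<in> V"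
  by (auto simp: vertices_def)

lemma P_eq: "i \<le> Suc m \<Longrightarrow> j \<le> Suc m \<Longrightarrow> P i = P j \<longleftrightarrow> i = j"
  using enc_eq[OF spine_V spine_V] by simp

lemma ends_not_same_tree: "\<not> same_tree (dom X) (P 0) (P (Suc 0))"
proof (rule closed_zone_not_same_tree)
  let ?Z = "enc ` {v \<in> V. fst v = 0}"
  show "closed_zone X ?Z"
    unfolding closed_zone_def X_dom
  proof (intro ballI impI)
    fix f assume "f \<in> E ` Ks" "f \<inter> ?Z \<noteq> {}"
    then obtain v x where v: "v \<in> Ks" "f = E v" "x \<in> V" "fst x = 0" "enc x \<in> E v" by blast
    have "v = x \<or> parent v = x" using enc_in_edge v by blast
    then have "fst v = 0 \<and> fst (parent v) = 0" using v(1,4)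
      by (cases v) (auto simp: children_def split: if_splits)
    then show "f \<subseteq> ?Z" using v(1,2) child_in_V[OF v(1)] by (auto simp: parent_edge_def)
  qed
  show "P 0 \<in> ?Z" using ends_V by auto
  show "P (Suc 0) \<notin> ?Z"
  proof
    assume "P (Suc 0) \<in> ?Z"
    then obtain v where v: "v \<in> V" "fst v = 0" "P (Suc 0) = enc v" by blast
    then have "v = (Suc 0, [], 0)" using enc_eq[OF ends_V(2) v(1)] by simp
    with v(2) show False by simp
  qed
qed

lemma card_col_ends: "card (col X (P 0)) < \<Delta>" "card (col X (P (Suc 0))) < \<Delta>"
  using card_col_X[OF ends_V(1)] card_col_X[OF ends_V(2)] unfolding if_not_P[OF ends_not_children(1)]
    if_not_P[OF ends_not_children(2)] by linarith+

lemma e_not_dom: "e 0 \<notin> dom X"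
proof
  assume "e 0 \<in> dom X"
  then obtain v where "v \<in> Ks" "e 0 = E v" unfolding X_dom by blast
  then have "enc (0, [], 0) \<in> E v" "enc (Suc 0, [], 0) \<in> E v" "v \<in> Ks" "E v = {P 0, P (Suc 0)}"
    by (auto simp: spine_edge_def)
  then have "parent v = (0, [], 0)" "parent v = (Suc 0, [], 0)"
    using enc_in_edge ends_V ends_not_children by blast+
  then show False by simp
qed

section \<open>The bad forest as an instance of the abstract setting\<close>

definition dec :: "nat \<Rightarrow> vertex" where
  "dec = inv_into V enc"

lemma dec_enc: "v \<in> V \<Longrightarrow> dec (enc v) = v"
  unfolding dec_def by (rule inv_into_f_f[OF enc_inj])

definition "Ch = enc ` {v \<in> Ks. snd (snd v) = 0}"
definition "Inner = enc ` interior K m"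
definition "Dg = E ` {v \<in> Ks. snd (snd v) \<noteq> 0}"
definition "par x = enc (parent (dec x))"
definition "dep x = depth m (dec x)"
definition "side x = even_vertex (dec x)"

lemma interior_V: "v \<in> interior K m \<Longrightarrow> v \<in> V"
  by (auto simp: interior_def vertices_def branch_address_def)

lemma degree_with_e: "degree (insert (e 0) (dom X)) x \<le> \<Delta>"
proof -
  have fin: "finite (insert (e 0) (dom X))" using graph_on_finite[OF X_graph] by simp
  show ?thesis
  proof (cases "x \<in> e 0")
    case True
    have "Suc (degree (insert (e 0) (dom X) - {e 0}) x) = degree (insert (e 0) (dom X)) x"
      by (rule degree_remove[OF fin _ True]) simp
    moreover have "insert (e 0) (dom X) - {e 0} = dom X" using e_not_dom by blast
    moreover have "degree (dom X) x < \<Delta>"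
      using True card_col_ends unfolding degree_eq_card_col[OF X_proper] by (auto simp: spine_edge_def)
    ultimately show ?thesis by simp
  next
    case False
    then have "degree (insert (e 0) (dom X)) x = degree (dom X) x"
      unfolding degree_def by (intro arg_cong[of _ _ card]) auto
    then show ?thesis using degree_X by simp
  qed
qed

lemma pendant_iff:
  assumes "v \<in> Ks"
  shows "edge_color K v \<in> pendant_colors \<longleftrightarrow> E v \<in> Dg"
proof -
  obtain i as b where v: "v = (i, as, b)" by (cases v)
  have "E v \<in> Dg \<longleftrightarrow> v \<in> {v \<in> Ks. snd (snd v) \<noteq> 0}"
    unfolding Dg_def by (rule inj_on_image_mem_iff[OF inj_edges assms]) blast
  also have "\<dots> \<longleftrightarrow> b \<noteq> 0" using assms unfolding v by simp
  finally have 1: "E v \<in> Dg \<longleftrightarrow> b \<noteq> 0" .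
  show ?thesis
  proof (cases "b = 0")
    case True
    then have "edge_color K v \<in> colors_below K (even_vertex (parent v))"
      using edge_color_cases[OF assms[unfolded v] K] unfolding v by auto
    then show ?thesis using 1 True colors_below_le by fastforce
  next
    case False
    then show ?thesis using 1 edge_color_cases[OF assms[unfolded v] K] unfolding v by auto
  qed
qed

lemma parent_edges_eq: "(\<lambda>x. {x, par x}) ` Ch = E ` {v \<in> Ks. snd (snd v) = 0}"
  unfolding Ch_def image_image
proof (rule image_cong)
  fix v assume "v \<in> {v \<in> Ks. snd (snd v) = 0}"
  then have "dec (enc v) = v" using dec_enc child_in_V by simp
  then show "{enc v, par (enc v)} = E v" by (simp only: par_def parent_edge_def)
qed simp

lemma active_edges: "insert (e 0) (dom X) - Dg = insert (e 0) ((\<lambda>x. {x, par x}) ` Ch)"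
proof -
  have "dom X - Dg = E ` (Ks - {v \<in> Ks. snd (snd v) \<noteq> 0})"
    unfolding X_dom Dg_def by (rule inj_on_image_set_diff[OF inj_edges, symmetric]) auto
  also have "Ks - {v \<in> Ks. snd (snd v) \<noteq> 0} = {v \<in> Ks. snd (snd v) = 0}" by auto
  finally have "dom X - Dg = (\<lambda>x. {x, par x}) ` Ch" unfolding parent_edges_eq .
  moreover have "Dg \<subseteq> dom X" unfolding X_dom Dg_def by blast
  then have "e 0 \<notin> Dg" using e_not_dom by blast
  ultimately show ?thesis by blast
qed

lemma ChE:
  assumes "x \<in> Ch"
  obtains i as where "(i, as, 0) \<in> Ks" "x = enc (i, as, 0)" "dec x = (i, as, 0)"
    "par x = enc (parent (i, as, 0))" "dec (par x) = parent (i, as, 0)"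
proof -
  obtain v where v: "v \<in> Ks" "snd (snd v) = 0" "x = enc v" using assms unfolding Ch_def by blast
  obtain i as where v': "v = (i, as, 0)" using v(2) by (cases v) auto
  have "dec x = v" "par x = enc (parent v)" "dec (par x) = parent v"
    using v child_in_V by (simp_all add: par_def dec_enc)
  with that v v' show thesis by metis
qed

lemma child_properties:
  assumes "x \<in> Ch"
  shows "side (par x) \<noteq> side x \<and> (x \<in> Inner \<or> par x \<in> Inner) \<and> par x \<in> Inner \<union> Ch \<and>
    dep x = Suc (dep (par x)) \<and> (par x \<in> Ch \<or> dep (par x) = 0)"
proof -
  obtain i as where v: "(i, as, 0) \<in> Ks" "x = enc (i, as, 0)" and d: "dec x = (i, as, 0)"
    and px: "par x = enc (parent (i, as, 0))" and dp: "dec (par x) = parent (i, as, 0)"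
    using assms by (rule ChE)
  have ba: "branch_address K m i as" "as \<noteq> [] \<or> 2 \<le> i \<and> i \<le> m"
    using v(1) by (auto simp: children_def)
  have len: "length as \<le> m" using ba(1) by (simp add: branch_address_def)
  have 1: "side (par x) \<noteq> side x"
    using edge_color_cases[OF v(1) K] unfolding side_def d dp by (simp only: less_irrefl if_False) blast
  have tl: "branch_address K m i (tl as)" "branch_address K m (i - 1) []"
    using branch_address_tl[OF ba(1)] ba(1) by (auto simp: branch_address_def)
  have len_tl: "as \<noteq> [] \<Longrightarrow> length (tl as) < m" using len by (cases as) auto
  \<comment> \<open>The only non-interior parent is the spine vertex with index \<open>m\<close>;
    its children here have address length 1 < \<open>m\<close> and are interior themselves.\<close>
  have int_or: "(i, as, 0) \<in> interior K m \<or> parent (i, as, 0) \<in> interior K m"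
  proof (cases "as = []")
    case True
    then show ?thesis using ba tl m by (auto simp: interior_def)
  next
    case False
    show ?thesis
    proof (cases "i = m \<and> tl as = []")
      case True
      then have "length as = 1" using False by (cases as) simp_all
      then have "length as < m" using m by simp
      then show ?thesis using ba(1) False unfolding interior_def by blast
    next
      case nq: False
      then show ?thesis using tl(1) len_tl[OF False] False by (simp add: interior_def)
    qed
  qed
  have pint: "parent (i, as, 0) \<in> interior K m \<or> parent (i, as, 0) \<in> Ks"
  proof (cases "as = []")
    case True
    then show ?thesis using ba tl m by (auto simp: interior_def)
  next
    case False
    then show ?thesis using tl(1) len_tl[OF False] m by (simp add: interior_def children_def)
  qed
  have dd: "depth m (i, as, 0) = Suc (depth m (parent (i, as, 0)))"
    using ba by (cases as) auto
  have root: "parent (i, as, 0) \<in> Ks \<or> depth m (parent (i, as, 0)) = 0"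
  proof -
    have "i \<le> Suc m" using ba(1) by (simp add: branch_address_def)
    then show ?thesis using ba tl by (cases as) (auto simp: children_def)
  qed
  have pb: "snd (snd (parent (i, as, 0))) = 0" by simp
  have inChI: "enc q \<in> Ch" if "q \<in> Ks" "snd (snd q) = 0" for q
    unfolding Ch_def using that by blast
  have inInnerI: "enc q \<in> Inner" if "q \<in> interior K m" for q
    unfolding Inner_def using that by (rule imageI)
  have "x \<in> Inner \<or> par x \<in> Inner"
    unfolding v(2) px[unfolded v(2)] using int_or inInnerI by metis
  moreover have "par x \<in> Inner \<union> Ch"
    unfolding px using pint pb inInnerI inChI by (metis UnCI)
  moreover have "dep x = Suc (dep (par x))" unfolding dep_def d dp by (rule dd)
  moreover have "par x \<in> Ch \<or> dep (par x) = 0"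
    using root
  proof
    assume "parent (i, as, 0) \<in> Ks"
    from inChI[OF this pb] show ?thesis unfolding px ..
  next
    assume "depth m (parent (i, as, 0)) = 0"
    then show ?thesis unfolding dep_def dp ..
  qed
  ultimately show ?thesis using 1 by blast
qed

lemma child_color:
  assumes "x \<in> Ch"
  shows "\<exists>a. X {x, par x} = Some a \<and> a \<in> (if side (par x) then {1..K} else {Suc K..2 * K})"
proof -
  obtain i as where v: "(i, as, 0) \<in> Ks" "x = enc (i, as, 0)" and d: "dec x = (i, as, 0)"
    and px: "par x = enc (parent (i, as, 0))" and dp: "dec (par x) = parent (i, as, 0)"
    using assms by (rule ChE)
  have "{x, par x} = E (i, as, 0)" by (simp only: parent_edge_def px v(2)[symmetric])
  then have "X {x, par x} = Some (edge_color K (i, as, 0))" using X_edge[OF v(1)] by simp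
  moreover have "edge_color K (i, as, 0) \<in> colors_below K (side (par x))"
    using edge_color_cases[OF v(1) K] unfolding side_def dp by (simp only: less_irrefl if_False)
  ultimately show ?thesis by (simp add: colors_below_def)
qed

lemma pendant_subset_child: "x \<in> Ch \<Longrightarrow> pendant_colors \<subseteq> col X x"
proof -
  assume "x \<in> Ch"
  then obtain i as where v: "(i, as, 0) \<in> Ks" "x = enc (i, as, 0)" by (rule ChE)
  then show ?thesis using pendant_col[of i as] by (simp add: children_def)
qed

lemma inner_full:
  assumes "y \<in> Inner"
  shows "(if side y then {1..K} else {Suc K..2 * K}) \<union> pendant_colors \<subseteq> col X y"
proof -
  obtain v where v: "v \<in> interior K m" "y = enc v" using assms unfolding Inner_def by blast
  have "dec y = v" using dec_enc[OF interior_V[OF v(1)]] v(2) by simp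
  then show ?thesis using interior_col[OF v(1)] unfolding v(2) by (simp add: side_def colors_below_def)
qed

lemma ends_not_Ch: "P 0 \<notin> Ch" "P (Suc 0) \<notin> Ch"
proof -
  have "enc v \<notin> Ch" if "v \<in> V" "v \<notin> Ks" for v
    using that enc_eq child_in_V unfolding Ch_def by blast
  then show "P 0 \<notin> Ch" "P (Suc 0) \<notin> Ch" using ends_V ends_not_children by blast+
qed

sublocale hole_tree \<kappa> \<Delta> "{1..K}" "{Suc K..2 * K}" pendant_colors side Inner Ch
  "insert (e 0) (dom X)" Dg par dep X "e 0" "P 0" "P (Suc 0)"
proof
  show "{1..\<kappa>} = {1..K} \<union> {Suc K..2 * K} \<union> pendant_colors" by auto
  show "e 0 = {P 0, P (Suc 0)}" by (simp add: spine_edge_def)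
  show "P 0 \<noteq> P (Suc 0)" using P_eq[of 0 "Suc 0"] by simp
  show "side (P 0) \<noteq> side (P (Suc 0))" by (simp add: side_def dec_enc[OF ends_V(1)] dec_enc[OF ends_V(2)])
  show "P 0 \<in> Inner" "P (Suc 0) \<in> Inner" unfolding Inner_def using ends_interior by blast+
  show "finite (insert (e 0) (dom X))" using graph_on_finite[OF X_graph] by simp
  show "degree (insert (e 0) (dom X)) y \<le> \<Delta>" for y by (rule degree_with_e)
  have "insert (e 0) (dom X) - {e 0} = dom X" using e_not_dom by blast
  then show "proper_edge_coloring \<kappa> (insert (e 0) (dom X) - {e 0}) X" using X_proper by simp
  show "a \<in> pendant_colors \<longleftrightarrow> f \<in> Dg" if fa: "X f = Some a" for f a
  proof -
    obtain v where "v \<in> Ks" "f = E v" "a = edge_color K v" using iffD1[OF X_Some fa] by blast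
    then show ?thesis using pendant_iff by simp
  qed
  show "insert (e 0) (dom X) - Dg = insert (e 0) ((\<lambda>x. {x, par x}) ` Ch)" by (rule active_edges)
  show "side (par x) \<noteq> side x \<and> (x \<in> Inner \<or> par x \<in> Inner) \<and> par x \<in> Inner \<union> Ch \<and>
    dep x = Suc (dep (par x)) \<and> (par x \<in> Ch \<or> dep (par x) = 0)" if "x \<in> Ch" for x
    using that by (rule child_properties)
  show "\<exists>a. X {x, par x} = Some a \<and> a \<in> (if side (par x) then {1..K} else {Suc K..2 * K})"
    if "x \<in> Ch" for x
    using that by (rule child_color)
  show "(if side y then {1..K} else {Suc K..2 * K}) \<union> pendant_colors \<subseteq> col X y" if "y \<in> Inner" for y
    using that by (rule inner_full)
  show "pendant_colors \<subseteq> col X x" if "x \<in> Ch" for x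
    using that by (rule pendant_subset_child)
  show "P 0 \<notin> Ch" "P (Suc 0) \<notin> Ch" by (rule ends_not_Ch)+
  show "{1..K} \<inter> {Suc K..2 * K} = {}" "{1..K} \<inter> pendant_colors = {}"
    "{Suc K..2 * K} \<inter> pendant_colors = {}" by auto
  show "card {1..K} + card pendant_colors + 1 = \<Delta>" "card {Suc K..2 * K} = card {1..K}" by simp_all
qed

end

section \<open>The cheapest chain\<close>

fun reflect :: "nat \<Rightarrow> vertex \<Rightarrow> vertex" where
  "reflect m (i, as, b) = (Suc m - i, as, b)"

lemma reflect_vertices: "v \<in> vertices K g m \<Longrightarrow> reflect m v \<in> vertices K g m"
  by (cases v) (auto simp: vertices_def)

lemma reflect_reflect: "v \<in> vertices K g m \<Longrightarrow> reflect m (reflect m v) = v"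
  by (cases v) (auto simp: vertices_def)

text \<open>Needed because reflecting twice is the identity only on \<open>vertices\<close>: beyond
  index \<open>m + 1\<close> the subtraction truncates.\<close>

lemma tree_coloring_cong:
  assumes "\<And>v. v \<in> vertices K g m \<Longrightarrow> enc v = enc' v"
  shows "tree_coloring K g m enc = tree_coloring K g m enc'"
proof
  fix f
  have eq: "parent_edge enc v = parent_edge enc' v" if "v \<in> children K g m" for v
    using assms children_vertices[OF that] by (simp add: parent_edge_def)
  then have "parent_edge enc ` children K g m = parent_edge enc' ` children K g m"
    by (intro image_cong refl)
  moreover have "inv_into (children K g m) (parent_edge enc) f = inv_into (children K g m) (parent_edge enc') f"
    unfolding inv_into_def by (rule arg_cong[of _ _ Eps]) (use eq in auto)
  ultimately show "tree_coloring K g m enc f = tree_coloring K g m enc' f"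
    by (simp add: tree_coloring_def indexed_coloring_def)
qed

context spine_tree
begin

lemma spine_child: "2 \<le> i \<Longrightarrow> i \<le> m \<Longrightarrow> (i, [], 0) \<in> Ks"
  by (simp add: children_def branch_address_def)

lemma spine_parent_edge: "E (Suc i, [], 0) = e i"
  by (simp add: parent_edge_def spine_edge_def insert_commute)

lemma X_spine: "1 \<le> i \<Longrightarrow> i < m \<Longrightarrow> X (e i) = Some (branch_color K 0 i)"
  using X_edge[OF spine_child, of "Suc i"] by (simp add: spine_parent_edge)

lemma e_eq: "i \<le> m \<Longrightarrow> j \<le> m \<Longrightarrow> e i = e j \<longleftrightarrow> i = j"
  by (auto simp: spine_edge_def doubleton_eq_iff P_eq)

lemma side_spine: "i \<le> Suc m \<Longrightarrow> side (P i) \<longleftrightarrow> even i"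
  by (simp add: side_def dec_enc spine_V)

lemma spine_inner: "i < m \<Longrightarrow> P i \<in> Inner"
  unfolding Inner_def by (intro imageI) (simp add: interior_def branch_address_def)

lemma spine_class: "i \<le> Suc m \<Longrightarrow> C (P i) = colors_below K (even i)"
  by (simp only: side_spine colors_below_def)

lemma color_in_class: "i \<le> Suc m \<Longrightarrow> branch_color K 0 i \<in> C (P i)"
  unfolding spine_class by (rule branch_color_mem) (use K in simp)

text \<open>The explicit cheap chain: after \<open>j\<close> shifts the hole is \<open>e j\<close>,
  and each earlier spine edge has the original color of its successor.\<close>

primrec moves :: "nat \<Rightarrow> coloring" where
  "moves 0 = X"
| "moves (Suc j) = shift_step (moves j) (e (Suc j)) (e j) (branch_color K 0 (Suc j))"

lemma moves_available:
  assumes j: "j < m" and inv: "hole_inv (moves j) (e j)"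
  shows "branch_color K 0 (Suc j) \<in> available \<kappa> (moves j) (P j)"
proof -
  have a: "branch_color K 0 (Suc j) \<in> C (P (Suc j))" by (rule color_in_class) (use j in simp)
  have "branch_color K 0 (Suc j) \<notin> C (P j) \<union> pendant_colors"
    by (rule class_disjoint[OF a]) (use j side_spine[of j] side_spine[of "Suc j"] in simp)
  moreover have "P j \<in> e j" by (simp add: spine_edge_def)
  ultimately have "branch_color K 0 (Suc j) \<notin> col (moves j) (P j)"
    using hole_exact[OF inv spine_inner[OF j]] by blast
  moreover have "branch_color K 0 (Suc j) \<in> {1..\<kappa>}"
  proof -
    have "branch_color K 0 (Suc j) \<in> colors_below K (even (Suc j))" by (rule branch_color_mem) (use K in simp)
    then show ?thesis using colors_below_le by fastforce
  qed
  ultimately show ?thesis by (simp add: available_eq)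
qed

lemma moves_spec:
  "j < m \<Longrightarrow> hole_inv (moves j) (e j) \<and> (\<forall>i. j < i \<and> i < m \<longrightarrow> moves j (e i) = Some (branch_color K 0 i)) \<and>
    (\<forall>f. f \<notin> e ` {..j} \<longrightarrow> moves j f = X f)"
proof (induction j)
  case 0
  then show ?case using hole_inv_start X_spine by auto
next
  case (Suc j)
  let ?a = "branch_color K 0 (Suc j)"
  have inv: "hole_inv (moves j) (e j)" and nx: "\<And>i. j < i \<Longrightarrow> i < m \<Longrightarrow> moves j (e i) = Some (branch_color K 0 i)"
    and old: "\<And>f. f \<notin> e ` {..j} \<Longrightarrow> moves j f = X f"
    using Suc by auto
  have f: "moves j (e (Suc j)) = Some ?a" using nx[of "Suc j"] Suc.prems by simp
  have v: "P (Suc j) \<in> e (Suc j)" by (simp add: spine_edge_def)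
  have ej: "e j = {P j, P (Suc j)}" by (simp add: spine_edge_def)
  have av: "?a \<in> available \<kappa> (moves j) (P j)" by (rule moves_available[OF _ inv]) (use Suc.prems in simp)
  have "?a \<in> col (moves j) (P (Suc j))" by (rule colI[of _ "e (Suc j)" "moves j", OF v f])
  then have nav: "?a \<notin> available \<kappa> (moves j) (P (Suc j))" by (simp add: available_eq)
  have "hole_inv (moves (Suc j)) (e (Suc j))"
    unfolding moves.simps by (rule hole_step[OF inv ej av nav v f])
  moreover have "moves (Suc j) (e i) = Some (branch_color K 0 i)" if "Suc j < i" "i < m" for i
    using that nx[of i] e_eq[of i j] e_eq[of i "Suc j"] by (simp add: shift_step_def)
  moreover have "moves (Suc j) f = X f" if "f \<notin> e ` {..Suc j}" for f
    using that old[of f] by (auto simp: shift_step_def atMost_Suc)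
  ultimately show ?case by blast
qed

definition final :: coloring where
  "final = (moves (m - 1))(e (m - 1) \<mapsto> branch_color K 0 m)"

text \<open>At index \<open>m\<close> only the absent edge to index \<open>m + 1\<close> would have
  the color of branch 0: the parent edge is the hole, and side branches there avoid branch
  0.\<close>

lemma final_color_free: "branch_color K 0 m \<in> available \<kappa> (moves (m - 1)) (P m)"
proof -
  have j: "m - 1 < m" "Suc (m - 1) = m" using m by auto
  have inv: "hole_inv (moves (m - 1)) (e (m - 1))" and old: "\<And>f. f \<notin> e ` {..m - 1} \<Longrightarrow> moves (m - 1) f = X f"
    using moves_spec[OF j(1)] by auto
  have "branch_color K 0 m \<in> {1..\<kappa>}"
    using moves_available[OF j(1) inv] unfolding j(2) available_eq by blast
  moreover have "branch_color K 0 m \<notin> col (moves (m - 1)) (P m)"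
  proof
    assume "branch_color K 0 m \<in> col (moves (m - 1)) (P m)"
    then obtain f where f: "P m \<in> f" "moves (m - 1) f = Some (branch_color K 0 m)" unfolding col_def by blast
    have none: "moves (m - 1) (e (m - 1)) = None"
    proof -
      have "proper_edge_coloring \<kappa> (insert (e 0) (dom X) - {e (m - 1)}) (moves (m - 1))"
        using inv unfolding hole_inv_def by blast
      from proper_dom[OF this] show ?thesis by blast
    qed
    have "f \<notin> e ` {..m - 1}"
    proof
      assume "f \<in> e ` {..m - 1}"
      then obtain i where i: "i \<le> m - 1" "f = e i" by auto
      then have "m = i \<or> m = Suc i" using f(1) P_eq[of m i] P_eq[of m "Suc i"] by (auto simp: spine_edge_def)
      then have "i = m - 1" using i(1) m by auto
      then show False using none f(2) i(2) by simp
    qed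
    then have "X f = Some (branch_color K 0 m)" using old f(2) by simp
    then obtain x where x: "x \<in> Ks" "f = E x" "branch_color K 0 m = edge_color K x"
      using iffD1[OF X_Some] by blast
    have "x = (m, [], 0) \<or> parent x = (m, [], 0)"
      using f(1) enc_in_edge[OF spine_V x(1), of m] unfolding x(2) by simp
    then show False
    proof
      assume "x = (m, [], 0)"
      then have "f = e (m - 1)" using spine_parent_edge[of "m - 1"] j(2) x(2) by simp
      then show False using \<open>f \<notin> e ` {..m - 1}\<close> by auto
    next
      assume p: "parent x = (m, [], 0)"
      obtain i as b where x': "x = (i, as, b)" by (cases x)
      have b0: "b = 0"
      proof (rule ccontr)
        assume "b \<noteq> 0"
        then have "edge_color K x > 2 * K" unfolding x' by simp
        moreover have "branch_color K 0 m \<le> 2 * K" using K by (simp add: branch_color_def)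
        ultimately show False using x(3) by simp
      qed
      show False
      proof (cases as)
        case Nil
        then have "i - 1 = m" "i \<le> m" using p b0 x(1) unfolding x' by (auto simp: children_def)
        then show False using m by simp
      next
        case (Cons k bs)
        then have "i = m" "bs = []" using p b0 unfolding x' by auto
        then have "k \<noteq> 0" using x(1) m Cons unfolding x' by (auto simp: children_def branch_address_def)
        moreover have "branch_color K 0 m = branch_color K k m"
          using x(3) Cons b0 \<open>i = m\<close> \<open>bs = []\<close> unfolding x' by simp
        ultimately show False using branch_color_inj by blast
      qed
    qed
  qed
  ultimately show ?thesis by (simp add: available_eq)
qed

text \<open>The induction runs backwards from the last hole, since a shift chain grows by prepending
  its first shift.\<close>

lemma final_chain: "shift_chain \<kappa> X (e 0) (map e [0..<m]) final"
proof -
  have ne: "P i \<noteq> P (Suc i)" if "i < m" for i using that P_eq[of i "Suc i"] by simp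
  have "shift_chain \<kappa> (moves j) (e j) (map e [j..<m]) final" if "j \<le> m - 1" for j
    using that
  proof (induction rule: inc_induct)
    case base
    have j: "m - 1 < m" "Suc (m - 1) = m" "[m - 1..<m] = [m - 1]" using m by (auto simp: upt_rec)
    have "hole_inv (moves (m - 1)) (e (m - 1))" using moves_spec[OF j(1)] by blast
    from moves_available[OF j(1) this] have a: "branch_color K 0 m \<in> available \<kappa> (moves (m - 1)) (P (m - 1))"
      unfolding j(2) .
    have ee: "e (m - 1) = {P (m - 1), P m}" using j(2) by (simp add: spine_edge_def)
    have nn: "P (m - 1) \<noteq> P m" using ne[OF j(1)] unfolding j(2) .
    show ?case unfolding j(3) list.map final_def
      by (rule shift_chain.stop[OF ee nn a final_color_free])
  next
    case (step j)
    have j: "j < m" "[j..<m] = j # [Suc j..<m]" using step.hyps by (auto simp: upt_rec)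
    have inv: "hole_inv (moves j) (e j)" and f: "moves j (e (Suc j)) = Some (branch_color K 0 (Suc j))"
      using moves_spec[OF j(1)] step.hyps by auto
    have ej: "e j = {P j, P (Suc j)}" by (simp add: spine_edge_def)
    have v: "P (Suc j) \<in> e (Suc j)" by (simp add: spine_edge_def)
    have "branch_color K 0 (Suc j) \<in> col (moves j) (P (Suc j))" by (rule colI[of _ "e (Suc j)" "moves j", OF v f])
    then have nav: "branch_color K 0 (Suc j) \<notin> available \<kappa> (moves j) (P (Suc j))" by (simp add: available_eq)
    show ?case unfolding j(2) list.map
      by (rule shift_chain.shift[OF ej ne[OF j(1)] moves_available[OF j(1) inv] nav v f
        step.IH[unfolded moves.simps shift_step_def]])
  qed
  from this[of 0] show ?thesis by simp
qed

lemma final_path: "form_path (map e [0..<m])"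
proof -
  have "distinct (map P [0..<Suc m])"
    unfolding distinct_map by (auto intro!: inj_onI simp: P_eq)
  moreover have "map e [0..<m] ! i = {map P [0..<Suc m] ! i, map P [0..<Suc m] ! Suc i}" if "i < m" for i
    using that by (simp add: spine_edge_def del: upt_Suc)
  ultimately show ?thesis
    unfolding form_path_def by (intro exI[of _ "map P [0..<Suc m]"]) (simp del: upt_Suc)
qed

lemma final_recourse: "recourse X final \<le> m - 1"
proof -
  have old: "\<And>f. f \<notin> e ` {..m - 1} \<Longrightarrow> moves (m - 1) f = X f"
    using moves_spec[of "m - 1"] m by auto
  have "{f \<in> dom X \<inter> dom final. X f \<noteq> final f} \<subseteq> e ` {1..m - 1}"
  proof
    fix f assume f: "f \<in> {f \<in> dom X \<inter> dom final. X f \<noteq> final f}"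
    have "f \<in> e ` {..m - 1}"
    proof (rule ccontr)
      assume nf: "f \<notin> e ` {..m - 1}"
      then have "f \<noteq> e (m - 1)" by auto
      then have "final f = X f" using old[OF nf] by (simp add: final_def)
      with f show False by simp
    qed
    then obtain i where i: "i \<le> m - 1" "f = e i" by auto
    then have "i \<noteq> 0" using f e_not_dom by auto
    then show "f \<in> e ` {1..m - 1}" using i by auto
  qed
  then have "recourse X final \<le> card (e ` {1..m - 1})"
    unfolding recourse_def by (intro card_mono) auto
  also have "\<dots> \<le> m - 1" using card_image_le[of "{1..m - 1}" e] by simp
  finally show ?thesis .
qed

lemma par_spine: "k \<le> m \<Longrightarrow> (par ^^ k) (P m) = P (m - k)"
proof (induction k)
  case (Suc k)
  then show ?case by (simp add: par_def dec_enc spine_V)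
qed simp

text \<open>The non-interior witness \<open>z\<close> cannot be at the bottom of a side tree, whose
  depth is at least \<open>m\<close>; so it is the spine vertex with index \<open>m\<close>, and the
  cost is attained with equality. Everything off the spine is therefore unchanged, and only the
  choice of color within the right half is left.\<close>

lemma cheap_chain:
  assumes chain: "shift_chain \<kappa> X (e 0) es \<psi>" and cheap: "recourse X \<psi> \<le> m - 1"
  shows "recourse X \<psi> = m - 1"
    "\<And>f. f \<in> dom X \<Longrightarrow> f \<notin> e ` {1..<m} \<Longrightarrow> \<psi> f = X f"
    "\<And>i. 1 \<le> i \<Longrightarrow> i < m \<Longrightarrow> \<psi> (e i) = Some (branch_color K 0 (Suc i))"
proof -
  obtain z where z: "z \<in> Ch" "z \<notin> Inner" "dep z \<le> recourse X \<psi>"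
    and up: "\<And>k. k < dep z \<Longrightarrow> \<exists>a\<in>C ((par ^^ k) z). \<psi> (up_edge z k) = Some a"
    and old: "\<And>f. \<lbrakk>recourse X \<psi> \<le> dep z; f \<in> dom X; \<And>k. k < dep z \<Longrightarrow> f \<noteq> up_edge z k\<rbrakk> \<Longrightarrow> \<psi> f = X f"
    using chain by (rule chain_recourse) blast
  obtain i as where v: "(i, as, 0) \<in> Ks" "z = enc (i, as, 0)" "dec z = (i, as, 0)" using z(1) by (rule ChE)
  have "(i, as, 0) \<notin> interior K m" using z(2) v(2) unfolding Inner_def by blast
  then have "\<not> length as < m \<or> i = m \<and> as = []" using v(1) unfolding interior_def children_def by blast
  moreover have "length as < m" using z(3) cheap v(3) m by (simp add: dep_def)
  ultimately have zm: "i = m" "as = []" by auto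
  have zP: "z = P m" using v(2) zm by simp
  have dz: "dep z = m - 1" unfolding dep_def v(3) using zm m by simp
  then show rec: "recourse X \<psi> = m - 1" using z(3) cheap by simp
  have upe: "up_edge z k = e (m - 1 - k)" if "k < m - 1" for k
  proof -
    have "(par ^^ k) z = P (Suc (m - 1 - k))" "(par ^^ Suc k) z = P (m - 1 - k)"
      using that par_spine[of k] par_spine[of "Suc k"] unfolding zP
      by (simp_all add: Suc_diff_Suc)
    then show ?thesis by (simp add: spine_edge_def insert_commute)
  qed
  show unchanged: "\<psi> f = X f" if f: "f \<in> dom X" "f \<notin> e ` {1..<m}" for f
  proof (rule old[OF _ f(1)])
    show "recourse X \<psi> \<le> dep z" using rec dz by simp
    fix k assume "k < dep z"
    then have k: "k < m - 1" using dz by simp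
    have "m - 1 - k \<in> {1..<m}" using k m by auto
    then show "f \<noteq> up_edge z k" using f(2) upe[OF k] by auto
  qed
  show "\<psi> (e i) = Some (branch_color K 0 (Suc i))" if i: "1 \<le> i" "i < m" for i
  proof -
    define k where "k = m - 1 - i"
    have k: "k < m - 1" "m - 1 - k = i" "m - k = Suc i" using i by (auto simp: k_def)
    have "(par ^^ k) z = P (Suc i)" using par_spine[of k] k(3) i unfolding zP by (simp add: k_def)
    then obtain a where a: "a \<in> C (P (Suc i))" "\<psi> (e i) = Some a"
      using up[of k] upe[OF k(1)] k dz by auto
    have "a \<in> colors_below K (even (Suc i))" using a(1) i spine_class[of "Suc i"] by simp
    then obtain j where j: "j < K" "a = branch_color K j (Suc i)" by (rule colors_belowE)
    \<comment> \<open>The side branches at index i + 1 keep their colors, so properness leaves only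
      the color of branch 0 for \<open>e i\<close>.\<close>
    have "j = 0"
    proof (rule ccontr)
      assume j0: "j \<noteq> 0"
      let ?w = "(Suc i, [j], 0)"
      have w: "?w \<in> Ks" using i j j0 m by (simp add: children_def branch_address_def)
      have "E ?w \<notin> e ` {1..<m}"
      proof
        assume "E ?w \<in> e ` {1..<m}"
        then obtain l where l: "1 \<le> l" "l < m" "E ?w = E (Suc l, [], 0)"
          using spine_parent_edge by auto
        have "(Suc l, [], 0) \<in> Ks" by (rule spine_child) (use l in auto)
        with inj_onD[OF inj_edges l(3) w] show False by simp
      qed
      moreover have "E ?w \<in> dom X" unfolding X_dom using w by blast
      ultimately have "\<psi> (E ?w) = X (E ?w)" by (intro unchanged)
      then have "\<psi> (E ?w) = Some a" using X_edge[OF w] j(2) by simp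
      moreover have "P (Suc i) \<in> E ?w" "P (Suc i) \<in> e i" by (simp_all add: parent_edge_def spine_edge_def)
      moreover have "proper_edge_coloring \<kappa> (dom \<psi>) \<psi>"
        using shift_chain_proper[OF chain X_proper e_not_dom] by blast
      ultimately have "E ?w = e i" using proper_inj[of \<kappa> "dom \<psi>" \<psi> "E ?w" a "e i" "P (Suc i)"] a(2) by blast
      then show False using \<open>E ?w \<notin> e ` {1..<m}\<close> i by auto
    qed
    then show ?thesis using a(2) j(2) by simp
  qed
qed

section \<open>The mirror image of the bad forest\<close>

abbreviation "enc' \<equiv> enc \<circ> reflect m"

lemma reflected: "spine_tree K g m n enc'"
proof
  show "inj_on enc' V"
  proof (rule comp_inj_on)
    show "inj_on (reflect m) V" by (rule inj_on_inverseI[of _ "reflect m"]) (rule reflect_reflect)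
    show "inj_on enc (reflect m ` V)"
      by (rule inj_on_subset[OF enc_inj]) (use reflect_vertices in blast)
  qed
  show "enc' v < n" if "v \<in> V" for v
    using enc_less[OF reflect_vertices[OF that]] by simp
qed (use K m in auto)

lemma double_reflection: "tree_coloring K g m (enc' \<circ> reflect m) = X"
  by (rule tree_coloring_cong) (simp add: reflect_reflect)

lemma reflected_spine_edge: "i \<le> m \<Longrightarrow> spine_edge enc' (m - i) = e i"
  by (simp add: spine_edge_def Suc_diff_le insert_commute)

text \<open>Under the mirrored embedding an off-spine edge is the same set. For odd \<open>m\<close>
  the indices i and m + 1 - i have equal parity, so its color is the same too.\<close>

lemma reflected_branch:
  assumes v: "(i, as, b) \<in> Ks" and off: "0 < b \<or> as \<noteq> []" and odd: "odd m"
  shows "reflect m (i, as, b) \<in> Ks" "parent_edge enc' (reflect m (i, as, b)) = E (i, as, b)"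
    "edge_color K (reflect m (i, as, b)) = edge_color K (i, as, b)"
proof -
  have i: "i \<le> Suc m" using v by (simp add: children_def branch_address_def)
  then show "reflect m (i, as, b) \<in> Ks" using v off by (auto simp: children_def branch_address_def)
  show "parent_edge enc' (reflect m (i, as, b)) = E (i, as, b)"
    using i off by (auto simp: parent_edge_def)
  have "even (Suc m - i + i)" using i odd by simp
  then have "even (Suc m - i + length (tl as)) = even (i + length (tl as))" unfolding even_add by blast
  then show "edge_color K (reflect m (i, as, b)) = edge_color K (i, as, b)"
    using off by (auto intro: branch_color_parity)
qed

end

section \<open>Alternating insertions\<close>

context spine_tree
begin

abbreviation "X' \<equiv> tree_coloring K g m enc'"

lemma spine_or_branch:
  assumes "v \<in> Ks"
  obtains i where "1 \<le> i" "i < m" "E v = e i"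
  | i as b where "v = (i, as, b)" "0 < b \<or> as \<noteq> []"
proof -
  obtain i as b where v: "v = (i, as, b)" by (cases v)
  show thesis
  proof (cases "0 < b \<or> as \<noteq> []")
    case True
    then show thesis using that(2) v by blast
  next
    case False
    then have "v = (i, [], 0)" "2 \<le> i" "i \<le> m" using assms v by (auto simp: children_def)
    then have "1 \<le> i - 1" "i - 1 < m" "E v = e (i - 1)" using spine_parent_edge[of "i - 1"] by auto
    then show thesis by (rule that(1))
  qed
qed

text \<open>Counted from the other end, \<open>e i\<close> has index m - i, for odd \<open>m\<close>
  of the parity of i + 1. This is the color that the cheap chain puts on \<open>e i\<close>.\<close>

lemma reflected_spine:
  assumes "1 \<le> i" "i < m" "odd m"
  shows "X' (e i) = Some (branch_color K 0 (Suc i))"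
proof -
  have "X' (spine_edge enc' (m - i)) = Some (branch_color K 0 (m - i))"
    by (rule spine_tree.X_spine[OF reflected]) (use assms in auto)
  moreover have "spine_edge enc' (m - i) = e i" by (rule reflected_spine_edge) (use assms in simp)
  moreover have "even (m - i + Suc i)" using assms by simp
  then have "even (m - i) = even (Suc i)" unfolding even_add by blast
  then have "branch_color K 0 (m - i) = branch_color K 0 (Suc i)" by (rule branch_color_parity)
  ultimately show ?thesis by simp
qed

lemma reflected_other:
  assumes f: "f \<in> dom X" "f \<notin> e ` {1..<m}" and odd: "odd m"
  shows "X' f = X f"
proof -
  obtain v where v: "v \<in> Ks" "f = E v" using f(1) unfolding X_dom by blast
  show ?thesis
    using v(1)
  proof (cases rule: spine_or_branch)
    case (1 i)
    then show ?thesis using f(2) v(2) by auto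
  next
    case (2 i as b)
    note r = reflected_branch[OF v(1)[unfolded 2(1)] 2(2) odd]
    have "X' (parent_edge enc' (reflect m (i, as, b))) = Some (edge_color K (reflect m (i, as, b)))"
      by (rule spine_tree.X_edge[OF reflected r(1)])
    then have "X' f = Some (edge_color K v)" unfolding r(2,3) v(2) 2(1) .
    then show ?thesis using X_edge[OF v(1)] v(2) by simp
  qed
qed

lemma dom_reflected_subset: "odd m \<Longrightarrow> dom X \<subseteq> dom X'"
proof
  fix f assume odd: "odd m" and f: "f \<in> dom X"
  show "f \<in> dom X'"
  proof (cases "f \<in> e ` {1..<m}")
    case True
    then obtain i where "1 \<le> i" "i < m" "f = e i" by auto
    then show ?thesis using reflected_spine[of i] odd by auto
  next
    case False
    then show ?thesis using reflected_other[OF f False odd] f by (simp add: domIff)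
  qed
qed

text \<open>The reverse inclusion is the forward one for the mirrored embedding, whose mirror image
  is the original.\<close>

lemma dom_reflected: "odd m \<Longrightarrow> dom X' = dom X"
  using dom_reflected_subset spine_tree.dom_reflected_subset[OF reflected] unfolding double_reflection
  by blast

text \<open>The color \<open>t\<close> of the inserted edge can stay open, because the next update
  deletes this edge. The locale parameter \<open>K - 1\<close> is c.\<close>

lemma insertion:
  assumes alg: "greedy_algorithm n \<Delta> (K - 1) adm alg" and odd: "odd m"
  shows "legal_update n \<Delta> (dom X) (Insert (e 0))"
    "recourse X (alg X (e 0)) = m - 1"
    "\<exists>t. alg X (e 0) = X'(e 0 \<mapsto> t)"
proof -
  have \<kappa>: "\<Delta> + (K - 1) = \<kappa>" using K by simp
  have cf: "colored_forest n \<Delta> (\<Delta> + (K - 1)) X" unfolding \<kappa> by (rule X_colored_forest)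
  show legal: "legal_update n \<Delta> (dom X) (Insert (e 0))"
    unfolding spine_edge_def
    by (rule greedy_algorithm.legal_insertI[OF alg cf enc_less[OF ends_V(1)] enc_less[OF ends_V(2)]
        ends_not_same_tree card_col_ends])
  define \<psi> where "\<psi> = alg X (e 0)"
  obtain es where es: "shift_chain \<kappa> X (e 0) es \<psi>"
    using greedy_algorithm.alg_chain[OF alg cf legal] unfolding \<kappa> \<psi>_def by blast
  have "recourse X \<psi> \<le> recourse X final"
    unfolding \<psi>_def
    by (rule greedy_algorithm.alg_minimal[OF alg cf legal greedy_algorithm.adm_path[OF alg final_path]])
      (unfold \<kappa>, rule final_chain)
  then have cheap: "recourse X \<psi> \<le> m - 1" using final_recourse by simp
  note result = cheap_chain[OF es cheap]
  show "recourse X (alg X (e 0)) = m - 1" using result(1) unfolding \<psi>_def .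
  have d: "dom \<psi> = insert (e 0) (dom X)" using shift_chain_proper[OF es X_proper e_not_dom] by blast
  then obtain t where t: "\<psi> (e 0) = Some t" by blast
  have same: "\<psi> f = X' f" if f: "f \<in> dom X" for f
  proof (cases "f \<in> e ` {1..<m}")
    case True
    then obtain i where i: "1 \<le> i" "i < m" "f = e i" by auto
    then show ?thesis using result(3)[OF i(1,2)] reflected_spine[OF i(1,2) odd] by simp
  next
    case False
    then show ?thesis using result(2)[OF f False] reflected_other[OF f False odd] by simp
  qed
  have "\<psi> f = (X'(e 0 \<mapsto> t)) f" for f
  proof (cases "f = e 0")
    case True
    then show ?thesis using t by simp
  next
    case ne: False
    show ?thesis
    proof (cases "f \<in> dom X")
      case True
      then show ?thesis using same ne by simp
    next
      case False
      then have "\<psi> f = None" "X' f = None" using ne d dom_reflected[OF odd] by (metis domIff insert_iff)+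
      then show ?thesis using ne by simp
    qed
  qed
  then have "\<psi> = X'(e 0 \<mapsto> t)" by (rule ext)
  then show "\<exists>t. alg X (e 0) = X'(e 0 \<mapsto> t)" unfolding \<psi>_def by blast
qed

end

definition alternating_updates :: "edge \<Rightarrow> edge \<Rightarrow> nat \<Rightarrow> update" where
  "alternating_updates a b t =
     (if t mod 4 = 0 then Insert a else if t mod 4 = 1 then Delete a
      else if t mod 4 = 2 then Insert b else Delete b)"

lemma alternating_legal:
  assumes "legal_update n \<Delta> D (Insert a)" "legal_update n \<Delta> D (Insert b)" "a \<notin> D" "b \<notin> D"
  shows "legal_updates n \<Delta> D (alternating_updates a b) T"
proof -
  have at: "edges_at D (alternating_updates a b) t =
    (if t mod 4 = 1 then insert a D else if t mod 4 = 3 then insert b D else D)" for t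
  proof (induction t)
    case (Suc t)
    have "t mod 4 = 0 \<or> t mod 4 = 1 \<or> t mod 4 = 2 \<or> t mod 4 = 3" by linarith
    then show ?case using Suc assms(3,4) by (auto simp: alternating_updates_def mod_Suc)
  qed simp
  show ?thesis
    unfolding legal_updates_def
  proof (intro allI impI)
    fix t :: nat
    have "t mod 4 = 0 \<or> t mod 4 = 1 \<or> t mod 4 = 2 \<or> t mod 4 = 3" by linarith
    then show "legal_update n \<Delta> (edges_at D (alternating_updates a b) t) (alternating_updates a b t)"
      unfolding at using assms(1,2) by (elim disjE) (simp_all add: alternating_updates_def)
  qed
qed

lemma alternating_run:
  assumes a: "alg \<phi> a = \<chi>(a \<mapsto> s)" "\<chi> a = None" and b: "alg \<chi> b = \<phi>(b \<mapsto> r)" "\<phi> b = None"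
  shows "run alg \<phi> (alternating_updates a b) t =
    (if t mod 4 = 0 then \<phi> else if t mod 4 = 1 then alg \<phi> a else if t mod 4 = 2 then \<chi> else alg \<chi> b)"
proof (induction t)
  case (Suc t)
  have da: "(alg \<phi> a)(a := None) = \<chi>" unfolding a(1) using a(2) by (simp add: fun_upd_idem)
  have db: "(alg \<chi> b)(b := None) = \<phi>" unfolding b(1) using b(2) by (simp add: fun_upd_idem)
  have "t mod 4 = 0 \<or> t mod 4 = 1 \<or> t mod 4 = 2 \<or> t mod 4 = 3" by linarith
  then show ?case
    unfolding run.simps Suc.IH
    by (elim disjE) (simp_all add: alternating_updates_def mod_Suc da db)
qed simp

text \<open>Insertions occupy the even times and cost at least \<open>L\<close>, deletions are
  bounded below by 0. Rounding T / 2 up gives the bound for every \<open>T\<close> from 1 on, not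
  only for full periods.\<close>

lemma alternating_amortized:
  assumes a: "alg \<phi> a = \<chi>(a \<mapsto> s)" "\<chi> a = None" and b: "alg \<chi> b = \<phi>(b \<mapsto> r)" "\<phi> b = None"
    and cost: "L \<le> recourse \<phi> (alg \<phi> a)" "L \<le> recourse \<chi> (alg \<chi> b)" and T: "1 \<le> T"
  shows "real L / 2 \<le> amortized_recourse alg \<phi> (alternating_updates a b) T"
proof -
  let ?run = "run alg \<phi> (alternating_updates a b)"
  define R where "R t = recourse (?run t) (?run (Suc t))" for t
  have R: "L \<le> R t" if "even t" for t
  proof -
    have "t mod 4 = 0 \<or> t mod 4 = 2" using that by presburger
    then show ?thesis
      unfolding R_def alternating_run[of alg, OF a b] using cost by (auto simp: mod_Suc)
  qed
  \<comment> \<open>\<open>T + T mod 2\<close> is twice the number of even times below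
    \<open>T\<close>.\<close>
  have "real L * (real T + real (T mod 2)) / 2 \<le> (\<Sum>t<T. real (R t))" for T
  proof (induction T)
    case (Suc T)
    show ?case
    proof (cases "even T")
      case True
      then have "T mod 2 = 0" "Suc T mod 2 = 1" by presburger+
      then show ?thesis using Suc R[OF True] by (simp add: field_simps)
    next
      case False
      then have "T mod 2 = 1" "Suc T mod 2 = 0" by presburger+
      then show ?thesis using Suc by (simp add: field_simps)
    qed
  qed simp
  then have "real L * (real T + real (T mod 2)) / 2 \<le> (\<Sum>t<T. real (R t))" .
  moreover have "real L * real T / 2 \<le> real L * (real T + real (T mod 2)) / 2"
    by (simp add: field_simps)
  ultimately have "real L * real T / 2 \<le> (\<Sum>t<T. real (R t))" by linarith
  then show ?thesis using T unfolding amortized_recourse_def R_def by (simp add: field_simps)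
qed

context spine_tree
begin

abbreviation "spine_updates \<equiv> alternating_updates (e 0) (e m)"

lemma spine_updates_bad:
  assumes alg: "greedy_algorithm n \<Delta> (K - 1) adm alg" and odd: "odd m"
  shows "legal_updates n \<Delta> (dom X) spine_updates T"
    "1 \<le> T \<Longrightarrow> real (m - 1) / 2 \<le> amortized_recourse alg X spine_updates T"
proof -
  note L = insertion[OF alg odd]
  have em: "spine_edge enc' 0 = e m" using reflected_spine_edge[of m] by simp
  note R = spine_tree.insertion[OF reflected alg odd, unfolded double_reflection em dom_reflected[OF odd]]
  have ne: "e 0 \<notin> dom X" "e m \<notin> dom X"
    using e_not_dom spine_tree.e_not_dom[OF reflected] unfolding em dom_reflected[OF odd] by blast+
  show "legal_updates n \<Delta> (dom X) spine_updates T" by (rule alternating_legal[OF L(1) R(1) ne])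
  obtain s where s: "alg X (e 0) = X'(e 0 \<mapsto> s)" using L(3) by blast
  obtain r where r: "alg X' (e m) = X(e m \<mapsto> r)" using R(3) by blast
  have none: "X' (e 0) = None" "X (e m) = None" using ne dom_reflected[OF odd] by (metis domIff)+
  show "real (m - 1) / 2 \<le> amortized_recourse alg X spine_updates T" if "1 \<le> T"
    by (rule alternating_amortized[OF s none(1) r none(2) eq_refl[OF L(2)[symmetric]]
        eq_refl[OF R(2)[symmetric]] that])
qed

end

section \<open>Counting vertices and choosing the length of the spine\<close>

lemma sum_powers_le: "(\<Sum>i\<le>m. K ^ i) \<le> Suc K ^ m" for K m :: nat
proof (induction m)
  case (Suc m)
  have "K * K ^ m \<le> K * Suc K ^ m" by (intro mult_le_mono power_mono) auto
  from add_mono[OF Suc this] show ?case by simp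
qed simp

text \<open>Bounding the addresses by a power of K + 1 = c + 2 also covers \<open>K = 1\<close>,
  where powers of \<open>K\<close> do not grow. This is the origin of the base of the
  logarithm.\<close>

lemma card_vertices_le: "card (vertices K g m) \<le> (m + 2) * Suc K ^ m * Suc g"
proof -
  have "card (vertices K g m) = Suc (Suc m) * (\<Sum>i\<le>m. K ^ i) * Suc g"
    unfolding vertices_def card_cartesian_product by (simp add: card_lists_length_le algebra_simps)
  also have "\<dots> \<le> (m + 2) * Suc K ^ m * Suc g"
    by (intro mult_le_mono sum_powers_le) auto
  finally show ?thesis .
qed

lemma spine_tree_for:
  fixes \<Delta> c n :: nat
  assumes c: "3 \<le> \<Delta>" "c \<le> \<Delta> - 2"
    and L: "L = log (real c + 2) (real n / (real \<Delta> - real c))" "16 \<le> L"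
  obtains m enc where "spine_tree (Suc c) (\<Delta> - c - 2) m n enc" "odd m" "L / 8 \<le> real (m - 1) / 2"
    "enc ` vertices (Suc c) (\<Delta> - c - 2) m \<subseteq> {..<n div 2}"
proof -
  \<comment> \<open>With \<open>Suc c\<close> colors in each half this gives maximum degree \<Delta>
    and palette size \<Delta> + c; moreover g + 2 = \<Delta> - c is the denominator in the
    logarithm.\<close>
  define g where "g = \<Delta> - c - 2"
  \<comment> \<open>Chosen so that 2m + 2 = 4j + 4 \<le> L for the odd number m = 2j + 1. From L
    \<ge> 16 follows (m - 1) / 2 = j > (L - 8) / 4 \<ge> L / 8.\<close>
  define j where "j = nat \<lfloor>(L - 4) / 4\<rfloor>"
  define m where "m = 2 * j + 1"
  define N where "N = card (vertices (Suc c) g m)"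
  have j: "(L - 8) / 4 < real j" "real j \<le> (L - 4) / 4"
  proof -
    have "0 \<le> (L - 4) / 4" using L(2) by simp
    then have "real j = of_int \<lfloor>(L - 4) / 4\<rfloor>" by (simp add: j_def)
    then show "(L - 8) / 4 < real j" "real j \<le> (L - 4) / 4"
      using floor_correct[of "(L - 4) / 4"] by (auto simp: field_simps)
  qed
  have d: "real \<Delta> - real c = real (g + 2)" using c by (simp add: g_def of_nat_diff)
  \<comment> \<open>By the convention ln 0 = 0 the logarithm would be 0 for n = 0, below the
    threshold 16.\<close>
  have n0: "n \<noteq> 0"
  proof
    assume "n = 0"
    then have "L = 0" unfolding L(1) by (simp add: log_def)
    with L(2) show False by simp
  qed
  have pos: "0 < real n / real (g + 2)" using n0 by simp
  have "real (c + 2) ^ (2 * m + 2) = real (c + 2) powr real (2 * m + 2)" by (rule powr_realpow[symmetric]) simp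
  also have "\<dots> \<le> real (c + 2) powr L"
    by (rule powr_mono) (use j(2) in \<open>auto simp: m_def field_simps\<close>)
  also have "\<dots> = real n / real (g + 2)"
    unfolding L(1) d using pos powr_log_cancel[of "real c + 2" "real n / real (g + 2)"] by (simp add: add.commute)
  finally have "real (c + 2) ^ (2 * m + 2) \<le> real n / real (g + 2)" .
  moreover have "0 < real (g + 2)" by simp
  ultimately have "real (c + 2) ^ (2 * m + 2) * real (g + 2) \<le> real n"
    by (simp only: pos_le_divide_eq)
  then have "real ((c + 2) ^ (2 * m + 2) * (g + 2)) \<le> real n" by (simp only: of_nat_mult of_nat_power)
  then have size: "(c + 2) ^ (2 * m + 2) * (g + 2) \<le> n" unfolding of_nat_le_iff .
  have "2 * N \<le> 2 * ((m + 2) * Suc (Suc c) ^ m * Suc g)"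
    unfolding N_def using card_vertices_le[of "Suc c" g m] by simp
  also have "\<dots> = 2 * (m + 2) * (c + 2) ^ m * Suc g" by simp
  also have "\<dots> \<le> (c + 2) ^ (m + 2) * (c + 2) ^ m * (g + 2)"
  proof (intro mult_le_mono)
    \<comment> \<open>The extra factor (c + 2) ^ (m + 2) absorbs the number of spine vertices and
      the factor 2 for the reserve, hence the exponent 2m + 2.\<close>
    have "m + 2 \<le> 2 ^ (m + 1)" by (induction m) auto
    then have "2 * (m + 2) \<le> 2 ^ (m + 2)" by simp
    also have "\<dots> \<le> (c + 2) ^ (m + 2)" by (rule power_mono) auto
    finally show "2 * (m + 2) \<le> (c + 2) ^ (m + 2)" .
  qed auto
  also have "\<dots> = (c + 2) ^ (2 * m + 2) * (g + 2)"
  proof -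
    have "m + 2 + m = 2 * m + 2" by simp
    then show ?thesis by (simp only: power_add[symmetric])
  qed
  also have "\<dots> \<le> n" by (rule size)
  finally have N: "N \<le> n div 2" by simp
  obtain enc where enc: "bij_betw enc (vertices (Suc c) g m) {0..<N}"
    using ex_bij_betw_finite_nat[OF finite_vertices] unfolding N_def by blast
  have img: "enc ` vertices (Suc c) g m \<subseteq> {..<n div 2}"
    using enc N by (auto simp: bij_betw_def)
  have "spine_tree (Suc c) g m n enc"
  proof
    show "2 \<le> m" using j(1) L(2) by (simp add: m_def)
    show "inj_on enc (vertices (Suc c) g m)" using enc by (rule bij_betw_imp_inj_on)
    show "enc v < n" if "v \<in> vertices (Suc c) g m" for v
    proof -
      have "enc v < n div 2" using img that by auto
      then show ?thesis by simp
    qed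
  qed simp
  moreover have "odd m" by (simp add: m_def)
  moreover have "L / 8 \<le> real (m - 1) / 2" using j(1) L(2) by (simp add: m_def)
  ultimately show thesis using that img unfolding g_def by blast
qed

text \<open>The embedding uses only the lower half of the numbers below \<open>n\<close>, so the
  upper half is isolated and serves as the reserve for the gadgets.\<close>

lemma (in spine_tree) X_reachable:
  assumes alg: "greedy_algorithm n \<Delta> (K - 1) adm alg"
    and enc: "enc ` V \<subseteq> {..<n div 2}" and large: "2 * (gadget_size \<Delta> (K - 1) (\<Delta> - 1) + 2 * \<Delta>) \<le> n"
  shows "reachable_from_empty n \<Delta> alg X"
proof (rule greedy_algorithm.reach_empty[OF alg], rule greedy_algorithm.reach_leaf_built[OF alg X_leaf_built])
  have "\<Delta> + (K - 1) = \<kappa>" using K by simp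
  then show "colored_forest n \<Delta> (\<Delta> + (K - 1)) X" by (simp only: X_colored_forest)
  show "spare X {n div 2..<n}"
    unfolding spare_def X_dom
  proof
    fix f assume "f \<in> E ` Ks"
    then obtain v where v: "v \<in> Ks" "f = E v" by blast
    then have "f \<subseteq> {..<n div 2}" using child_in_V[OF v(1)] enc by (auto simp: parent_edge_def)
    then show "f \<inter> {n div 2..<n} = {}" by auto
  qed
  show "gadget_size \<Delta> (K - 1) (\<Delta> - 1) + 2 * \<Delta> \<le> card {n div 2..<n}" using large by simp
qed auto

text \<open>One state and one update sequence serve both algorithms, because the spine chain is a
  path and its cost bounds hold against all chains. The constants 1/8 and 16 are those of
  \<open>spine_tree_for\<close>.\<close>

theorem theorem3p14:
  shows "\<exists>(C::real)>0. \<exists>K::real. \<forall>\<Delta> c :: nat. 3 \<le> \<Delta> \<and> c \<le> \<Delta> - 2 \<longrightarrow>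
    (\<exists>n\<^sub>2::nat. \<forall>n::nat. \<forall>gs gp :: algorithm.
      (K \<le> log (real c + 2) (real n / (real \<Delta> - real c)) \<or> n\<^sub>2 \<le> n) \<and>
      greedy_shift n \<Delta> (\<Delta> + c) gs \<and> greedy_path n \<Delta> (\<Delta> + c) gp \<longrightarrow>
      (\<exists>\<phi> \<sigma>. colored_forest n \<Delta> (\<Delta> + c) \<phi> \<and>
        (\<forall>T. legal_updates n \<Delta> (dom \<phi>) \<sigma> T) \<and>
        (\<forall>T\<ge>1. C * log (real c + 2) (real n / (real \<Delta> - real c)) \<le> amortized_recourse gs \<phi> \<sigma> T) \<and>
        (\<forall>T\<ge>1. C * log (real c + 2) (real n / (real \<Delta> - real c)) \<le> amortized_recourse gp \<phi> \<sigma> T) \<and>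
        (n \<ge> n\<^sub>2 \<longrightarrow> reachable_from_empty n \<Delta> gs \<phi> \<and> reachable_from_empty n \<Delta> gp \<phi>)))"
proof (rule exI[of _ "1 / 8"], rule conjI, simp, rule exI[of _ 16], intro allI impI)
  fix \<Delta> c :: nat assume "3 \<le> \<Delta> \<and> c \<le> \<Delta> - 2"
  then have c: "3 \<le> \<Delta>" "c \<le> \<Delta> - 2" by auto
  define N where "N = 2 * (gadget_size \<Delta> c (\<Delta> - 1) + 2 * \<Delta>)"
  show "\<exists>n\<^sub>2::nat. \<forall>n::nat. \<forall>gs gp :: algorithm.
      (16 \<le> log (real c + 2) (real n / (real \<Delta> - real c)) \<or> n\<^sub>2 \<le> n) \<and>
      greedy_shift n \<Delta> (\<Delta> + c) gs \<and> greedy_path n \<Delta> (\<Delta> + c) gp \<longrightarrow>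
      (\<exists>\<phi> \<sigma>. colored_forest n \<Delta> (\<Delta> + c) \<phi> \<and>
        (\<forall>T. legal_updates n \<Delta> (dom \<phi>) \<sigma> T) \<and>
        (\<forall>T\<ge>1. 1 / 8 * log (real c + 2) (real n / (real \<Delta> - real c)) \<le> amortized_recourse gs \<phi> \<sigma> T) \<and>
        (\<forall>T\<ge>1. 1 / 8 * log (real c + 2) (real n / (real \<Delta> - real c)) \<le> amortized_recourse gp \<phi> \<sigma> T) \<and>
        (n \<ge> n\<^sub>2 \<longrightarrow> reachable_from_empty n \<Delta> gs \<phi> \<and> reachable_from_empty n \<Delta> gp \<phi>))"
  proof (intro exI[of _ "max N ((c + 2) ^ 16 * (\<Delta> - c))"] allI impI)
    fix n :: nat and gs gp :: algorithm
    let ?n\<^sub>2 = "max N ((c + 2) ^ 16 * (\<Delta> - c))"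
    define L where "L = log (real c + 2) (real n / (real \<Delta> - real c))"
    assume asm: "(16 \<le> log (real c + 2) (real n / (real \<Delta> - real c)) \<or> ?n\<^sub>2 \<le> n) \<and>
      greedy_shift n \<Delta> (\<Delta> + c) gs \<and> greedy_path n \<Delta> (\<Delta> + c) gp"
    \<comment> \<open>If \<open>n\<close> is only known to exceed the threshold, the second term of
      the maximum lifts the logarithm to 16; the first term provides the reserve for the
      gadgets.\<close>
    have L16: "16 \<le> L"
    proof (cases "?n\<^sub>2 \<le> n")
      case True
      have d: "0 < real (\<Delta> - c)" "real (\<Delta> - c) = real \<Delta> - real c" using c by auto
      have "(c + 2) ^ 16 * (\<Delta> - c) \<le> n" using True by simp
      then have "real ((c + 2) ^ 16 * (\<Delta> - c)) \<le> real n" unfolding of_nat_le_iff .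
      then have "(real c + 2) ^ 16 * real (\<Delta> - c) \<le> real n" by (simp add: add.commute)
      then have "(real c + 2) ^ 16 \<le> real n / (real \<Delta> - real c)"
        using d by (simp add: field_simps)
      then have "log (real c + 2) ((real c + 2) ^ 16) \<le> L" unfolding L_def
        by (intro log_mono) auto
      then show ?thesis by (simp add: log_nat_power)
    next
      case False
      then show ?thesis using asm unfolding L_def by blast
    qed
    obtain m enc where st: "spine_tree (Suc c) (\<Delta> - c - 2) m n enc" and odd: "odd m"
      and Lm: "L / 8 \<le> real (m - 1) / 2"
      and img: "enc ` vertices (Suc c) (\<Delta> - c - 2) m \<subseteq> {..<n div 2}"
      using spine_tree_for[OF c L_def L16] by blast
    have eqs: "Suc c + (\<Delta> - c - 2) + 1 = \<Delta>" "Suc c - 1 = c" "2 * Suc c + (\<Delta> - c - 2) = \<Delta> + c"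
      using c by auto
    have gs: "greedy_algorithm n \<Delta> c (\<lambda>es. True) gs" and gp: "greedy_algorithm n \<Delta> c form_path gp"
      using asm c by (auto simp: greedy_algorithm_def greedy_shift_def greedy_path_def)
    note bad = spine_tree.spine_updates_bad[OF st, unfolded eqs, OF _ odd]
    note reachable = spine_tree.X_reachable[OF st, unfolded eqs, OF _ img]
    show "\<exists>\<phi> \<sigma>. colored_forest n \<Delta> (\<Delta> + c) \<phi> \<and>
        (\<forall>T. legal_updates n \<Delta> (dom \<phi>) \<sigma> T) \<and>
        (\<forall>T\<ge>1. 1 / 8 * log (real c + 2) (real n / (real \<Delta> - real c)) \<le> amortized_recourse gs \<phi> \<sigma> T) \<and>
        (\<forall>T\<ge>1. 1 / 8 * log (real c + 2) (real n / (real \<Delta> - real c)) \<le> amortized_recourse gp \<phi> \<sigma> T) \<and>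
        (n \<ge> ?n\<^sub>2 \<longrightarrow> reachable_from_empty n \<Delta> gs \<phi> \<and> reachable_from_empty n \<Delta> gp \<phi>)"
      unfolding L_def[symmetric]
    proof (rule exI[of _ "tree_coloring (Suc c) (\<Delta> - c - 2) m enc"],
        rule exI[of _ "alternating_updates (spine_edge enc 0) (spine_edge enc m)"], intro conjI allI impI)
      show "colored_forest n \<Delta> (\<Delta> + c) (tree_coloring (Suc c) (\<Delta> - c - 2) m enc)"
        using spine_tree.X_colored_forest[OF st] unfolding eqs .
    next
      fix T :: nat assume T: "1 \<le> T"
      show "1 / 8 * L \<le> amortized_recourse gs (tree_coloring (Suc c) (\<Delta> - c - 2) m enc)
          (alternating_updates (spine_edge enc 0) (spine_edge enc m)) T"
        using bad(2)[OF gs T] Lm by linarith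
      show "1 / 8 * L \<le> amortized_recourse gp (tree_coloring (Suc c) (\<Delta> - c - 2) m enc)
          (alternating_updates (spine_edge enc 0) (spine_edge enc m)) T"
        using bad(2)[OF gp T] Lm by linarith
    next
      assume "?n\<^sub>2 \<le> n"
      then have large: "2 * (gadget_size \<Delta> c (\<Delta> - 1) + 2 * \<Delta>) \<le> n" by (simp add: N_def)
      show "reachable_from_empty n \<Delta> gs (tree_coloring (Suc c) (\<Delta> - c - 2) m enc)"
        by (rule reachable[OF gs large])
      show "reachable_from_empty n \<Delta> gp (tree_coloring (Suc c) (\<Delta> - c - 2) m enc)"
        by (rule reachable[OF gp large])
    qed (rule bad(1)[OF gs])
  qed
qed

end
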